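(* Let $n$ be a positive integer, let $h:[n]\to\{0,1,\dots,n-1\}$ be a Hessenberg function with $h(i)<i$ for all $i\in[n]$, let $\lambda$ be a weak composition of $n$, and let $w\in S_n$ be such that $R(w)\in \mathrm{RS}_h(\lambda)$. Suppose $V_\bullet=g_ng_{n-1}\cdots g_2wE_\bullet\in\mathcal{D}_w$, where $g_k\in B_k(w)$ for all $2\le k\le n$. (1) We have $V_\bullet\in \mathrm{Hess}(X_\lambda,h)$ if and only if $x_{w(k)w(\ell)}=0$ for all $(k,\ell)\in \mathrm{inv}_\lambda(w)\setminus \mathrm{inv}_{\lambda,h}(w)$, where $x_{w(k)w(\ell)}\in\mathbb{C}$ is the corresponding coordinate of $g_k$. (2) The isomorphism of varieties $\widetilde\varphi_w:\mathbb{C}^{d_w}\to C_w\cap\mathcal{B}^{X_\lambda}$ restricts to an isomorphism of varieties $\mathbb{C}^{d_{w,h}}\to C_w\cap \mathrm{Hess}(X_\lambda,h)$, where $d_{w,h}=|\mathrm{inv}_{\lambda,h}(w)|$ and $\mathbb{C}^{d_{w,h}}\subseteq\mathbb{C}^{d_w}$ is the coordinate subspace on which all coordinates indexed by $\mathrm{inv}_\lambda(w)\setminus\mathrm{inv}_{\lambda,h}(w)$ vanish. In particular, there is an affine paving of $\mathrm{Hess}(X_\lambda,h)$ whose affine cells are obtained by intersecting $\mathrm{Hess}(X_\lambda,h)$ with the Schubert cells.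
   Context: Notation: $[n]=\{1,\dots,n\}$; $\mathbf{e}_1,\dots,\mathbf{e}_n$ is the standard basis of $\mathbb{C}^n$; $E_{ab}$ is the elementary matrix with $E_{ab}\mathbf{e}_b=\mathbf{e}_a$; permutations $w\in S_n$ are identified with permutation matrices, $w\mathbf{e}_j=\mathbf{e}_{w(j)}$. $B\subset GL_n(\mathbb{C})$ is the group of upper triangular matrices. Flags: $\mathrm{Flags}(\mathbb{C}^n)\cong GL_n(\mathbb{C})/B$ is the variety of full flags $V_\bullet=(V_1\subset V_2\subset\cdots\subset V_n=\mathbb{C}^n)$, $\dim V_i=i$ (with $V_0=\{0\}$). One writes $V_\bullet=(\mathbf{v}_1\mid\cdots\mid\mathbf{v}_n)$ if $V_i=\mathrm{span}\{\mathbf{v}_1,\dots,\mathbf{v}_i\}$ for all $i$. $E_\bullet=(\mathbf{e}_1\mid\cdots\mid\mathbf{e}_n)$ and $gE_\bullet=(g\mathbf{e}_1\mid\cdots\mid g\mathbf{e}_n)$. The Schubert cell of $w$ is $C_w=BwE_\bullet$. Hessenberg varieties: a Hessenberg function is a nondecreasing function $h$ on $[n]$; here always $h(i)<i$. $\mathrm{Hess}(X,h)=\{V_\bullet: X(V_i)\subseteq V_{h(i)}\ \forall i\in[n]\}$. For nilpotent $X$, the Springer fiber is $\mathcal{B}^X=\{V_\bullet: X(V_i)\subseteq V_{i-1}\ \forall i\}$, i.e. the case $h=(0,1,\dots,n-1)$. All intersections with $C_w$ are regarded as reduced locally closed subvarieties of the flag variety. Tableaux: a weak composition $\lambda$ of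 $n$ (a finite sequence of nonnegative integers with sum $n$) is drawn as a left-justified diagram whose $i$-th row from the top has $\lambda_i$ boxes. The base filling $R(e)$ labels the boxes by $1,\dots,n$, column by column from the leftmost column to the right, and from bottom to top in each column. $X_\lambda=\sum E_{ab}$, summed over all pairs $(a,b)$ such that $b$ labels the box directly to the right of the box labeled $a$ in $R(e)$. For $w\in S_n$, $R(w)$ is the filling of $\lambda$ in which the box labeled $i$ in $R(e)$ is labeled $w^{-1}(i)$. $R(w)$ is $h$-strict if $\ell\le h(r)$ whenever $\ell$ labels the box directly to the left of the box labeled $r$ in $R(w)$; $\mathrm{RS}_h(\lambda)$ is the set of $h$-strict fillings. Inversions: $(k,\ell)$ with $k>\ell$ is a Hessenberg inversion of $R(w)$ if (i) $k$ occurs in a box below $\ell$ in the same column, or in any column strictly to the left of the column containing $\ell$, in $R(w)$, and (ii) if the box directly to the right of $\ell$ in $R(w)$ exists and is labeled $r$, then $k\le h(r)$. The set of these is $\mathrm{inv}_{\lambda,h}(w)$. For $h=(0,1,\dots,n-1)$ (condition (ii) becomes $k<r$) it is denoted $\mathrm{inv}_\lambda(w)$ (Springer inversions), and $\mathrm{inv}^k_\lambda(w)$ is the set of $(k,\ell)\in\mathrm{inv}_\lambda(w)$ with first entry $k$. Put $d_w=|\mathrm{inv}_\lambda(w)|$. Subgroups $B_k(w)$ (for $2\le k\le n$): $B_k(w)$ is the set of all $n\times n$ matrices $g_k$ for which there are scalars $x_{w(k)w(\ell)}\in\mathbb{C}$, one for each $(k,\ell)\in\mathrm{inv}_\lambda^k(w)$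 (the coordinates of $g_k$, which are arbitrary and determine $g_k$), such that for each $j\in[n]$: if $\mathbf{e}_{w(j)}=X_\lambda^m\mathbf{e}_{w(\ell)}$ for some $m\ge 0$ and some $(k,\ell)\in\mathrm{inv}_\lambda^k(w)$, then $g_k\mathbf{e}_{w(j)}=\mathbf{e}_{w(j)}+x_{w(k)w(\ell)}X_\lambda^m\mathbf{e}_{w(k)}$; otherwise $g_k\mathbf{e}_{w(j)}=\mathbf{e}_{w(j)}$. $\mathcal{D}_w=\{g_ng_{n-1}\cdots g_2wE_\bullet: g_k\in B_k(w)\text{ for } 2\le k\le n\}$. The map $\widetilde\varphi_w$: for $\mathbf{x}=(x_{w(k)w(\ell)})_{(k,\ell)\in\mathrm{inv}_\lambda(w)}\in\mathbb{C}^{d_w}$, $\widetilde\varphi_w(\mathbf{x})=g_ng_{n-1}\cdots g_2wE_\bullet$, where $g_k\in B_k(w)$ is the element with coordinates $(x_{w(k)w(\ell)})_{(k,\ell)\in\mathrm{inv}^k_\lambda(w)}$; it is an isomorphism of varieties $\mathbb{C}^{d_w}\to C_w\cap\mathcal{B}^{X_\lambda}$ with image $\mathcal{D}_w$ whenever rows of $R(w)$ are strictly increasing. Affine paving: a paving of a variety $Y$ is a filtration by closed subvarieties $Y_0\subset Y_1\subset\cdots\subset Y_d=Y$; it is affine if every $Y_i\setminus Y_{i-1}$ (with $Y_{-1}=\emptyset$) is isomorphic to a finite disjoint union of affine spaces, called the affine cells. *)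

theory Defs
  imports
    "HOL-Analysis.Sum_Topology"
    "HOL-Combinatorics.Permutations"
    "Jordan_Normal_Form.VS_Connect"
begin

section \<open>Varieties as spaces with functions\<close>

text \<open>
  A (reduced, complex) variety is given by its Zariski topology together with the sheaf of
  regular complex-valued functions. A function on an open set \<open>U\<close> is represented by a total
  function of which only the values on \<open>U\<close> matter.
\<close>

record 'a fun_space =
  ztop :: "'a topology"
  regular :: "'a set \<Rightarrow> ('a \<Rightarrow> complex) \<Rightarrow> bool"

definition morphism :: "'a fun_space \<Rightarrow> 'b fun_space \<Rightarrow> ('a \<Rightarrow> 'b) \<Rightarrow> bool" where
  "morphism X Y \<phi> \<longleftrightarrow>
     continuous_map (ztop X) (ztop Y) \<phi> \<and>
     (\<forall>V f. regular Y V f \<longrightarrow> regular X {x \<in> topspace (ztop X). \<phi> x \<in> V} (f \<circ> \<phi>))"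

definition variety_iso :: "'a fun_space \<Rightarrow> 'b fun_space \<Rightarrow> ('a \<Rightarrow> 'b) \<Rightarrow> bool" where
  "variety_iso X Y \<phi> \<longleftrightarrow>
     morphism X Y \<phi> \<and>
     (\<exists>\<psi>. morphism Y X \<psi> \<and>
          (\<forall>x \<in> topspace (ztop X). \<psi> (\<phi> x) = x) \<and>
          (\<forall>y \<in> topspace (ztop Y). \<phi> (\<psi> y) = y))"

inductive_set poly_funs :: "('a \<Rightarrow> complex) set \<Rightarrow> ('a \<Rightarrow> complex) set"
  for C :: "('a \<Rightarrow> complex) set" where
  const: "(\<lambda>_. c) \<in> poly_funs C"
| gen: "f \<in> C \<Longrightarrow> f \<in> poly_funs C"
| add: "f \<in> poly_funs C \<Longrightarrow> g \<in> poly_funs C \<Longrightarrow> (\<lambda>x. f x + g x) \<in> poly_funs C"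
| mult: "f \<in> poly_funs C \<Longrightarrow> g \<in> poly_funs C \<Longrightarrow> (\<lambda>x. f x * g x) \<in> poly_funs C"

definition zariski :: "('a \<Rightarrow> complex) set \<Rightarrow> 'a set \<Rightarrow> 'a topology" where
  "zariski C X = topology (\<lambda>U. \<exists>S \<subseteq> poly_funs C. U = {x \<in> X. \<exists>p \<in> S. p x \<noteq> 0})"

lemma istopology_zariski:
  "istopology (\<lambda>U. \<exists>S \<subseteq> poly_funs C. U = {x \<in> X. \<exists>p \<in> S. p x \<noteq> 0})" (is "istopology ?O")
  unfolding istopology_def
proof (intro conjI allI impI)
  fix U V assume "?O U" "?O V"
  then obtain S T where ST: "S \<subseteq> poly_funs C" "U = {x \<in> X. \<exists>p \<in> S. p x \<noteq> 0}"
    "T \<subseteq> poly_funs C" "V = {x \<in> X. \<exists>p \<in> T. p x \<noteq> 0}" by blast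
  let ?R = "{\<lambda>x. p x * q x | p q. p \<in> S \<and> q \<in> T}"
  have "?R \<subseteq> poly_funs C"
    using ST(1,3) by (auto intro!: poly_funs.mult)
  moreover have "U \<inter> V = {x \<in> X. \<exists>p \<in> ?R. p x \<noteq> 0}"
  proof (intro Set.set_eqI iffI)
    fix x assume "x \<in> U \<inter> V"
    then obtain p q where "x \<in> X" "p \<in> S" "p x \<noteq> 0" "q \<in> T" "q x \<noteq> 0"
      unfolding ST(2,4) by blast
    then show "x \<in> {x \<in> X. \<exists>p \<in> ?R. p x \<noteq> 0}"
      by (intro CollectI conjI bexI[of _ "\<lambda>x. p x * q x"]) auto
  next
    fix x assume "x \<in> {x \<in> X. \<exists>p \<in> ?R. p x \<noteq> 0}"
    then show "x \<in> U \<inter> V" unfolding ST(2,4) by auto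
  qed
  ultimately show "?O (U \<inter> V)" by (intro exI[of _ ?R] conjI)
next
  fix K assume "\<forall>U \<in> K. ?O U"
  then have "\<exists>S. \<forall>U \<in> K. S U \<subseteq> poly_funs C \<and> U = {x \<in> X. \<exists>p \<in> S U. p x \<noteq> 0}"
    by (rule bchoice)
  then obtain S where SU: "\<forall>U \<in> K. S U \<subseteq> poly_funs C \<and> U = {x \<in> X. \<exists>p \<in> S U. p x \<noteq> 0}"
    by (rule exE)
  note S = bspec[OF SU, THEN conjunct1] and U = bspec[OF SU, THEN conjunct2]
  have "\<Union>K = {x \<in> X. \<exists>p \<in> \<Union>(S ` K). p x \<noteq> 0}"
  proof (rule Set.set_eqI)
    fix x
    have "x \<in> \<Union>K \<longleftrightarrow> (\<exists>U \<in> K. x \<in> U)" by (rule Union_iff)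
    also have "\<dots> \<longleftrightarrow> (\<exists>U \<in> K. x \<in> {x \<in> X. \<exists>p \<in> S U. p x \<noteq> 0})"
      by (intro bex_cong refl arg_cong2[where f = "(\<in>)"] U)
    also have "\<dots> \<longleftrightarrow> x \<in> {x \<in> X. \<exists>p \<in> \<Union>(S ` K). p x \<noteq> 0}" by auto
    finally show "x \<in> \<Union>K \<longleftrightarrow> x \<in> {x \<in> X. \<exists>p \<in> \<Union>(S ` K). p x \<noteq> 0}" .
  qed
  moreover have "\<Union>(S ` K) \<subseteq> poly_funs C" using S by (rule UN_least)
  ultimately show "?O (\<Union>K)" by (intro exI[of _ "\<Union>(S ` K)"] conjI)
qed

lemma openin_zariski:
  "openin (zariski C X) U \<longleftrightarrow> (\<exists>S \<subseteq> poly_funs C. U = {x \<in> X. \<exists>p \<in> S. p x \<noteq> 0})"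
  by (simp add: zariski_def topology_inverse'[OF istopology_zariski])

lemma topspace_zariski [simp]: "topspace (zariski C X) = X"
proof -
  have "openin (zariski C X) X"
    unfolding openin_zariski
    by (rule exI[of _ "{\<lambda>_. 1}"]) (auto intro: poly_funs.const)
  moreover have "U \<subseteq> X" if "openin (zariski C X) U" for U
    using that by (auto simp: openin_zariski)
  ultimately show ?thesis
    by (meson openin_subset openin_topspace subset_antisym)
qed

text \<open>
  The quasi-affine variety \<open>X\<close> in the affine space whose coordinate functions are \<open>C\<close>:
  a regular function is locally a quotient of polynomials.
\<close>

definition quasi_affine :: "('a \<Rightarrow> complex) set \<Rightarrow> 'a set \<Rightarrow> 'a fun_space" where
  "quasi_affine C X = \<lparr>
     ztop = zariski C X,
     regular = (\<lambda>U f. openin (zariski C X) U \<and>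
       (\<forall>a \<in> U. \<exists>N p q. openin (zariski C X) N \<and> a \<in> N \<and> N \<subseteq> U \<and>
          p \<in> poly_funs C \<and> q \<in> poly_funs C \<and> (\<forall>x \<in> N. q x \<noteq> 0 \<and> f x = p x / q x))) \<rparr>"

text \<open>
  The affine space with one coordinate for each element of the finite set \<open>I\<close>. Points are
  extended by zero outside \<open>I\<close>, so for \<open>J \<subseteq> I\<close> the set \<open>affine_pts J\<close> is literally the
  coordinate subspace of \<open>affine_pts I\<close> on which the coordinates in \<open>I - J\<close> vanish.
\<close>

definition affine_pts :: "'i set \<Rightarrow> ('i \<Rightarrow> complex) set" where
  "affine_pts I = {x. \<forall>i. i \<notin> I \<longrightarrow> x i = 0}"

definition affine_space :: "'i set \<Rightarrow> ('i \<Rightarrow> complex) fun_space" where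
  "affine_space I = quasi_affine ((\<lambda>i x. x i) ` I) (affine_pts I)"

text \<open>Reduced structure induced on a locally closed subset.\<close>

definition subvariety :: "'a fun_space \<Rightarrow> 'a set \<Rightarrow> 'a fun_space" where
  "subvariety X Y = \<lparr>
     ztop = subtopology (ztop X) Y,
     regular = (\<lambda>U f. openin (subtopology (ztop X) Y) U \<and>
       (\<forall>a \<in> U. \<exists>N g. a \<in> N \<and> regular X N g \<and> (\<forall>x \<in> N \<inter> U. f x = g x))) \<rparr>"

definition disjoint_union :: "'j set \<Rightarrow> ('j \<Rightarrow> 'a fun_space) \<Rightarrow> ('j \<times> 'a) fun_space" where
  "disjoint_union J X = \<lparr>
     ztop = sum_topology (\<lambda>j. ztop (X j)) J,
     regular = (\<lambda>U f. openin (sum_topology (\<lambda>j. ztop (X j)) J) U \<and>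
       (\<forall>j \<in> J. regular (X j) {x. (j, x) \<in> U} (\<lambda>x. f (j, x)))) \<rparr>"

text \<open>
  \<open>Y\<close> is isomorphic to a finite disjoint union of affine spaces, and \<open>cells\<close> is the set of the
  images of these affine spaces in \<open>Y\<close>.
\<close>

definition affine_cells :: "'a fun_space \<Rightarrow> 'a set set \<Rightarrow> bool" where
  "affine_cells Y cells \<longleftrightarrow>
     (\<exists>(r :: nat) (m :: nat \<Rightarrow> nat) \<phi>.
        variety_iso (disjoint_union {..<r} (\<lambda>j. affine_space {..<m j})) Y \<phi> \<and>
        cells = (\<lambda>j. \<phi> ` ({j} \<times> affine_pts {..<m j})) ` {..<r})"

definition affine_paving :: "'a fun_space \<Rightarrow> nat \<Rightarrow> (nat \<Rightarrow> 'a set) \<Rightarrow> 'a set set \<Rightarrow> bool" where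
  "affine_paving Y d Z cells \<longleftrightarrow>
     (\<forall>i \<le> d. closedin (ztop Y) (Z i)) \<and>
     (\<forall>i < d. Z i \<subseteq> Z (Suc i)) \<and>
     Z d = topspace (ztop Y) \<and>
     (\<exists>cs. cells = (\<Union>i \<le> d. cs i) \<and>
        (\<forall>i \<le> d. affine_cells (subvariety Y (Z i - (if i = 0 then {} else Z (i - 1)))) (cs i)))"

section \<open>Flags\<close>

text \<open>
  Vectors and matrices of the library are indexed from 0, whereas basis vectors, matrix entries
  \<open>E\<^sub>a\<^sub>b\<close> and permutations below are indexed by \<open>{1..n}\<close>.
\<close>

abbreviation Cn :: "nat \<Rightarrow> (complex, complex vec) module" where
  "Cn n \<equiv> module_vec TYPE(complex) n"

definition vspan :: "nat \<Rightarrow> complex vec set \<Rightarrow> complex vec set" where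
  "vspan n S = LinearCombinations.module.span class_ring (Cn n) S"

definition vdim :: "nat \<Rightarrow> complex vec set \<Rightarrow> nat" where
  "vdim n W = vectorspace.dim class_ring (Cn n\<lparr>carrier := W\<rparr>)"

definition std_basis :: "nat \<Rightarrow> nat \<Rightarrow> complex vec" where
  "std_basis n i = unit_vec n (i - 1)"

definition elem_mat :: "nat \<Rightarrow> nat \<Rightarrow> nat \<Rightarrow> complex mat" where
  "elem_mat n a b = mat n n (\<lambda>(i, j). if Suc i = a \<and> Suc j = b then 1 else 0)"

definition perm_mat :: "nat \<Rightarrow> (nat \<Rightarrow> nat) \<Rightarrow> complex mat" where
  "perm_mat n w = mat n n (\<lambda>(i, j). if Suc i = w (Suc j) then 1 else 0)"

definition GL :: "nat \<Rightarrow> complex mat set" where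
  "GL n = {g \<in> carrier_mat n n. invertible_mat g}"

definition Borel :: "nat \<Rightarrow> complex mat set" where
  "Borel n = {g \<in> GL n. upper_triangular g}"

text \<open>
  A flag is recorded with \<open>V 0\<close>, and is \<open>undefined\<close> outside \<open>{0..n}\<close> so that flags are equal
  iff they have the same members.
\<close>

definition Flags :: "nat \<Rightarrow> (nat \<Rightarrow> complex vec set) set" where
  "Flags n = {V \<in> extensional {0..n}.
     (\<forall>i \<le> n. VectorSpace.subspace class_ring (V i) (Cn n) \<and> vdim n (V i) = i) \<and>
     (\<forall>i < n. V i \<subset> V (Suc i))}"

text \<open>The flag \<open>g E\<^sub>\<bullet> = (g e\<^sub>1 | \<dots> | g e\<^sub>n)\<close>.\<close>

definition flag_of :: "nat \<Rightarrow> complex mat \<Rightarrow> nat \<Rightarrow> complex vec set" where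
  "flag_of n g = (\<lambda>i \<in> {0..n}. vspan n ((\<lambda>j. g *\<^sub>v std_basis n j) ` {1..i}))"

definition schubert_cell :: "nat \<Rightarrow> (nat \<Rightarrow> nat) \<Rightarrow> (nat \<Rightarrow> complex vec set) set" where
  "schubert_cell n w = {flag_of n (b * perm_mat n w) | b. b \<in> Borel n}"

definition GL_variety :: "nat \<Rightarrow> complex mat fun_space" where
  "GL_variety n = quasi_affine {\<lambda>A. A $$ (i, j) | i j. i < n \<and> j < n} (GL n)"

text \<open>
  The flag variety as the quotient variety \<open>GL\<^sub>n/B\<close>, via \<open>g B \<mapsto> g E\<^sub>\<bullet>\<close>: open sets and regular
  functions are those whose pullbacks to \<open>GL\<^sub>n\<close> are open and regular, respectively.
\<close>

definition flag_top :: "nat \<Rightarrow> (nat \<Rightarrow> complex vec set) topology" where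
  "flag_top n = topology (\<lambda>U. U \<subseteq> Flags n \<and>
     openin (ztop (GL_variety n)) {g \<in> GL n. flag_of n g \<in> U})"

definition flag_variety :: "nat \<Rightarrow> (nat \<Rightarrow> complex vec set) fun_space" where
  "flag_variety n = \<lparr>
     ztop = flag_top n,
     regular = (\<lambda>U f. openin (flag_top n) U \<and>
       regular (GL_variety n) {g \<in> GL n. flag_of n g \<in> U} (f \<circ> flag_of n)) \<rparr>"

lemma openin_flag_top:
  "openin (flag_top n) U \<longleftrightarrow>
     U \<subseteq> Flags n \<and> openin (ztop (GL_variety n)) {g \<in> GL n. flag_of n g \<in> U}"
proof -
  let ?T = "ztop (GL_variety n)" and ?P = "\<lambda>U. {g \<in> GL n. flag_of n g \<in> U}"
  have "istopology (\<lambda>U. U \<subseteq> Flags n \<and> openin ?T (?P U))"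
    unfolding istopology_def
  proof (intro conjI allI impI)
    fix U V assume "U \<subseteq> Flags n \<and> openin ?T (?P U)" "V \<subseteq> Flags n \<and> openin ?T (?P V)"
    moreover have "?P (U \<inter> V) = ?P U \<inter> ?P V" by blast
    ultimately show "U \<inter> V \<subseteq> Flags n" "openin ?T (?P (U \<inter> V))"
      by (simp_all only: openin_Int) (rule le_infI1, simp)
  next
    fix K assume K: "\<forall>U \<in> K. U \<subseteq> Flags n \<and> openin ?T (?P U)"
    then show "\<Union>K \<subseteq> Flags n" by blast
    have "?P (\<Union>K) = (\<Union>U \<in> K. ?P U)" by blast
    moreover have "openin ?T (\<Union>U \<in> K. ?P U)" using K by (intro openin_Union) auto
    ultimately show "openin ?T (?P (\<Union>K))" by (simp only:)
  qed
  then show ?thesis by (simp add: flag_top_def topology_inverse')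
qed

section \<open>Hessenberg varieties\<close>

definition hessenberg_fun :: "nat \<Rightarrow> (nat \<Rightarrow> nat) \<Rightarrow> bool" where
  "hessenberg_fun n h \<longleftrightarrow> mono_on {1..n} h \<and> (\<forall>i \<in> {1..n}. h i < i)"

definition Hess :: "nat \<Rightarrow> complex mat \<Rightarrow> (nat \<Rightarrow> nat) \<Rightarrow> (nat \<Rightarrow> complex vec set) set" where
  "Hess n X h = {V \<in> Flags n. \<forall>i \<in> {1..n}. (\<lambda>v. X *\<^sub>v v) ` V i \<subseteq> V (h i)}"

definition springer_fun :: "nat \<Rightarrow> nat" where
  "springer_fun i = i - 1"

abbreviation springer_fiber :: "nat \<Rightarrow> complex mat \<Rightarrow> (nat \<Rightarrow> complex vec set) set" where
  "springer_fiber n X \<equiv> Hess n X springer_fun"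

section \<open>Tableaux and inversions\<close>

text \<open>
  A box is a pair (row, column), both counted from 0; rows are counted from the top.
\<close>

definition boxes :: "nat list \<Rightarrow> (nat \<times> nat) set" where
  "boxes lam = {(r, c). r < length lam \<and> c < lam ! r}"

definition base_label :: "nat list \<Rightarrow> nat \<times> nat \<Rightarrow> nat" where
  "base_label lam = (\<lambda>(r, c).
     card {(r', c') \<in> boxes lam. c' < c \<or> (c' = c \<and> r \<le> r')})"

definition X_mat :: "nat \<Rightarrow> nat list \<Rightarrow> complex mat" where
  "X_mat n lam = mat n n (\<lambda>ij. \<Sum>(a, b) \<in> {(base_label lam (r, c), base_label lam (r, Suc c)) | r c.
       (r, c) \<in> boxes lam \<and> (r, Suc c) \<in> boxes lam}. elem_mat n a b $$ ij)"

text \<open>\<open>R_filling lam w\<close> is the filling \<open>R(w)\<close>.\<close>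

definition R_filling :: "nat list \<Rightarrow> (nat \<Rightarrow> nat) \<Rightarrow> nat \<times> nat \<Rightarrow> nat" where
  "R_filling lam w = (\<lambda>p \<in> boxes lam. inv_into UNIV w (base_label lam p))"

definition h_strict :: "(nat \<Rightarrow> nat) \<Rightarrow> nat list \<Rightarrow> (nat \<times> nat \<Rightarrow> nat) \<Rightarrow> bool" where
  "h_strict h lam T \<longleftrightarrow>
     (\<forall>r c. (r, c) \<in> boxes lam \<and> (r, Suc c) \<in> boxes lam \<longrightarrow> T (r, c) \<le> h (T (r, Suc c)))"

definition RS :: "(nat \<Rightarrow> nat) \<Rightarrow> nat list \<Rightarrow> (nat \<times> nat \<Rightarrow> nat) set" where
  "RS h lam = {T. (\<exists>w. w permutes {1..sum_list lam} \<and> T = R_filling lam w) \<and> h_strict h lam T}"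

definition hess_inv :: "nat list \<Rightarrow> (nat \<Rightarrow> nat) \<Rightarrow> (nat \<Rightarrow> nat) \<Rightarrow> (nat \<times> nat) set" where
  "hess_inv lam h w = {(k, l). k > l \<and>
     (\<exists>r c r' c'. (r, c) \<in> boxes lam \<and> (r', c') \<in> boxes lam \<and>
        R_filling lam w (r, c) = k \<and> R_filling lam w (r', c') = l \<and>
        ((c = c' \<and> r > r') \<or> c < c') \<and>
        ((r', Suc c') \<in> boxes lam \<longrightarrow> k \<le> h (R_filling lam w (r', Suc c'))))}"

definition springer_inv :: "nat list \<Rightarrow> (nat \<Rightarrow> nat) \<Rightarrow> (nat \<times> nat) set" where
  "springer_inv lam w = hess_inv lam springer_fun w"

section \<open>The subgroups and the parametrization\<close>

text \<open>
  \<open>has_coords n lam w k x g\<close>: \<open>g\<close> is the element of \<open>B\<^sub>k(w)\<close> whose coordinate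
  \<open>x\<^bsub>w(k)w(l)\<^esub>\<close> is \<open>x (k, l)\<close>, for every \<open>(k, l) \<in> inv\<^sup>k\<close>. Coordinates are thus indexed by the
  inversion \<open>(k, l)\<close> itself rather than by \<open>(w k, w l)\<close>.
\<close>

definition has_coords ::
  "nat \<Rightarrow> nat list \<Rightarrow> (nat \<Rightarrow> nat) \<Rightarrow> nat \<Rightarrow> (nat \<times> nat \<Rightarrow> complex) \<Rightarrow> complex mat \<Rightarrow> bool" where
  "has_coords n lam w k x g \<longleftrightarrow> g \<in> carrier_mat n n \<and>
     (\<forall>j \<in> {1..n}.
        (\<forall>m l. (k, l) \<in> springer_inv lam w \<and>
           std_basis n (w j) = (X_mat n lam ^\<^sub>m m) *\<^sub>v std_basis n (w l) \<longrightarrow>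
           g *\<^sub>v std_basis n (w j) =
             std_basis n (w j) + x (k, l) \<cdot>\<^sub>v ((X_mat n lam ^\<^sub>m m) *\<^sub>v std_basis n (w k))) \<and>
        ((\<nexists>m l. (k, l) \<in> springer_inv lam w \<and>
           std_basis n (w j) = (X_mat n lam ^\<^sub>m m) *\<^sub>v std_basis n (w l)) \<longrightarrow>
           g *\<^sub>v std_basis n (w j) = std_basis n (w j)))"

definition B_sub :: "nat \<Rightarrow> nat list \<Rightarrow> (nat \<Rightarrow> nat) \<Rightarrow> nat \<Rightarrow> complex mat set" where
  "B_sub n lam w k = {g. \<exists>x. has_coords n lam w k x g}"

text \<open>The product \<open>g\<^sub>n g\<^sub>n\<^sub>-\<^sub>1 \<dots> g\<^sub>2 w\<close>.\<close>

definition gprod :: "nat \<Rightarrow> (nat \<Rightarrow> nat) \<Rightarrow> (nat \<Rightarrow> complex mat) \<Rightarrow> complex mat" where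
  "gprod n w g = fold (\<lambda>k A. g k * A) [2..<Suc n] (perm_mat n w)"

definition D_set :: "nat \<Rightarrow> nat list \<Rightarrow> (nat \<Rightarrow> nat) \<Rightarrow> (nat \<Rightarrow> complex vec set) set" where
  "D_set n lam w = {flag_of n (gprod n w g) | g. \<forall>k \<in> {2..n}. g k \<in> B_sub n lam w k}"

definition phi_map ::
  "nat \<Rightarrow> nat list \<Rightarrow> (nat \<Rightarrow> nat) \<Rightarrow> (nat \<times> nat \<Rightarrow> complex) \<Rightarrow> nat \<Rightarrow> complex vec set" where
  "phi_map n lam w x = flag_of n (gprod n w (\<lambda>k. THE g. has_coords n lam w k x g))"

end

theory Submission
  imports Defs
begin

text \<open>
  After conjugation by \<open>w\<close> the coordinates are indexed by the labels of \<open>R(w)\<close>, \<open>X\<close> becomes the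
  matrix \<open>Y\<close> that moves a label to its left neighbour, and \<open>g\<^sub>k\<close> becomes \<open>H\<^sub>k = 1 + N\<^sub>k\<close>, where \<open>N\<^sub>k\<close>
  has square zero and commutes with \<open>Y\<close> on the span of the labels up to \<open>k\<close>. Hence, for
  \<open>H = H\<^sub>n \<dots> H\<^sub>2\<close> and \<open>l\<close> the left neighbour of \<open>r\<close>, the column \<open>H\<inverse> Y H e\<^sub>r\<close> is the product of
  \<open>H\<^sub>2\<inverse> \<dots> H\<^sub>r\<inverse>\<close> with \<open>e\<^sub>l\<close>, and the Hessenberg condition on it says that \<open>x\<^sub>k\<^sub>l\<close> vanishes for
  \<open>h r < k < r\<close>.

  A flag of the Springer fiber in the cell of \<open>w\<close> is factored by splitting off \<open>H\<^sub>n, H\<^sub>n\<^sub>-\<^sub>1, \<dots>\<close>; the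
  coordinates of \<open>H\<^sub>k\<close> form a row of an inverse matrix, and invariance under \<open>Y\<close> makes that row vanish
  off the inversions. They are polynomials in the entries of the reduced matrix of the flag, which
  are ratios of minors and thus regular on an open neighbourhood of the cell (a translate of the big
  cell).

  This neighbourhood of the cell of \<open>w\<close> meets the cell of \<open>v\<close> only if all partial sums of \<open>w\<close> are
  bounded by those of \<open>v\<close>. So the cells listed by increasing sum of the partial sums form a paving.
\<close>

section \<open>Linear algebra\<close>

text \<open>The obstacle is that \<open>H_k\<close> and \<open>Y\<close> do not commute as matrices:
  if \<open>(k, l)\<close> is an inversion and \<open>r\<close> is the right neighbour of
  \<open>l\<close>, then \<open>Y\<close> maps \<open>e_r\<close> to \<open>e_l\<close>, which
  \<open>N_k\<close> sends to a multiple of \<open>e_k\<close>, while \<open>N_k e_r = 0\<close>. As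
  \<open>k < r\<close>, this failure disappears on the labels up to \<open>k\<close>. That is
  enough, because in column \<open>r\<close> each factor above \<open>r\<close> meets only vectors
  supported on labels below its own index. The descending order of the factors is adapted to this.
  Regularity on the flag variety is tested after pull-back to \<open>GL n\<close>. The inverse of
  the parametrization must therefore be built from expressions that are constant on cosets
  \<open>g B\<close>. Two minors with the same leading columns change by the same factor, so their
  ratio has this property. The paving also has to treat permutations whose filling is not
  \<open>h\<close>-strict; a comparison of leading terms shows that their cells miss the Hessenberg
  variety. The partial sums come from a nonzero Leibniz term of a minor: its factors bound the
  positions of \<open>w\<close> by positions of \<open>v\<close>, up to an unknown permutation that
  disappears on summing.\<close>

lemma mult_mat_entry:
  fixes A B :: "'a :: semiring_0 mat"
  assumes "A \<in> carrier_mat m n" "B \<in> carrier_mat n k" "i < m" "j < k"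
  shows "(A * B) $$ (i, j) = (\<Sum>l<n. A $$ (i, l) * B $$ (l, j))"
  using assms by (simp add: scalar_prod_def atLeast0LessThan)

lemma mult_mat_vec_entry:
  fixes A :: "'a :: semiring_0 mat"
  assumes "A \<in> carrier_mat m n" "v \<in> carrier_vec n" "i < m"
  shows "(A *\<^sub>v v) $ i = (\<Sum>l<n. A $$ (i, l) * v $ l)"
  using assms by (simp add: scalar_prod_def atLeast0LessThan)

lemma mult_mat_unit_vec:
  fixes A :: "'a :: semiring_1 mat"
  assumes "A \<in> carrier_mat m n" "j < n"
  shows "A *\<^sub>v unit_vec n j = col A j"
  by (rule eq_vecI) (use assms in \<open>auto simp: col_def\<close>)

lemma GL_iff_det: "A \<in> GL n \<longleftrightarrow> A \<in> carrier_mat n n \<and> det A \<noteq> 0"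
proof safe
  assume A: "A \<in> GL n"
  then show c: "A \<in> carrier_mat n n" by (simp add: GL_def)
  from A obtain B where B: "A * B = 1\<^sub>m n" "B * A = 1\<^sub>m (dim_row B)"
    using c by (auto simp: GL_def invertible_mat_def inverts_mat_def)
  have "dim_col (A * B) = n" using B(1) by simp
  then have "dim_col B = n" by simp
  moreover have "dim_col (B * A) = dim_row B" using B(2) by simp
  then have "dim_row B = n" using c by simp
  ultimately have "B \<in> carrier_mat n n" by auto
  then have "det A * det B = 1" using det_mult[OF c] B(1) by (metis det_one)
  then show "det A = 0 \<Longrightarrow> False" by simp
next
  assume A: "A \<in> carrier_mat n n" "det A \<noteq> 0"
  then have "A \<in> Units (ring_mat TYPE(complex) n ())" by (rule det_non_zero_imp_unit)
  then show "A \<in> GL n" using A(1)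
    by (auto simp: Units_def ring_mat_simps GL_def invertible_mat_def inverts_mat_def)
qed

lemma GL_inverse:
  assumes "A \<in> GL n"
  obtains B where "B \<in> GL n" "A * B = 1\<^sub>m n" "B * A = 1\<^sub>m n"
proof -
  have A: "A \<in> carrier_mat n n" "det A \<noteq> 0" using assms by (auto simp: GL_iff_det)
  then have "A \<in> Units (ring_mat TYPE(complex) n ())" by (rule det_non_zero_imp_unit)
  then obtain B where B: "B \<in> carrier_mat n n" "A * B = 1\<^sub>m n" "B * A = 1\<^sub>m n"
    by (auto simp: Units_def ring_mat_simps)
  have "det A * det B = 1" using det_mult[OF A(1) B(1)] B(2) by simp
  then have "B \<in> GL n" using B(1) by (auto simp: GL_iff_det)
  with B that show thesis by blast
qed

lemma GL_carrier: "A \<in> GL n \<Longrightarrow> A \<in> carrier_mat n n"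
  by (simp add: GL_def)

lemma GL_mult: "A \<in> GL n \<Longrightarrow> B \<in> GL n \<Longrightarrow> A * B \<in> GL n"
  by (auto simp: GL_iff_det det_mult)

section \<open>Matrices that are triangular for a permuted order\<close>

definition tri :: "nat \<Rightarrow> (nat \<Rightarrow> nat) \<Rightarrow> complex mat \<Rightarrow> bool" where
  "tri n p A \<longleftrightarrow> A \<in> carrier_mat n n \<and> (\<forall>a<n. \<forall>b<n. p b < p a \<longrightarrow> A $$ (a, b) = 0)"

lemma triD: "tri n p A \<Longrightarrow> a < n \<Longrightarrow> b < n \<Longrightarrow> p b < p a \<Longrightarrow> A $$ (a, b) = 0"
  by (simp add: tri_def)

lemma tri_carrier: "tri n p A \<Longrightarrow> A \<in> carrier_mat n n"
  by (simp add: tri_def)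

lemma tri_mult_diag:
  assumes p: "inj_on p {..<n}" and A: "tri n p A" and B: "tri n p B" and a: "a < n"
  shows "(A * B) $$ (a, a) = A $$ (a, a) * B $$ (a, a)"
proof -
  have "A $$ (a, c) * B $$ (c, a) = 0" if c: "c < n" "c \<noteq> a" for c
  proof -
    have "p c \<noteq> p a" using c a p by (auto dest: inj_onD)
    then have "p c < p a \<or> p a < p c" by auto
    then show ?thesis using triD[OF A a c(1)] triD[OF B c(1) a] by auto
  qed
  then have "(\<Sum>c<n. A $$ (a, c) * B $$ (c, a)) = (\<Sum>c\<in>{a}. A $$ (a, c) * B $$ (c, a))"
    using a by (intro sum.mono_neutral_right) auto
  then show ?thesis using a A B by (simp add: mult_mat_entry[of _ n n _ n] tri_carrier)
qed

lemma tri_mult: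
  assumes A: "tri n p A" and B: "tri n p B"
  shows "tri n p (A * B)"
  unfolding tri_def
proof (intro conjI allI impI)
  show "A * B \<in> carrier_mat n n" using A B by (auto simp: tri_def)
  fix a b assume ab: "a < n" "b < n" "p b < p a"
  have "A $$ (a, c) * B $$ (c, b) = 0" if c: "c < n" for c
    using triD[OF A ab(1) c] triD[OF B c ab(2)] ab(3) by (cases "p c < p a") auto
  then have "(\<Sum>c<n. A $$ (a, c) * B $$ (c, b)) = 0" by (intro sum.neutral) auto
  then show "(A * B) $$ (a, b) = 0"
    using ab mult_mat_entry[OF tri_carrier[OF A] tri_carrier[OF B]] by simp
qed

text \<open>Column by column in the order \<open>p\<close>: in the entry \<open>(a, b)\<close> of
  \<open>B * A = 1\<close> the terms from columns before \<open>b\<close> vanish by induction and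
  those from later ones by triangularity of \<open>A\<close>, which leaves
  \<open>B $$ (a, b) * A $$ (b, b)\<close>.\<close>

lemma tri_inverse:
  assumes p: "inj_on p {..<n}" and A: "tri n p A" and diag: "\<And>a. a < n \<Longrightarrow> A $$ (a, a) \<noteq> 0"
    and B: "B \<in> carrier_mat n n" and BA: "B * A = 1\<^sub>m n"
  shows "tri n p B"
  unfolding tri_def
proof (intro conjI allI impI B)
  fix a b assume ab: "a < n" "b < n" "p b < p a"
  then show "B $$ (a, b) = 0"
  proof (induction "p b" arbitrary: b rule: less_induct)
    case less
    have "B $$ (a, c) * A $$ (c, b) = 0" if c: "c < n" "c \<noteq> b" for c
    proof (cases "p c < p b")
      case True
      then show ?thesis using less c by simp
    next
      case False
      moreover have "p c \<noteq> p b" using c less p by (auto dest: inj_onD)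
      ultimately show ?thesis using triD[OF A c(1) less.prems(2)] by simp
    qed
    then have "(\<Sum>c<n. B $$ (a, c) * A $$ (c, b)) = (\<Sum>c\<in>{b}. B $$ (a, c) * A $$ (c, b))"
      using less by (intro sum.mono_neutral_right) auto
    moreover have "(\<Sum>c<n. B $$ (a, c) * A $$ (c, b)) = (1\<^sub>m n :: complex mat) $$ (a, b)"
      unfolding BA[symmetric] using less A B by (simp add: mult_mat_entry[of _ n n _ n] tri_carrier)
    moreover have "a \<noteq> b" using less.prems by auto
    ultimately show ?case using less.prems diag[of b] by simp
  qed
qed

lemma upper_triangular_iff_tri:
  "A \<in> carrier_mat n n \<Longrightarrow> upper_triangular A \<longleftrightarrow> tri n (\<lambda>a. a) A"
  by (auto simp: upper_triangular_def tri_def)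

lemma GL_tri_diag:
  assumes "A \<in> GL n" "tri n (\<lambda>a. a) A" "a < n"
  shows "A $$ (a, a) \<noteq> 0"
proof -
  have A: "A \<in> carrier_mat n n" using assms by (simp add: GL_carrier)
  have "prod_list (diag_mat A) \<noteq> 0"
    using assms A det_upper_triangular[OF _ A] by (simp add: upper_triangular_iff_tri GL_iff_det)
  then show ?thesis using assms(3) A by (auto simp: diag_mat_def prod_list_zero_iff)
qed

lemma Borel_iff: "b \<in> Borel n \<longleftrightarrow> b \<in> GL n \<and> tri n (\<lambda>a. a) b"
  unfolding Borel_def using upper_triangular_iff_tri GL_carrier by blast

section \<open>Flags\<close>

text \<open>The \<open>i\<close>-th member of the standard flag, written by vanishing coordinates so
  that inclusions become zero patterns of matrices.\<close>

definition fsub :: "nat \<Rightarrow> nat \<Rightarrow> complex vec set" where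
  "fsub n i = {u \<in> carrier_vec n. \<forall>j<n. i \<le> j \<longrightarrow> u $ j = 0}"

lemma fsub_carrier: "u \<in> fsub n i \<Longrightarrow> u \<in> carrier_vec n"
  by (simp add: fsub_def)

lemma unit_vec_fsub: "j < i \<Longrightarrow> unit_vec n j \<in> fsub n i"
  by (auto simp: fsub_def unit_vec_def)

lemma fsub_Suc_decompose:
  assumes "u \<in> fsub n (Suc i)" "i < n"
  shows "u + (- u $ i) \<cdot>\<^sub>v unit_vec n i \<in> fsub n i"
  using assms unfolding fsub_def
proof (intro CollectI conjI allI impI)
  show "u + (- u $ i) \<cdot>\<^sub>v unit_vec n i \<in> carrier_vec n" using assms by (simp add: fsub_def)
  fix j assume j: "j < n" "i \<le> j"
  then show "(u + (- u $ i) \<cdot>\<^sub>v unit_vec n i) $ j = 0"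
    using assms by (cases "j = i") (auto simp: fsub_def)
qed

text \<open>Peels off the last admissible coordinate, so that claims linear in the vector reduce to
  unit vectors.\<close>

lemma fsub_induct:
  assumes u: "u \<in> fsub n i" "i \<le> n" and zero: "P (0\<^sub>v n)"
    and add: "\<And>v c j. v \<in> carrier_vec n \<Longrightarrow> P v \<Longrightarrow> j < i \<Longrightarrow> P (v + c \<cdot>\<^sub>v unit_vec n j)"
  shows "P u"
  using u add
proof (induction i arbitrary: u)
  case 0
  then have "u = 0\<^sub>v n" by (intro eq_vecI) (auto simp: fsub_def)
  then show ?case using zero by simp
next
  case (Suc i)
  let ?v = "u + (- u $ i) \<cdot>\<^sub>v unit_vec n i"
  have v: "?v \<in> fsub n i" using fsub_Suc_decompose Suc.prems(1,2) by auto
  have "P ?v"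
  proof (rule Suc.IH[OF v])
    show "i \<le> n" using Suc.prems(2) by simp
    show "P (w + c \<cdot>\<^sub>v unit_vec n j)"
      if "w \<in> carrier_vec n" "P w" "j < i" for w c j
      by (rule Suc.prems(3)) (use that in simp_all)
  qed
  then have "P (?v + u $ i \<cdot>\<^sub>v unit_vec n i)"
    by (rule Suc.prems(3)[OF fsub_carrier[OF v]]) simp
  moreover have "?v + u $ i \<cdot>\<^sub>v unit_vec n i = u"
    using Suc.prems(1,2) by (intro eq_vecI) (auto simp: fsub_def)
  ultimately show ?case by simp
qed

lemma flag_of_columns:
  assumes "g \<in> carrier_mat n n" "i \<le> n"
  shows "flag_of n g i = vspan n (col g ` {..<i})"
proof -
  have "(\<lambda>j. g *\<^sub>v std_basis n j) ` {1..i} = (\<lambda>j. g *\<^sub>v std_basis n (Suc j)) ` {..<i}"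
    unfolding image_Suc_lessThan[symmetric] image_image ..
  also have "\<dots> = col g ` {..<i}"
    using assms by (intro image_cong) (auto simp: std_basis_def mult_mat_unit_vec)
  finally show ?thesis using assms by (simp add: flag_of_def)
qed

lemma vspan_eq_span: "vspan n S = LinearCombinations.module.span class_ring (Cn n) S"
  by (simp add: vspan_def)

lemma flag_of_eq:
  assumes g: "g \<in> carrier_mat n n" and i: "i \<le> n"
  shows "flag_of n g i = (\<lambda>u. g *\<^sub>v u) ` fsub n i"
proof -
  interpret vec_space "TYPE(complex)" n .
  let ?S = "col g ` {..<i}"
  have S: "?S \<subseteq> carrier_vec n" using g by auto
  have sub: "submodule class_ring (span ?S) (Cn n)" using S by (intro span_is_submodule) auto
  have "span ?S \<subseteq> (\<lambda>u. g *\<^sub>v u) ` fsub n i"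
  proof (rule span_is_subset)
    show "?S \<subseteq> (\<lambda>u. g *\<^sub>v u) ` fsub n i"
    proof
      fix v assume "v \<in> ?S"
      then obtain j where j: "j < i" "v = col g j" by auto
      then show "v \<in> (\<lambda>u. g *\<^sub>v u) ` fsub n i"
        using g i by (intro image_eqI[of _ _ "unit_vec n j"]) (auto simp: mult_mat_unit_vec unit_vec_fsub)
    qed
    show "submodule class_ring ((\<lambda>u. g *\<^sub>v u) ` fsub n i) (Cn n)"
    proof (unfold_locales, goal_cases)
      case 1
      show ?case using g by (auto simp: fsub_def)
    next
      case (2 v w)
      then obtain a b where ab: "a \<in> fsub n i" "b \<in> fsub n i" "v = g *\<^sub>v a" "w = g *\<^sub>v b" by auto
      then have "v + w = g *\<^sub>v (a + b)" "a + b \<in> fsub n i"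
        using g by (auto simp: fsub_def mult_add_distrib_mat_vec)
      then show ?case by auto
    next
      case 3
      have "g *\<^sub>v 0\<^sub>v n = 0\<^sub>v n" using g by (intro eq_vecI) auto
      moreover have "0\<^sub>v n \<in> fsub n i" by (auto simp: fsub_def)
      ultimately have "0\<^sub>v n \<in> (\<lambda>u. g *\<^sub>v u) ` fsub n i" by (metis imageI)
      then show ?case by simp
    next
      case (4 c v)
      then obtain a where a: "a \<in> fsub n i" "v = g *\<^sub>v a" by auto
      then have "c \<cdot>\<^sub>v v = g *\<^sub>v (c \<cdot>\<^sub>v a)" "c \<cdot>\<^sub>v a \<in> fsub n i"
        using g by (auto simp: fsub_def mult_mat_vec)
      then show ?case by auto
    qed
  qed
  moreover have "g *\<^sub>v u \<in> span ?S" if "u \<in> fsub n i" for u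
    using that i
  proof (rule fsub_induct)
    have "g *\<^sub>v 0\<^sub>v n = 0\<^sub>v n" using g by (intro eq_vecI) auto
    then show "g *\<^sub>v 0\<^sub>v n \<in> span ?S" using span_zero by simp
    fix v c j assume v: "v \<in> carrier_vec n" "g *\<^sub>v v \<in> span ?S" and j: "j < i"
    have "col g j \<in> span ?S" using in_own_span[of ?S] S j by auto
    then have "g *\<^sub>v v + c \<cdot>\<^sub>v col g j \<in> span ?S"
      using smult_in_span[OF S] span_add1[of ?S "g *\<^sub>v v" "c \<cdot>\<^sub>v col g j"] S v(2) by simp
    moreover have "g *\<^sub>v (v + c \<cdot>\<^sub>v unit_vec n j) = g *\<^sub>v v + c \<cdot>\<^sub>v col g j"
      using g v j i by (simp add: mult_add_distrib_mat_vec mult_mat_vec mult_mat_unit_vec)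
    ultimately show "g *\<^sub>v (v + c \<cdot>\<^sub>v unit_vec n j) \<in> span ?S" by simp
  qed
  ultimately show ?thesis using g i by (auto simp: flag_of_columns vspan_eq_span)
qed

lemma GL_mult_vec_cancel:
  assumes "g \<in> GL n" "u \<in> carrier_vec n" "v \<in> carrier_vec n"
  shows "g *\<^sub>v u = g *\<^sub>v v \<longleftrightarrow> u = v"
proof -
  obtain h where h: "h \<in> GL n" "h * g = 1\<^sub>m n" using GL_inverse[OF assms(1)] by metis
  have "h *\<^sub>v (g *\<^sub>v x) = x" if "x \<in> carrier_vec n" for x
    using assoc_mult_mat_vec[of h n n g n x] h assms that by (simp add: GL_carrier)
  then show ?thesis using assms by metis
qed

lemma flag_of_extensional: "flag_of n g \<in> extensional {0..n}"
  by (simp add: flag_of_def)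

lemma flag_of_Flags:
  assumes g: "g \<in> GL n"
  shows "flag_of n g \<in> Flags n"
proof -
  interpret vec_space "TYPE(complex)" n .
  have gc: "g \<in> carrier_mat n n" and gd: "det g \<noteq> 0" using g by (auto simp: GL_iff_det)
  have cinj: "inj_on (col g) {..<n}"
  proof (rule inj_onI)
    fix i j assume "i \<in> {..<n}" "j \<in> {..<n}" "col g i = col g j"
    then have "unit_vec n i = (unit_vec n j :: complex vec)"
      using GL_mult_vec_cancel[OF g, of "unit_vec n i" "unit_vec n j"] gc
      by (auto simp: mult_mat_unit_vec)
    then show "i = j" using \<open>i \<in> {..<n}\<close> \<open>j \<in> {..<n}\<close> by simp
  qed
  have cols: "set (cols g) = col g ` {..<n}" using gc by (auto simp: cols_def)
  have li: "lin_indpt (set (cols g))" using lin_dep_cols_imp_det_0[OF gc] gd by auto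
  show ?thesis unfolding Flags_def
  proof (intro CollectI conjI allI impI flag_of_extensional)
    fix i assume i: "i \<le> n"
    let ?S = "col g ` {..<i}"
    have S: "?S \<subseteq> carrier_vec n" using gc by auto
    have f: "flag_of n g i = span ?S" using gc i by (simp add: flag_of_columns vspan_eq_span)
    have sub: "VectorSpace.subspace class_ring (span ?S) (Cn n)"
      using S by (intro span_is_subspace) auto
    then show "VectorSpace.subspace class_ring (flag_of n g i) (Cn n)" using f by simp
    then interpret W: vectorspace class_ring "vs (span ?S)" unfolding f by (rule subspace_is_vs)
    have subm: "submodule class_ring (span ?S) (Cn n)" using S by (intro span_is_submodule) auto
    have own: "?S \<subseteq> span ?S" using S by (intro in_own_span) auto
    have "?S \<subseteq> set (cols g)" unfolding cols using i by auto
    then have "lin_indpt ?S" using li subset_li_is_li by blast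
    then have "W.lin_indpt ?S" using span_li_not_depend(2)[OF own subm] by simp
    moreover have "W.span ?S = span ?S" using span_li_not_depend(1)[OF own subm] by simp
    ultimately have "W.basis ?S" unfolding W.basis_def using own by simp
    then have "W.dim = card ?S" by (intro W.dim_basis) auto
    moreover have "card ?S = i" using i cinj by (subst card_image) (auto intro: inj_on_subset)
    ultimately show "vdim n (flag_of n g i) = i" unfolding vdim_def f by simp
  next
    fix i assume i: "i < n"
    have "g *\<^sub>v unit_vec n i \<notin> (\<lambda>u. g *\<^sub>v u) ` fsub n i"
    proof
      assume "g *\<^sub>v unit_vec n i \<in> (\<lambda>u. g *\<^sub>v u) ` fsub n i"
      then obtain u where u: "u \<in> fsub n i" "g *\<^sub>v unit_vec n i = g *\<^sub>v u" by blast
      then have "u = unit_vec n i" using GL_mult_vec_cancel[OF g] by (simp add: fsub_carrier)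
      then show False using u(1) i by (auto simp: fsub_def)
    qed
    moreover have "g *\<^sub>v unit_vec n i \<in> (\<lambda>u. g *\<^sub>v u) ` fsub n (Suc i)"
      by (simp add: unit_vec_fsub)
    moreover have "fsub n i \<subseteq> fsub n (Suc i)" by (auto simp: fsub_def)
    ultimately have "(\<lambda>u. g *\<^sub>v u) ` fsub n i \<subset> (\<lambda>u. g *\<^sub>v u) ` fsub n (Suc i)" by blast
    then show "flag_of n g i \<subset> flag_of n g (Suc i)" using gc i by (simp add: flag_of_eq)
  qed
qed

lemma mult_vec_fsub_iff:
  assumes "A \<in> carrier_mat n n" "i \<le> n" "k \<le> n"
  shows "(\<forall>u \<in> fsub n i. A *\<^sub>v u \<in> fsub n k) \<longleftrightarrow> (\<forall>a<n. \<forall>b<i. k \<le> a \<longrightarrow> A $$ (a, b) = 0)"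
proof safe
  fix a b assume *: "\<forall>u \<in> fsub n i. A *\<^sub>v u \<in> fsub n k" "a < n" "b < i" "k \<le> a"
  then have "A *\<^sub>v unit_vec n b \<in> fsub n k" by (simp add: unit_vec_fsub)
  then show "A $$ (a, b) = 0" using * assms by (auto simp: fsub_def mult_mat_unit_vec)
next
  fix u assume *: "\<forall>a<n. \<forall>b<i. k \<le> a \<longrightarrow> A $$ (a, b) = 0" "u \<in> fsub n i"
  have "A $$ (a, b) * u $ b = 0" if "a < n" "b < n" "k \<le> a" for a b
    using * that by (cases "b < i") (auto simp: fsub_def)
  then have "(\<Sum>b<n. A $$ (a, b) * u $ b) = 0" if "a < n" "k \<le> a" for a
    using that by (intro sum.neutral) auto
  then have "(A *\<^sub>v u) $ a = 0" if "a < n" "k \<le> a" for a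
    using that mult_mat_vec_entry[OF assms(1) fsub_carrier[OF *(2)]] by simp
  then show "A *\<^sub>v u \<in> fsub n k"
    using assms fsub_carrier[OF *(2)] by (auto simp: fsub_def)
qed

text \<open>Together with \<open>flag_of_eqD\<close> this identifies the fibres of
  \<open>flag_of\<close> on \<open>GL n\<close> with the cosets \<open>g B\<close>. The point is
  that \<open>T\<close> and its inverse both preserve every \<open>fsub n i\<close>.\<close>

lemma flag_of_mult_tri:
  assumes g: "g \<in> GL n" and T: "T \<in> GL n" "tri n (\<lambda>a. a) T"
  shows "flag_of n (g * T) = flag_of n g"
proof (rule extensionalityI[OF flag_of_extensional flag_of_extensional])
  fix i assume "i \<in> {0..n}"
  then have i: "i \<le> n" by simp
  obtain S where S: "S \<in> GL n" "T * S = 1\<^sub>m n" "S * T = 1\<^sub>m n" using GL_inverse[OF T(1)] by metis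
  have triS: "tri n (\<lambda>a. a) S"
    using T S GL_tri_diag by (intro tri_inverse[OF _ T(2)]) (auto simp: GL_carrier)
  have TF: "T *\<^sub>v u \<in> fsub n i" if "u \<in> fsub n i" for u
    using mult_vec_fsub_iff[of T n i i] T i that by (auto simp: GL_carrier tri_def)
  have SF: "S *\<^sub>v u \<in> fsub n i" if "u \<in> fsub n i" for u
    using mult_vec_fsub_iff[of S n i i] triS i that by (auto simp: GL_carrier tri_def)
  have "(\<lambda>u. T *\<^sub>v u) ` fsub n i = fsub n i"
  proof (intro equalityI subsetI)
    fix u assume u: "u \<in> fsub n i"
    have "u = T *\<^sub>v (S *\<^sub>v u)"
      using assoc_mult_mat_vec[of T n n S n u] S T u by (simp add: GL_carrier fsub_carrier)
    then show "u \<in> (\<lambda>u. T *\<^sub>v u) ` fsub n i" using SF[OF u] by blast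
  qed (use TF in auto)
  then have "(\<lambda>u. g *\<^sub>v u) ` fsub n i = (\<lambda>u. g *\<^sub>v u) ` (\<lambda>u. T *\<^sub>v u) ` fsub n i" by simp
  also have "\<dots> = (\<lambda>u. (g * T) *\<^sub>v u) ` fsub n i"
    unfolding image_image using g T
    by (intro image_cong) (auto simp: GL_carrier fsub_carrier assoc_mult_mat_vec[of g n n T n])
  finally show "flag_of n (g * T) i = flag_of n g i"
    using g T i by (simp add: flag_of_eq GL_carrier mult_carrier_mat[of g n n T n])
qed

lemma flag_of_eqD:
  assumes g: "g \<in> GL n" and h: "h \<in> GL n" and eq: "flag_of n g = flag_of n h"
  obtains T where "T \<in> GL n" "tri n (\<lambda>a. a) T" "h = g * T"
proof -
  obtain k where k: "k \<in> GL n" "g * k = 1\<^sub>m n" "k * g = 1\<^sub>m n" using GL_inverse[OF g] by metis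
  note c = g[THEN GL_carrier] h[THEN GL_carrier] k(1)[THEN GL_carrier]
  let ?T = "k * h"
  have "tri n (\<lambda>a. a) ?T" unfolding tri_def
  proof (intro conjI allI impI)
    show "?T \<in> carrier_mat n n" using c by simp
    fix a b assume ab: "a < n" "b < n" "b < a"
    have "h *\<^sub>v unit_vec n b \<in> flag_of n h (Suc b)"
      using c ab by (simp add: flag_of_eq unit_vec_fsub)
    then have "h *\<^sub>v unit_vec n b \<in> flag_of n g (Suc b)" by (simp only: eq)
    then have "h *\<^sub>v unit_vec n b \<in> (\<lambda>u. g *\<^sub>v u) ` fsub n (Suc b)"
      using c ab by (simp add: flag_of_eq)
    then obtain u where u: "u \<in> fsub n (Suc b)" "h *\<^sub>v unit_vec n b = g *\<^sub>v u" by blast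
    have "?T *\<^sub>v unit_vec n b = k *\<^sub>v (g *\<^sub>v u)" using c u(2) by simp
    also have "\<dots> = u"
      using assoc_mult_mat_vec[of k n n g n u] c k u(1) by (simp add: fsub_carrier)
    finally have "col ?T b = u" using c ab by (simp add: mult_mat_unit_vec[of _ n n])
    then have "?T $$ (a, b) = u $ a" using c ab by (metis carrier_matD col_def dim_col index_col
      index_mult_mat(2,3))
    then show "?T $$ (a, b) = 0" using u(1) ab by (simp add: fsub_def)
  qed
  moreover have "h = g * ?T" using c k(2) assoc_mult_mat[of g n n k n h n] by simp
  ultimately show thesis using that[of ?T] k h by (simp add: GL_mult)
qed

text \<open>After transport by \<open>g\<close> the flag is the standard one, and the condition
  becomes a zero pattern of the conjugate of \<open>X\<close>. Monotonicity of \<open>h\<close>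
  allows column \<open>b\<close> to be tested only at \<open>i = Suc b\<close>, the first member
  that contains the corresponding basis vector.\<close>

lemma Hess_flag_of_iff:
  assumes g: "g \<in> GL n" and k: "k \<in> carrier_mat n n" "g * k = 1\<^sub>m n" "k * g = 1\<^sub>m n"
    and X: "X \<in> carrier_mat n n" and h: "hessenberg_fun n h"
  shows "flag_of n g \<in> Hess n X h \<longleftrightarrow>
     (\<forall>a<n. \<forall>b<n. h (Suc b) \<le> a \<longrightarrow> (k * X * g) $$ (a, b) = 0)"
proof -
  note gc = g[THEN GL_carrier]
  have hn: "h i \<le> n" if "i \<in> {1..n}" for i
  proof -
    have "h i < i" using h that by (simp add: hessenberg_fun_def)
    then show ?thesis using that by simp
  qed
  have "(\<lambda>v. X *\<^sub>v v) ` flag_of n g i \<subseteq> flag_of n g (h i) \<longleftrightarrow>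
      (\<forall>a<n. \<forall>b<i. h i \<le> a \<longrightarrow> (k * X * g) $$ (a, b) = 0)" if i: "i \<in> {1..n}" for i
  proof -
    have "X *\<^sub>v (g *\<^sub>v u) \<in> (\<lambda>u. g *\<^sub>v u) ` fsub n (h i) \<longleftrightarrow> (k * X * g) *\<^sub>v u \<in> fsub n (h i)"
      if u: "u \<in> fsub n i" for u
    proof -
      have u': "u \<in> carrier_vec n" using u by (rule fsub_carrier)
      have e: "(k * X * g) *\<^sub>v u = k *\<^sub>v (X *\<^sub>v (g *\<^sub>v u))"
        using gc k X u' by (simp add: assoc_mult_mat_vec[of _ n n _ n])
      have 1: "k *\<^sub>v (g *\<^sub>v v) = v" if "v \<in> carrier_vec n" for v
        using assoc_mult_mat_vec[of k n n g n v] gc k that by simp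
      have 2: "g *\<^sub>v (k *\<^sub>v v) = v" if "v \<in> carrier_vec n" for v
        using assoc_mult_mat_vec[of g n n k n v] gc k that by simp
      have c: "X *\<^sub>v (g *\<^sub>v u) \<in> carrier_vec n" using X gc u' by simp
      show ?thesis unfolding e
      proof
        assume "X *\<^sub>v (g *\<^sub>v u) \<in> (\<lambda>u. g *\<^sub>v u) ` fsub n (h i)"
        then show "k *\<^sub>v (X *\<^sub>v (g *\<^sub>v u)) \<in> fsub n (h i)" using 1 fsub_carrier by force
      next
        assume "k *\<^sub>v (X *\<^sub>v (g *\<^sub>v u)) \<in> fsub n (h i)"
        then show "X *\<^sub>v (g *\<^sub>v u) \<in> (\<lambda>u. g *\<^sub>v u) ` fsub n (h i)" by (intro image_eqI[of _ _ "k *\<^sub>v (X *\<^sub>v (g *\<^sub>v u))"]) (simp_all add: 2[OF c])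
      qed
    qed
    then have "(\<lambda>v. X *\<^sub>v v) ` flag_of n g i \<subseteq> flag_of n g (h i) \<longleftrightarrow>
        (\<forall>u \<in> fsub n i. (k * X * g) *\<^sub>v u \<in> fsub n (h i))"
      using i hn[OF i] gc by (simp add: flag_of_eq image_subset_iff)
    also have "\<dots> \<longleftrightarrow> (\<forall>a<n. \<forall>b<i. h i \<le> a \<longrightarrow> (k * X * g) $$ (a, b) = 0)"
      using i hn[OF i] by (intro mult_vec_fsub_iff mult_carrier_mat[OF mult_carrier_mat[OF k(1) X] gc]) simp_all
    finally show ?thesis .
  qed
  then have "flag_of n g \<in> Hess n X h \<longleftrightarrow>
      (\<forall>i \<in> {1..n}. \<forall>a<n. \<forall>b<i. h i \<le> a \<longrightarrow> (k * X * g) $$ (a, b) = 0)"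
    using flag_of_Flags[OF g] by (simp add: Hess_def)
  also have "\<dots> \<longleftrightarrow> (\<forall>a<n. \<forall>b<n. h (Suc b) \<le> a \<longrightarrow> (k * X * g) $$ (a, b) = 0)"
  proof safe
    fix a b assume *: "\<forall>i \<in> {1..n}. \<forall>a<n. \<forall>b<i. h i \<le> a \<longrightarrow> (k * X * g) $$ (a, b) = 0"
      "a < n" "b < n" "h (Suc b) \<le> a"
    then show "(k * X * g) $$ (a, b) = 0" by (auto dest!: bspec[of _ _ "Suc b"])
  next
    fix i a b assume *: "\<forall>a<n. \<forall>b<n. h (Suc b) \<le> a \<longrightarrow> (k * X * g) $$ (a, b) = 0"
      "i \<in> {1..n}" "a < n" "b < i" "h i \<le> a"
    have "h (Suc b) \<le> h i"
      using h *(2,4) by (auto simp: hessenberg_fun_def intro!: mono_onD[of "{1..n}" h])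
    then show "(k * X * g) $$ (a, b) = 0" using * by auto
  qed
  finally show ?thesis .
qed

section \<open>Polynomial functions and morphisms\<close>

abbreviation coords :: "'i set \<Rightarrow> (('i \<Rightarrow> complex) \<Rightarrow> complex) set" where
  "coords I \<equiv> (\<lambda>i x. x i) ` I"

abbreviation entries :: "nat \<Rightarrow> (complex mat \<Rightarrow> complex) set" where
  "entries n \<equiv> {\<lambda>A. A $$ (i, j) | i j. i < n \<and> j < n}"

lemma poly_funs_sum:
  assumes "\<And>i. i \<in> I \<Longrightarrow> f i \<in> poly_funs C"
  shows "(\<lambda>x. \<Sum>i \<in> I. f i x) \<in> poly_funs C"
  using assms by (induction I rule: infinite_finite_induct) (auto intro: poly_funs.intros)

lemma poly_funs_prod:
  assumes "\<And>i. i \<in> I \<Longrightarrow> f i \<in> poly_funs C"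
  shows "(\<lambda>x. \<Prod>i \<in> I. f i x) \<in> poly_funs C"
  using assms by (induction I rule: infinite_finite_induct) (auto intro: poly_funs.intros)

lemma poly_funs_uminus: "f \<in> poly_funs C \<Longrightarrow> (\<lambda>x. - f x) \<in> poly_funs C"
  using poly_funs.mult[OF poly_funs.const[of "-1"], of f] by simp

lemma poly_funs_diff:
  "f \<in> poly_funs C \<Longrightarrow> g \<in> poly_funs C \<Longrightarrow> (\<lambda>x. f x - g x) \<in> poly_funs C"
  using poly_funs.add[OF _ poly_funs_uminus, of f C g] by simp

lemma regular_quasi_affine:
  "regular (quasi_affine C X) U f \<longleftrightarrow> openin (zariski C X) U \<and>
     (\<forall>a \<in> U. \<exists>N p q. openin (zariski C X) N \<and> a \<in> N \<and> N \<subseteq> U \<and>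
        p \<in> poly_funs C \<and> q \<in> poly_funs C \<and> (\<forall>x \<in> N. q x \<noteq> 0 \<and> f x = p x / q x))"
  by (simp add: quasi_affine_def)

lemma ztop_quasi_affine [simp]: "ztop (quasi_affine C X) = zariski C X"
  by (simp add: quasi_affine_def)

lemma ztop_subvariety [simp]: "ztop (subvariety X Y) = subtopology (ztop X) Y"
  by (simp add: subvariety_def)

lemma regular_subvariety:
  "regular (subvariety X Y) U f \<longleftrightarrow> openin (subtopology (ztop X) Y) U \<and>
     (\<forall>a \<in> U. \<exists>N g. a \<in> N \<and> regular X N g \<and> (\<forall>x \<in> N \<inter> U. f x = g x))"
  by (simp add: subvariety_def)

lemma ztop_flag_variety [simp]: "ztop (flag_variety n) = flag_top n"
  by (simp add: flag_variety_def)

lemma ztop_affine_space [simp]: "ztop (affine_space I) = zariski (coords I) (affine_pts I)"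
  by (simp add: affine_space_def)

lemma ztop_GL_variety [simp]: "ztop (GL_variety n) = zariski (entries n) (GL n)"
  by (simp add: GL_variety_def)

lemma openin_zariski_nonzero:
  "p \<in> poly_funs C \<Longrightarrow> openin (zariski C X) {x \<in> X. p x \<noteq> 0}"
  unfolding openin_zariski by (intro exI[of _ "{p}"]) auto

lemma morphism_comp:
  assumes "morphism X Y \<phi>" "morphism Y Z \<psi>"
  shows "morphism X Z (\<lambda>x. \<psi> (\<phi> x))"
  unfolding morphism_def
proof (intro conjI allI impI)
  show "continuous_map (ztop X) (ztop Z) (\<lambda>x. \<psi> (\<phi> x))"
    using assms continuous_map_compose[of "ztop X" "ztop Y" \<phi> "ztop Z" \<psi>]
    by (simp add: morphism_def o_def)
  fix V f assume "regular Z V f"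
  then have "regular Y {x \<in> topspace (ztop Y). \<psi> x \<in> V} (f \<circ> \<psi>)"
    using assms(2) by (simp add: morphism_def)
  then have "regular X {x \<in> topspace (ztop X). \<phi> x \<in> {x \<in> topspace (ztop Y). \<psi> x \<in> V}}
      ((f \<circ> \<psi>) \<circ> \<phi>)"
    using assms(1) unfolding morphism_def by blast
  moreover have "{x \<in> topspace (ztop X). \<phi> x \<in> {x \<in> topspace (ztop Y). \<psi> x \<in> V}}
      = {x \<in> topspace (ztop X). \<psi> (\<phi> x) \<in> V}"
    using assms(1) by (auto simp: morphism_def continuous_map_def)
  ultimately show "regular X {x \<in> topspace (ztop X). \<psi> (\<phi> x) \<in> V} (f \<circ> (\<lambda>x. \<psi> (\<phi> x)))"
    by (simp add: o_def)
qed

text \<open>Equality is required on \<open>S\<close> only, since coordinates outside the index set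
  are zero only for points of \<open>affine_pts\<close>. With \<open>m\<close> the identity this
  describes polynomial functions on an affine space; with \<open>m\<close> the coordinates of a cell
  it says that a quantity can be recovered polynomially from them.\<close>

definition pull_poly :: "('b \<Rightarrow> complex) set \<Rightarrow> 'a set \<Rightarrow> ('a \<Rightarrow> 'b) \<Rightarrow> ('a \<Rightarrow> complex) set" where
  "pull_poly C S m = {f. \<exists>P \<in> poly_funs C. \<forall>x \<in> S. f x = P (m x)}"

lemma pull_polyI: "P \<in> poly_funs C \<Longrightarrow> (\<And>x. x \<in> S \<Longrightarrow> f x = P (m x)) \<Longrightarrow> f \<in> pull_poly C S m"
  by (auto simp: pull_poly_def)

lemma pull_polyE:
  assumes "f \<in> pull_poly C S m"
  obtains P where "P \<in> poly_funs C" "\<And>x. x \<in> S \<Longrightarrow> f x = P (m x)"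
  using assms by (auto simp: pull_poly_def)

lemma pull_poly_const: "(\<lambda>_. c) \<in> pull_poly C S m"
  by (rule pull_polyI[OF poly_funs.const]) simp

lemma pull_poly_add:
  assumes "f \<in> pull_poly C S m" "g \<in> pull_poly C S m"
  shows "(\<lambda>x. f x + g x) \<in> pull_poly C S m"
proof -
  obtain P where P: "P \<in> poly_funs C" "\<And>x. x \<in> S \<Longrightarrow> f x = P (m x)" using pull_polyE[OF assms(1)] by blast
  obtain Q where Q: "Q \<in> poly_funs C" "\<And>x. x \<in> S \<Longrightarrow> g x = Q (m x)" using pull_polyE[OF assms(2)] by blast
  show ?thesis by (rule pull_polyI[where P = "\<lambda>x. P x + Q x"]) (simp_all add: P Q poly_funs.add)
qed

lemma pull_poly_diff:
  assumes "f \<in> pull_poly C S m" "g \<in> pull_poly C S m"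
  shows "(\<lambda>x. f x - g x) \<in> pull_poly C S m"
proof -
  obtain P where P: "P \<in> poly_funs C" "\<And>x. x \<in> S \<Longrightarrow> f x = P (m x)" using pull_polyE[OF assms(1)] by blast
  obtain Q where Q: "Q \<in> poly_funs C" "\<And>x. x \<in> S \<Longrightarrow> g x = Q (m x)" using pull_polyE[OF assms(2)] by blast
  show ?thesis by (rule pull_polyI[where P = "\<lambda>x. P x - Q x"]) (simp_all add: P Q poly_funs_diff)
qed

lemma pull_poly_mult:
  assumes "f \<in> pull_poly C S m" "g \<in> pull_poly C S m"
  shows "(\<lambda>x. f x * g x) \<in> pull_poly C S m"
proof -
  obtain P where P: "P \<in> poly_funs C" "\<And>x. x \<in> S \<Longrightarrow> f x = P (m x)" using pull_polyE[OF assms(1)] by blast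
  obtain Q where Q: "Q \<in> poly_funs C" "\<And>x. x \<in> S \<Longrightarrow> g x = Q (m x)" using pull_polyE[OF assms(2)] by blast
  show ?thesis by (rule pull_polyI[where P = "\<lambda>x. P x * Q x"]) (simp_all add: P Q poly_funs.mult)
qed

lemma pull_poly_cong:
  "f \<in> pull_poly C S m \<Longrightarrow> (\<And>x. x \<in> S \<Longrightarrow> f x = g x) \<Longrightarrow> g \<in> pull_poly C S m"
  by (auto simp: pull_poly_def)

lemma pull_poly_sum:
  assumes "\<And>i. i \<in> I \<Longrightarrow> f i \<in> pull_poly C S m"
  shows "(\<lambda>x. \<Sum>i \<in> I. f i x) \<in> pull_poly C S m"
  using assms by (induction I rule: infinite_finite_induct) (auto intro: pull_poly_const pull_poly_add)

lemma pull_poly_comp: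
  assumes "p \<in> poly_funs D" and "\<And>c. c \<in> D \<Longrightarrow> (\<lambda>x. c (\<phi> x)) \<in> pull_poly C S m"
  shows "(\<lambda>x. p (\<phi> x)) \<in> pull_poly C S m"
  using assms(1) by induction (auto intro: pull_poly_const pull_poly_add pull_poly_mult assms(2))

text \<open>It suffices to test the coordinate functions: composing numerator and denominator with
  \<phi> turns local quotients of polynomials into local quotients of polynomials.\<close>

lemma morphism_quasi_affine:
  assumes "\<And>x. x \<in> X \<Longrightarrow> \<phi> x \<in> Y"
    and "\<And>c. c \<in> D \<Longrightarrow> (\<lambda>x. c (\<phi> x)) \<in> pull_poly C X (\<lambda>x. x)"
  shows "morphism (quasi_affine C X) (quasi_affine D Y) \<phi>"
proof -
  have pull: "\<exists>P \<in> poly_funs C. \<forall>x \<in> X. p (\<phi> x) = P x" if "p \<in> poly_funs D" for p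
    using pull_poly_comp[OF that assms(2)] by (simp add: pull_poly_def)
  have op: "openin (zariski C X) {x \<in> X. \<phi> x \<in> U}" if U: "openin (zariski D Y) U" for U
  proof -
    obtain S where S: "S \<subseteq> poly_funs D" "U = {x \<in> Y. \<exists>p \<in> S. p x \<noteq> 0}"
      using U unfolding openin_zariski by blast
    \<comment> \<open>All polynomials that represent the pull-back of some member of
      \<open>S\<close> are taken together, in place of a choice for each member.\<close>
    let ?S = "{P \<in> poly_funs C. \<exists>p \<in> S. \<forall>x \<in> X. p (\<phi> x) = P x}"
    have "{x \<in> X. \<phi> x \<in> U} = {x \<in> X. \<exists>P \<in> ?S. P x \<noteq> 0}"
    proof (intro equalityI subsetI)
      fix x assume "x \<in> {x \<in> X. \<phi> x \<in> U}"
      then obtain p where p: "x \<in> X" "p \<in> S" "p (\<phi> x) \<noteq> 0" using S(2) by auto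
      then obtain P where "P \<in> poly_funs C" "\<forall>x \<in> X. p (\<phi> x) = P x" using pull S(1) by blast
      then show "x \<in> {x \<in> X. \<exists>P \<in> ?S. P x \<noteq> 0}" using p by auto
    next
      fix x assume "x \<in> {x \<in> X. \<exists>P \<in> ?S. P x \<noteq> 0}"
      then obtain P p where "x \<in> X" "p \<in> S" "\<forall>x \<in> X. p (\<phi> x) = P x" "P x \<noteq> 0" by blast
      then have "x \<in> X" "p \<in> S" "p (\<phi> x) \<noteq> 0" by auto
      then show "x \<in> {x \<in> X. \<phi> x \<in> U}" using S(2) assms(1) by blast
    qed
    then show ?thesis unfolding openin_zariski by (intro exI[of _ ?S]) auto
  qed
  show ?thesis unfolding morphism_def
  proof (intro conjI allI impI)
    show "continuous_map (ztop (quasi_affine C X)) (ztop (quasi_affine D Y)) \<phi>"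
      using op assms(1) by (auto simp: continuous_map_def)
    fix V f assume f: "regular (quasi_affine D Y) V f"
    show "regular (quasi_affine C X) {x \<in> topspace (ztop (quasi_affine C X)). \<phi> x \<in> V} (f \<circ> \<phi>)"
      unfolding regular_quasi_affine
    proof (intro conjI ballI)
      show "openin (zariski C X) {x \<in> topspace (ztop (quasi_affine C X)). \<phi> x \<in> V}"
        using f op by (simp add: regular_quasi_affine)
      fix a assume "a \<in> {x \<in> topspace (ztop (quasi_affine C X)). \<phi> x \<in> V}"
      then have a: "a \<in> X" "\<phi> a \<in> V" by auto
      then obtain N p q where N: "openin (zariski D Y) N" "\<phi> a \<in> N" "N \<subseteq> V"
        "p \<in> poly_funs D" "q \<in> poly_funs D" "\<forall>x \<in> N. q x \<noteq> 0 \<and> f x = p x / q x"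
        using f unfolding regular_quasi_affine by meson
      obtain P where P: "P \<in> poly_funs C" "\<forall>x \<in> X. p (\<phi> x) = P x" using pull[OF N(4)] by blast
      obtain Q where Q: "Q \<in> poly_funs C" "\<forall>x \<in> X. q (\<phi> x) = Q x" using pull[OF N(5)] by blast
      show "\<exists>N p q. openin (zariski C X) N \<and> a \<in> N \<and>
          N \<subseteq> {x \<in> topspace (ztop (quasi_affine C X)). \<phi> x \<in> V} \<and>
          p \<in> poly_funs C \<and> q \<in> poly_funs C \<and> (\<forall>x \<in> N. q x \<noteq> 0 \<and> (f \<circ> \<phi>) x = p x / q x)"
      proof (intro exI conjI)
        show "openin (zariski C X) {x \<in> X. \<phi> x \<in> N}" by (rule op[OF N(1)])
        show "\<forall>x \<in> {x \<in> X. \<phi> x \<in> N}. Q x \<noteq> 0 \<and> (f \<circ> \<phi>) x = P x / Q x"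
          using N(6) P(2) Q(2) by fastforce
      qed (use a N P Q in auto)
    qed
  qed
qed

text \<open>A regular function on the induced structure is near each point the restriction of one on
  \<open>Z\<close>. The pull-back of this extension is a local quotient, and it agrees with the
  given function on the overlap of the two open sets.\<close>

lemma morphism_into_subvariety:
  assumes \<phi>: "morphism (quasi_affine C X) Z \<phi>" and Y: "\<And>x. x \<in> X \<Longrightarrow> \<phi> x \<in> Y"
  shows "morphism (quasi_affine C X) (subvariety Z Y) \<phi>"
proof -
  have cont: "continuous_map (zariski C X) (subtopology (ztop Z) Y) \<phi>"
    using \<phi> Y by (auto simp: morphism_def continuous_map_in_subtopology)
  show ?thesis unfolding morphism_def
  proof (intro conjI allI impI)
    show "continuous_map (ztop (quasi_affine C X)) (ztop (subvariety Z Y)) \<phi>"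
      using cont by simp
    fix V f assume f: "regular (subvariety Z Y) V f"
    have V: "openin (zariski C X) {x \<in> X. \<phi> x \<in> V}"
      using cont f openin_continuous_map_preimage by (fastforce simp: regular_subvariety)
    show "regular (quasi_affine C X) {x \<in> topspace (ztop (quasi_affine C X)). \<phi> x \<in> V} (f \<circ> \<phi>)"
      unfolding regular_quasi_affine
    proof (intro conjI ballI)
      show "openin (zariski C X) {x \<in> topspace (ztop (quasi_affine C X)). \<phi> x \<in> V}"
        using V by simp
      fix a assume "a \<in> {x \<in> topspace (ztop (quasi_affine C X)). \<phi> x \<in> V}"
      then have a: "a \<in> X" "\<phi> a \<in> V" by auto
      then obtain N g where N: "\<phi> a \<in> N" "regular Z N g" "\<forall>x \<in> N \<inter> V. f x = g x"
        using f unfolding regular_subvariety by meson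
      then have "regular (quasi_affine C X) {x \<in> X. \<phi> x \<in> N} (g \<circ> \<phi>)"
        using \<phi> unfolding morphism_def by auto
      then obtain M p q where M: "openin (zariski C X) M" "a \<in> M" "M \<subseteq> {x \<in> X. \<phi> x \<in> N}"
        "p \<in> poly_funs C" "q \<in> poly_funs C" "\<forall>x \<in> M. q x \<noteq> 0 \<and> (g \<circ> \<phi>) x = p x / q x"
        unfolding regular_quasi_affine using a N(1)
        by (elim conjE ballE[of _ _ a]) auto
      show "\<exists>N p q. openin (zariski C X) N \<and> a \<in> N \<and>
          N \<subseteq> {x \<in> topspace (ztop (quasi_affine C X)). \<phi> x \<in> V} \<and>
          p \<in> poly_funs C \<and> q \<in> poly_funs C \<and> (\<forall>x \<in> N. q x \<noteq> 0 \<and> (f \<circ> \<phi>) x = p x / q x)"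
      proof (intro exI conjI)
        show "openin (zariski C X) (M \<inter> {x \<in> X. \<phi> x \<in> V})" using M(1) V by (rule openin_Int)
        show "\<forall>x \<in> M \<inter> {x \<in> X. \<phi> x \<in> V}. q x \<noteq> 0 \<and> (f \<circ> \<phi>) x = p x / q x"
          using M(3,6) N(3) by fastforce
      qed (use a M in auto)
    qed
  qed
qed

section \<open>Regular functions on open subsets of the flag variety\<close>

lemma topspace_flag_top: "topspace (flag_top n) = Flags n"
proof -
  have "{g \<in> GL n. flag_of n g \<in> Flags n} = GL n" using flag_of_Flags by auto
  moreover have "openin (zariski (entries n) (GL n)) (GL n)"
    using openin_zariski_nonzero[where C = "entries n" and X = "GL n", OF poly_funs.const[where c = 1]]
    by simp
  ultimately have "openin (flag_top n) (Flags n)" by (simp add: openin_flag_top)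
  then show ?thesis by (meson openin_flag_top openin_subset openin_topspace subset_antisym)
qed

lemma morphism_flag_of: "morphism (GL_variety n) (flag_variety n) (flag_of n)"
proof -
  have "continuous_map (ztop (GL_variety n)) (ztop (flag_variety n)) (flag_of n)"
    using flag_of_Flags by (auto simp: continuous_map_def openin_flag_top topspace_flag_top)
  then show ?thesis unfolding morphism_def by (simp add: flag_variety_def)
qed

text \<open>One quotient is asked for on the whole preimage of \<open>U\<close>, in contrast to the
  local quotients of \<open>quasi_affine\<close>. The coordinates on a big cell have this form, and
  the rules for fractions preserve it. Only the quotient has to be constant on cosets, not
  \<open>p\<close> and \<open>q\<close> separately.\<close>

definition ratfuns :: "nat \<Rightarrow> (nat \<Rightarrow> complex vec set) set \<Rightarrow>
    ((nat \<Rightarrow> complex vec set) \<Rightarrow> complex) set" where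
  "ratfuns n U = {f. \<exists>p \<in> poly_funs (entries n). \<exists>q \<in> poly_funs (entries n).
     \<forall>g \<in> GL n. flag_of n g \<in> U \<longrightarrow> q g \<noteq> 0 \<and> f (flag_of n g) = p g / q g}"

lemma ratfunsI:
  assumes "p \<in> poly_funs (entries n)" "q \<in> poly_funs (entries n)"
    and "\<And>g. g \<in> GL n \<Longrightarrow> flag_of n g \<in> U \<Longrightarrow> q g \<noteq> 0 \<and> f (flag_of n g) = p g / q g"
  shows "f \<in> ratfuns n U"
  using assms unfolding ratfuns_def by blast

lemma ratfunsE:
  assumes "f \<in> ratfuns n U"
  obtains p q where "p \<in> poly_funs (entries n)" "q \<in> poly_funs (entries n)"
    "\<And>g. g \<in> GL n \<Longrightarrow> flag_of n g \<in> U \<Longrightarrow> q g \<noteq> 0 \<and> f (flag_of n g) = p g / q g"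
  using assms unfolding ratfuns_def by blast

lemma ratfuns_const: "(\<lambda>_. c) \<in> ratfuns n U"
  by (rule ratfunsI[of "\<lambda>_. c" _ "\<lambda>_. 1"]) (auto intro: poly_funs.const)

lemma ratfuns_add:
  assumes "f \<in> ratfuns n U" "g \<in> ratfuns n U"
  shows "(\<lambda>x. f x + g x) \<in> ratfuns n U"
proof -
  obtain p q where pq: "p \<in> poly_funs (entries n)" "q \<in> poly_funs (entries n)"
    "\<And>g. g \<in> GL n \<Longrightarrow> flag_of n g \<in> U \<Longrightarrow> q g \<noteq> 0 \<and> f (flag_of n g) = p g / q g"
    using ratfunsE[OF assms(1)] by blast
  obtain r s where rs: "r \<in> poly_funs (entries n)" "s \<in> poly_funs (entries n)"
    "\<And>h. h \<in> GL n \<Longrightarrow> flag_of n h \<in> U \<Longrightarrow> s h \<noteq> 0 \<and> g (flag_of n h) = r h / s h"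
    using ratfunsE[OF assms(2)] by blast
  show ?thesis
    by (rule ratfunsI[of "\<lambda>x. p x * s x + r x * q x" _ "\<lambda>x. q x * s x"])
      (simp_all add: poly_funs.add poly_funs.mult pq rs add_frac_eq)
qed

lemma ratfuns_mult:
  assumes "f \<in> ratfuns n U" "g \<in> ratfuns n U"
  shows "(\<lambda>x. f x * g x) \<in> ratfuns n U"
proof -
  obtain p q where pq: "p \<in> poly_funs (entries n)" "q \<in> poly_funs (entries n)"
    "\<And>g. g \<in> GL n \<Longrightarrow> flag_of n g \<in> U \<Longrightarrow> q g \<noteq> 0 \<and> f (flag_of n g) = p g / q g"
    using ratfunsE[OF assms(1)] by blast
  obtain r s where rs: "r \<in> poly_funs (entries n)" "s \<in> poly_funs (entries n)"
    "\<And>h. h \<in> GL n \<Longrightarrow> flag_of n h \<in> U \<Longrightarrow> s h \<noteq> 0 \<and> g (flag_of n h) = r h / s h"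
    using ratfunsE[OF assms(2)] by blast
  show ?thesis
    by (rule ratfunsI[of "\<lambda>x. p x * r x" _ "\<lambda>x. q x * s x"])
      (simp_all add: poly_funs.mult pq rs)
qed

lemma ratfuns_poly:
  assumes "p \<in> poly_funs C" and "\<And>c. c \<in> C \<Longrightarrow> (\<lambda>V. c (\<psi> V)) \<in> ratfuns n U"
  shows "(\<lambda>V. p (\<psi> V)) \<in> ratfuns n U"
  using assms(1) by induction (auto intro: ratfuns_const ratfuns_add ratfuns_mult assms(2))

lemma openin_ratfuns_nonzero:
  assumes U: "openin (flag_top n) U" and f: "f \<in> ratfuns n U"
  shows "openin (flag_top n) {V \<in> U. f V \<noteq> 0}"
proof -
  obtain p q where pq: "p \<in> poly_funs (entries n)" "q \<in> poly_funs (entries n)"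
    "\<forall>g \<in> GL n. flag_of n g \<in> U \<longrightarrow> q g \<noteq> 0 \<and> f (flag_of n g) = p g / q g"
    using f unfolding ratfuns_def by blast
  have "{g \<in> GL n. flag_of n g \<in> {V \<in> U. f V \<noteq> 0}}
      = {g \<in> GL n. flag_of n g \<in> U} \<inter> {g \<in> GL n. p g \<noteq> 0}"
    using pq(3) by auto
  moreover have "openin (zariski (entries n) (GL n)) \<dots>"
    using U pq(1) by (intro openin_Int openin_zariski_nonzero) (auto simp: openin_flag_top)
  ultimately show ?thesis using U by (auto simp: openin_flag_top)
qed

text \<open>Polynomials in the components of \<Psi> are again quotients on the open set
  \<open>U\<close>, so their nonvanishing loci are open and quotients of them are regular there.
  Continuity and regularity thus hold on a neighbourhood of \<open>Y\<close> and restrict to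
  \<open>Y\<close>.\<close>

lemma morphism_subvariety_to_affine:
  fixes \<Psi> :: "(nat \<Rightarrow> complex vec set) \<Rightarrow> 'i \<Rightarrow> complex"
  assumes U: "openin (flag_top n) U" and YU: "Y \<subseteq> U"
    and \<Psi>: "\<And>V. \<Psi> V \<in> affine_pts I" "\<And>i. i \<in> I \<Longrightarrow> (\<lambda>V. \<Psi> V i) \<in> ratfuns n U"
  shows "morphism (subvariety (flag_variety n) Y) (affine_space I) \<Psi>"
proof -
  have rat: "(\<lambda>V. p (\<Psi> V)) \<in> ratfuns n U" if "p \<in> poly_funs (coords I)" for p
    using that by (rule ratfuns_poly) (use \<Psi>(2) in auto)
  have op: "openin (flag_top n) {V \<in> U. \<Psi> V \<in> N}"
    if N: "openin (zariski (coords I) (affine_pts I)) N" for N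
  proof -
    obtain S where S: "S \<subseteq> poly_funs (coords I)" "N = {x \<in> affine_pts I. \<exists>p \<in> S. p x \<noteq> 0}"
      using N unfolding openin_zariski by blast
    have "{V \<in> U. \<Psi> V \<in> N} = (\<Union>p \<in> S. {V \<in> U. p (\<Psi> V) \<noteq> 0})"
      using S(2) \<Psi>(1) by auto
    also have "openin (flag_top n) \<dots>"
      using S(1) rat by (intro openin_Union) (auto intro!: openin_ratfuns_nonzero U)
    finally show ?thesis .
  qed
  have "U \<subseteq> topspace (flag_top n)" using U by (rule openin_subset)
  then have top: "topspace (subtopology (flag_top n) Y) = Y" using YU by auto
  have sub: "openin (subtopology (flag_top n) Y) {V \<in> Y. \<Psi> V \<in> N}"
    if "openin (zariski (coords I) (affine_pts I)) N" for N
    unfolding openin_subtopology using YU op[OF that]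
    by (intro exI[of _ "{V \<in> U. \<Psi> V \<in> N}"]) auto
  show ?thesis unfolding morphism_def
  proof (intro conjI allI impI)
    show "continuous_map (ztop (subvariety (flag_variety n) Y)) (ztop (affine_space I)) \<Psi>"
      unfolding continuous_map_def using sub \<Psi>(1) top by auto
    fix N f assume f: "regular (affine_space I) N f"
    show "regular (subvariety (flag_variety n) Y)
       {x \<in> topspace (ztop (subvariety (flag_variety n) Y)). \<Psi> x \<in> N} (f \<circ> \<Psi>)"
      unfolding regular_subvariety
    proof (intro conjI ballI)
      show "openin (subtopology (ztop (flag_variety n)) Y)
          {x \<in> topspace (ztop (subvariety (flag_variety n) Y)). \<Psi> x \<in> N}"
        using sub f top by (simp add: affine_space_def regular_quasi_affine)
      fix a assume "a \<in> {x \<in> topspace (ztop (subvariety (flag_variety n) Y)). \<Psi> x \<in> N}"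
      then have a: "a \<in> Y" "\<Psi> a \<in> N" using top by auto
      then obtain M p q where M: "openin (zariski (coords I) (affine_pts I)) M" "\<Psi> a \<in> M" "M \<subseteq> N"
        "p \<in> poly_funs (coords I)" "q \<in> poly_funs (coords I)"
        "\<forall>x \<in> M. q x \<noteq> 0 \<and> f x = p x / q x"
        using f unfolding affine_space_def regular_quasi_affine by meson
      let ?W = "{V \<in> U. \<Psi> V \<in> M}" and ?g = "\<lambda>V. p (\<Psi> V) / q (\<Psi> V)"
      obtain r s where rs: "r \<in> poly_funs (entries n)" "s \<in> poly_funs (entries n)"
        "\<forall>g \<in> GL n. flag_of n g \<in> U \<longrightarrow> s g \<noteq> 0 \<and> p (\<Psi> (flag_of n g)) = r g / s g"
        using rat[OF M(4)] unfolding ratfuns_def by blast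
      obtain t u where tu: "t \<in> poly_funs (entries n)" "u \<in> poly_funs (entries n)"
        "\<forall>g \<in> GL n. flag_of n g \<in> U \<longrightarrow> u g \<noteq> 0 \<and> q (\<Psi> (flag_of n g)) = t g / u g"
        using rat[OF M(5)] unfolding ratfuns_def by blast
      \<comment> \<open>On this set \<open>q\<close> composed with \<Psi> equals
        \<open>t / u\<close> and is nonzero, so \<open>t\<close> is nonzero and the quotient is
        \<open>(r / s) * (u / t)\<close>.\<close>
      have "\<forall>g \<in> {g \<in> GL n. flag_of n g \<in> ?W}.
          s g * t g \<noteq> 0 \<and> (?g \<circ> flag_of n) g = (r g * u g) / (s g * t g)"
        using rs(3) tu(3) M(6) by fastforce
      moreover have "openin (zariski (entries n) (GL n)) {g \<in> GL n. flag_of n g \<in> ?W}"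
        using op[OF M(1)] by (simp add: openin_flag_top)
      moreover have "(\<lambda>g. r g * u g) \<in> poly_funs (entries n)" "(\<lambda>g. s g * t g) \<in> poly_funs (entries n)"
        using rs tu by (auto intro: poly_funs.mult)
      ultimately have "regular (flag_variety n) ?W ?g"
        unfolding flag_variety_def GL_variety_def fun_space.simps regular_quasi_affine
        using op[OF M(1)] by blast
      then show "\<exists>N' g. a \<in> N' \<and> regular (flag_variety n) N' g \<and>
          (\<forall>x \<in> N' \<inter> {x \<in> topspace (ztop (subvariety (flag_variety n) Y)). \<Psi> x \<in> N}.
             (f \<circ> \<Psi>) x = g x)"
        using a M YU by (intro exI[of _ ?W] exI[of _ ?g]) auto
    qed
  qed
qed

lemma mult_vec_diff:
  fixes A B :: "complex mat"
  assumes "A \<in> carrier_mat n n" "B \<in> carrier_mat n n" "v \<in> carrier_vec n"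
  shows "(A - B) *\<^sub>v v = A *\<^sub>v v - B *\<^sub>v v"
  using assms by (intro minus_mult_distrib_mat_vec)

lemma mat_assoc4:
  fixes A B C D :: "complex mat"
  assumes A: "A \<in> carrier_mat n n" and B: "B \<in> carrier_mat n n"
    and C: "C \<in> carrier_mat n n" and D: "D \<in> carrier_mat n n"
  shows "(A * B) * (C * D) = A * (B * C) * D"
  using assoc_mult_mat[OF mult_carrier_mat[OF A B] C D] assoc_mult_mat[OF A B C] by simp

section \<open>Matrices indexed by the labels of a tableau\<close>

text \<open>
  Labels are counted from 0. The label \<open>a\<close> is in the box whose base label, counted from 0, is \<open>p a\<close>,
  and \<open>E l r\<close> means that \<open>l\<close> is directly to the left of \<open>r\<close>.
\<close>

locale row_labels =
  fixes n :: nat and p :: "nat \<Rightarrow> nat" and E :: "nat \<Rightarrow> nat \<Rightarrow> bool"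
  assumes p_inj: "inj_on p {..<n}"
    and E_less: "E l r \<Longrightarrow> l < n" "E l r \<Longrightarrow> r < n"
    and E_fun: "E l r \<Longrightarrow> E l' r \<Longrightarrow> l = l'"
    and E_mono: "E l r \<Longrightarrow> E l' r' \<Longrightarrow> p r < p r' \<Longrightarrow> p l < p l'"
    and E_p: "E l r \<Longrightarrow> p l < p r"
    and E_ex: "E l r \<Longrightarrow> r' < n \<Longrightarrow> p r < p r' \<Longrightarrow> \<exists>l'. E l' r'"
begin

lemma p_eq: "a < n \<Longrightarrow> b < n \<Longrightarrow> p a = p b \<longleftrightarrow> a = b"
  using p_inj by (auto dest: inj_onD)

text \<open>Two different right neighbours would be comparable under \<open>p\<close>, and
  \<open>E_mono\<close> would place \<open>l\<close> strictly before itself.\<close>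

lemma E_inj: "E l r \<Longrightarrow> E l r' \<Longrightarrow> r = r'"
  using E_mono[of l r l r'] E_mono[of l r' l r] p_eq[of r r'] E_less by force

definition Y :: "complex mat" where
  "Y = mat n n (\<lambda>(a, b). of_bool (E a b))"

lemma Y_carrier [simp]: "Y \<in> carrier_mat n n" "dim_row Y = n" "dim_col Y = n"
  by (simp_all add: Y_def)

lemma Y_index: "a < n \<Longrightarrow> b < n \<Longrightarrow> Y $$ (a, b) = of_bool (E a b)"
  by (simp add: Y_def)

lemma E_sets:
  "E l r \<Longrightarrow> {..<n} \<inter> {a. E a r} = {l}" "\<nexists>l. E l r \<Longrightarrow> {..<n} \<inter> {a. E a r} = {}"
  "E l r \<Longrightarrow> {..<n} \<inter> {a. E l a} = {r}" "\<nexists>r. E l r \<Longrightarrow> {..<n} \<inter> {a. E l a} = {}"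
  using E_less E_fun E_inj by blast+

lemma mult_Y_index:
  assumes "A \<in> carrier_mat n n" "a < n" "r < n"
  shows "E l r \<Longrightarrow> (A * Y) $$ (a, r) = A $$ (a, l)"
    and "\<nexists>l. E l r \<Longrightarrow> (A * Y) $$ (a, r) = 0"
proof -
  have "(A * Y) $$ (a, r) = (\<Sum>b<n. A $$ (a, b) * of_bool (E b r))"
    unfolding mult_mat_entry[OF assms(1) Y_carrier(1) assms(2,3)]
    using assms(3) by (intro sum.cong) (auto simp: Y_index)
  then have eq: "(A * Y) $$ (a, r) = (\<Sum>b \<in> {..<n} \<inter> {b. E b r}. A $$ (a, b))"
    by (simp add: sum_mult_of_bool_eq)
  show "E l r \<Longrightarrow> (A * Y) $$ (a, r) = A $$ (a, l)" unfolding eq using E_sets(1) by simp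
  show "\<nexists>l. E l r \<Longrightarrow> (A * Y) $$ (a, r) = 0" unfolding eq using E_sets(2) by simp
qed

lemma Y_mult_index:
  assumes "A \<in> carrier_mat n n" "b < n" "l < n"
  shows "E l r \<Longrightarrow> (Y * A) $$ (l, b) = A $$ (r, b)"
    and "\<nexists>r. E l r \<Longrightarrow> (Y * A) $$ (l, b) = 0"
proof -
  have "(Y * A) $$ (l, b) = (\<Sum>a<n. of_bool (E l a) * A $$ (a, b))"
    unfolding mult_mat_entry[OF Y_carrier(1) assms(1,3,2)]
    using assms(3) by (intro sum.cong) (auto simp: Y_index)
  then have eq: "(Y * A) $$ (l, b) = (\<Sum>a \<in> {..<n} \<inter> {a. E l a}. A $$ (a, b))"
    by (simp add: sum_of_bool_mult_eq)
  show "E l r \<Longrightarrow> (Y * A) $$ (l, b) = A $$ (r, b)" unfolding eq using E_sets(3) by simp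
  show "(Y * A) $$ (l, b) = 0" if "\<nexists>r. E l r"
  proof -
    have "{..<n} \<inter> Collect (E l) = {}" using that by auto
    then show ?thesis unfolding eq by simp
  qed
qed

lemma Y_unit_vec:
  assumes "E l r"
  shows "Y *\<^sub>v unit_vec n r = unit_vec n l"
proof (rule eq_vecI)
  fix a assume a: "a < dim_vec (unit_vec n l)"
  have "r < n" "l < n" using E_less assms by auto
  moreover have "E a r \<longleftrightarrow> a = l" using assms E_fun by auto
  ultimately show "(Y *\<^sub>v unit_vec n r) $ a = unit_vec n l $ a"
    using a by (simp add: mult_mat_unit_vec[OF Y_carrier(1)] Y_def)
qed simp

lemma Y_unit_vec_0:
  assumes "r < n" "\<nexists>l. E l r"
  shows "Y *\<^sub>v unit_vec n r = 0\<^sub>v n"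
  using assms by (intro eq_vecI) (simp_all add: mult_mat_unit_vec[OF Y_carrier(1)], simp_all add: Y_def)

text \<open>In the order \<open>p\<close>, the leading term of \<open>Y A e\<^sub>r\<close> is a multiple of \<open>e\<^sub>l\<close>, and the leading term of an
  element of \<open>A F\<^sub>k\<close> has a label below \<open>k\<close>.\<close>

lemma left_neighbour_less:
  assumes A: "tri n p A" and diag: "\<And>a. a < n \<Longrightarrow> A $$ (a, a) \<noteq> 0"
    and B: "B \<in> carrier_mat n n" "A * B = 1\<^sub>m n" and E: "E l r"
    and zero: "\<And>a. a < n \<Longrightarrow> k \<le> a \<Longrightarrow> (B * Y * A) $$ (a, r) = 0"
  shows "l < k"
proof -
  let ?Z = "B * Y * A"
  note Ac = tri_carrier[OF A]
  have lr: "l < n" "r < n" using E_less[OF E] by auto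
  have Zc: "?Z \<in> carrier_mat n n" by (rule mult_carrier_mat[OF mult_carrier_mat[OF B(1) Y_carrier(1)] Ac])
  have "A * ?Z = A * (B * Y) * A"
    using assoc_mult_mat[OF Ac mult_carrier_mat[OF B(1) Y_carrier(1)] Ac] by simp
  also have "\<dots> = A * B * (Y * A)" by (rule mat_assoc4[OF Ac B(1) Y_carrier(1) Ac, symmetric])
  also have "\<dots> = Y * A" unfolding B(2) by (rule left_mult_one_mat[OF mult_carrier_mat[OF Y_carrier(1) Ac]])
  finally have AZ: "A * ?Z = Y * A" .
  have YA: "(Y * A) $$ (a, r) = (\<Sum>b<n. A $$ (a, b) * ?Z $$ (b, r))" if "a < n" for a
    unfolding AZ[symmetric] using Ac Zc that lr by (intro mult_mat_entry) auto
  have YAl: "(Y * A) $$ (l, r) \<noteq> 0" using Y_mult_index(1)[OF Ac lr(2,1) E] diag lr by simp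
  \<comment> \<open>Let \<open>i\<close> be the last row of this support in the order
    \<open>p\<close>. As \<open>A\<close> is triangular with nonzero diagonal, \<open>i\<close> is
    also the leading row of column \<open>r\<close> of \<open>A * ?Z = Y * A\<close>. Monotonicity
    of left neighbours bounds it by \<open>l\<close> from above, and the nonzero entry in row
    \<open>l\<close> bounds it from below.\<close>
  let ?I = "{b. b < n \<and> ?Z $$ (b, r) \<noteq> 0}"
  have "?I \<noteq> {}"
  proof
    assume "?I = {}"
    then have "(\<Sum>b<n. A $$ (l, b) * ?Z $$ (b, r)) = 0" by (intro sum.neutral) auto
    then show False using YA[OF lr(1)] YAl by simp
  qed
  moreover have "finite ?I" by simp
  ultimately have "Max (p ` ?I) \<in> p ` ?I" by (intro Max_in) simp_all
  then obtain i where i': "i \<in> ?I" and pi: "p i = Max (p ` ?I)" by (elim imageE) simp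
  then have i: "i < n" "?Z $$ (i, r) \<noteq> 0" by simp_all
  have max: "p b \<le> p i" if "b < n" "?Z $$ (b, r) \<noteq> 0" for b
    unfolding pi using that by (intro Max_ge) auto
  have "A $$ (i, b) * ?Z $$ (b, r) = 0" if "b < n" "b \<noteq> i" for b
  proof (cases "?Z $$ (b, r) = 0")
    case False
    then have "p b < p i" using max[of b] that p_eq[of b i] i by force
    then show ?thesis using triD[OF A i(1) that(1)] by simp
  qed simp
  then have "(\<Sum>b<n. A $$ (i, b) * ?Z $$ (b, r)) = (\<Sum>b\<in>{i}. A $$ (i, b) * ?Z $$ (b, r))"
    using i by (intro sum.mono_neutral_right) auto
  then have "(Y * A) $$ (i, r) \<noteq> 0" using YA[OF i(1)] diag i by simp
  then obtain b where b: "E i b" "A $$ (b, r) \<noteq> 0"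
    using Y_mult_index[OF Ac lr(2) i(1)] by metis
  then have "p b \<le> p r" using triD[OF A] lr E_less by (meson not_le)
  then have "p i \<le> p l" using b(1) E E_mono[of i b l r] p_eq[of b r] E_less E_fun by fastforce
  moreover have "\<not> p i < p l"
  proof
    assume "p i < p l"
    then have "A $$ (l, b) * ?Z $$ (b, r) = 0" if "b < n" for b
      using max[OF that] triD[OF A lr(1) that] by (cases "?Z $$ (b, r) = 0") auto
    then have "(\<Sum>b<n. A $$ (l, b) * ?Z $$ (b, r)) = 0" by (intro sum.neutral) auto
    then show False using YA[OF lr(1)] YAl by simp
  qed
  ultimately have "i = l" using p_eq i lr by fastforce
  then show "l < k" using zero[of l] i by force
qed

lemma chain_left_unique: "(E ^^ m) j l \<Longrightarrow> (E ^^ m) j' l \<Longrightarrow> j = j'"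
proof (induction m arbitrary: l)
  case (Suc m)
  then show ?case by (metis E_fun relpowp_Suc_E)
qed simp

lemma chain_mono: "(E ^^ m) j l \<Longrightarrow> (E ^^ m) j' l' \<Longrightarrow> p l < p l' \<Longrightarrow> p j < p j'"
proof (induction m arbitrary: l l')
  case (Suc m)
  then show ?case by (metis E_mono relpowp_Suc_E)
qed simp

text \<open>Both chains run to the right from \<open>i\<close> along the same row, because right
  neighbours are unique; the longer one continues the shorter.\<close>

lemma chain_comparable: "(E ^^ m) i k \<Longrightarrow> (E ^^ m') i l \<Longrightarrow> m \<le> m' \<Longrightarrow> (E ^^ (m' - m)) k l"
proof (induction m arbitrary: i m')
  case (Suc m)
  then obtain m'' where m': "m' = Suc m''" by (cases m') auto
  obtain j where j: "E i j" "(E ^^ m) j k" using Suc.prems(1) by (rule relpowp_Suc_E2)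
  obtain j' where j': "E i j'" "(E ^^ m'') j' l" using Suc.prems(2) unfolding m' by (rule relpowp_Suc_E2)
  then show ?case using Suc.IH[of j m''] j E_inj Suc.prems(3) m' by auto
qed simp

lemma Y_pow_index: "a < n \<Longrightarrow> b < n \<Longrightarrow> (Y ^\<^sub>m m) $$ (a, b) = of_bool ((E ^^ m) a b)"
proof (induction m arbitrary: b)
  case 0
  then show ?case by (simp add: Y_def)
next
  case (Suc m)
  have c: "Y ^\<^sub>m m \<in> carrier_mat n n" by (simp add: pow_carrier_mat)
  show ?case
  proof (cases "\<exists>l. E l b")
    case True
    then obtain l where l: "E l b" by blast
    then have "(E ^^ Suc m) a b \<longleftrightarrow> (E ^^ m) a l" using E_fun by auto
    then show ?thesis using mult_Y_index(1)[OF c Suc.prems l] Suc.IH[of l] E_less[OF l] Suc.prems by simp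
  next
    case False
    then show ?thesis using mult_Y_index(2)[OF c Suc.prems] by auto
  qed
qed

text \<open>The Springer inversions for labels counted from 0. As \<open>p\<close> is the reading
  order of the base filling, \<open>p k < p l\<close> says that \<open>k\<close> is below
  \<open>l\<close> in its column or in a column further left.\<close>

definition inversion :: "nat \<Rightarrow> nat \<Rightarrow> bool" where
  "inversion k l \<longleftrightarrow> l < k \<and> k < n \<and> p k < p l \<and> (\<forall>r. E l r \<longrightarrow> k < r)"

lemma inversionD: "inversion k l \<Longrightarrow> l < k" "inversion k l \<Longrightarrow> k < n" "inversion k l \<Longrightarrow> l < n"
  "inversion k l \<Longrightarrow> p k < p l" "inversion k l \<Longrightarrow> E l r \<Longrightarrow> k < r"
  by (auto simp: inversion_def)

end

section \<open>Inversions and nilpotent parts for strictly increasing rows\<close>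

locale strict_row_labels = row_labels +
  assumes E_strict: "E l r \<Longrightarrow> l < r"
begin

lemma chain_le: "(E ^^ m) j l \<Longrightarrow> j + m \<le> l"
proof (induction m arbitrary: l)
  case (Suc m)
  then obtain i where "(E ^^ m) j i" "E i l" by auto
  then show ?case using Suc.IH[of i] E_strict[of i l] by simp
qed simp

text \<open>If two partners of \<open>k\<close> shared a row, the left one would have a right
  neighbour at most equal to the other partner, hence below \<open>k\<close>, against the inversion
  condition. So \<open>k\<close> has at most one partner in each row, and the image of every
  \<open>e_j\<close> under \<open>g_k\<close> is prescribed only once.\<close>

lemma chain_inversion_unique:
  assumes "inversion k l" "(E ^^ m) j l" "inversion k l'" "(E ^^ m') j l'"
  shows "l = l' \<and> m = m'"
proof -
  have *: "l = l' \<and> m = m'"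
    if "inversion k l" "(E ^^ m) j l" "inversion k l'" "(E ^^ m') j l'" "m \<le> m'" for l m l' m'
  proof (cases "m = m'")
    case True
    then show ?thesis using chain_comparable[OF that(2,4)] by simp
  next
    case False
    then have "m' - m = Suc (m' - m - 1)" using that(5) by simp
    then have "(E ^^ Suc (m' - m - 1)) l l'" using chain_comparable[OF that(2,4,5)] by (simp only:)
    then obtain r where "E l r" "(E ^^ (m' - m - 1)) r l'" by (rule relpowp_Suc_E2)
    then have "k < r" "r \<le> l'" using inversionD(5)[OF that(1)] chain_le by force+
    then show ?thesis using inversionD(1)[OF that(3)] by simp
  qed
  show ?thesis using *[OF assms] *[OF assms(3,4,1,2)] by (cases "m \<le> m'") auto
qed

text \<open>The nilpotent part of \<open>g_k\<close> in label coordinates: a label \<open>m\<close>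
  steps to the left of a partner \<open>l\<close> goes to the label \<open>m\<close> steps to the
  left of \<open>k\<close>, scaled by \<open>x (k, l)\<close>, or to zero if there is none. By
  \<open>chain_inversion_unique\<close> the sum has at most one term.\<close>

definition N :: "(nat \<times> nat \<Rightarrow> complex) \<Rightarrow> nat \<Rightarrow> complex mat" where
  "N x k = mat n n (\<lambda>(a, j). \<Sum>(l, m)\<in>{(l, m). l < n \<and> m < n \<and> inversion k l \<and> (E ^^ m) a k \<and> (E ^^ m) j l}. x (k, l))"

lemma N_carrier [simp]: "N x k \<in> carrier_mat n n"
  "dim_row (N x k) = n" "dim_col (N x k) = n"
  by (simp_all add: N_def)

lemma N_index:
  assumes "inversion k l" "(E ^^ m) j l" "a < n"
  shows "N x k $$ (a, j) = (if (E ^^ m) a k then x (k, l) else 0)"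
proof -
  have "l < n" "m < n" "j < n"
    using chain_le[OF assms(2)] inversionD(3)[OF assms(1)] by auto
  have "(l' < n \<and> m' < n \<and> inversion k l' \<and> (E ^^ m') a k \<and> (E ^^ m') j l')
      \<longleftrightarrow> l' = l \<and> m' = m \<and> (E ^^ m) a k" for l' m'
    using assms(1,2) \<open>l < n\<close> \<open>m < n\<close> chain_inversion_unique[OF assms(1,2), of l' m'] by metis
  then have "{(l, m). l < n \<and> m < n \<and> inversion k l \<and> (E ^^ m) a k \<and> (E ^^ m) j l}
      = (if (E ^^ m) a k then {(l, m)} else {})"
    by (simp add: set_eq_iff)
  then show ?thesis using \<open>j < n\<close> assms(3) by (simp add: N_def)
qed

lemma N_index_0:
  assumes "\<nexists>l m. inversion k l \<and> (E ^^ m) j l" "a < n" "j < n"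
  shows "N x k $$ (a, j) = 0"
proof -
  have "{(l, m). l < n \<and> m < n \<and> inversion k l \<and> (E ^^ m) a k \<and> (E ^^ m) j l} = {}"
    using assms(1) by blast
  then show ?thesis by (simp only: N_def index_mat(1)[OF assms(2,3)] prod.case sum.empty)
qed

lemma N_nonzero:
  assumes "N x k $$ (a, j) \<noteq> 0" "a < n" "j < n"
  obtains l m where "inversion k l" "(E ^^ m) j l" "(E ^^ m) a k" "j < k" "a \<le> k" "p a < p j"
proof -
  obtain l m where lm: "inversion k l" "(E ^^ m) j l" using assms N_index_0 by metis
  then have a: "(E ^^ m) a k" using assms N_index by metis
  have "j < k" using chain_le[OF lm(2)] inversionD(1)[OF lm(1)] by simp
  moreover have "a \<le> k" using chain_le[OF a] by simp
  moreover have "p a < p j" using chain_mono[OF a lm(2)] inversionD(4)[OF lm(1)] by simp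
  ultimately show thesis using that lm a by blast
qed

text \<open>In a strictly increasing row a chain from \<open>k\<close> to itself has length 0, so
  row \<open>k\<close> displays the coordinates themselves. Both the factorization and the recovery
  of the coordinates read this row.\<close>

lemma N_row:
  assumes "k < n" "j < n"
  shows "N x k $$ (k, j) = (if inversion k j then x (k, j) else 0)"
proof (cases "inversion k j")
  case True
  then show ?thesis using N_index[of k j 0 j k] assms by simp
next
  case False
  have "N x k $$ (k, j) = 0"
  proof (rule ccontr)
    assume "N x k $$ (k, j) \<noteq> 0"
    then obtain l m where lm: "inversion k l" "(E ^^ m) j l" "(E ^^ m) k k"
      using N_nonzero[OF _ assms] by metis
    then have "m = 0" using chain_le[OF lm(3)] by simp
    then show False using lm False by simp
  qed
  then show ?thesis using False by simp
qed

text \<open>Both products move one step further left in the row of the partner and in that of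
  \<open>k\<close>. Two boundary cases remain. The row of \<open>j\<close> cannot stop while that of
  \<open>k\<close> continues, by \<open>E_ex\<close>, since the label reached in the row of
  \<open>k\<close> precedes \<open>j\<close>. And a partner cannot appear only after the step from
  \<open>j\<close> to its left neighbour, for then \<open>j\<close> would be the right neighbour of
  a partner and exceed \<open>k\<close>.\<close>

lemma N_comm:
  assumes "j \<le> k" "k < n" "a < n"
  shows "(N x k * Y) $$ (a, j) = (Y * N x k) $$ (a, j)"
proof -
  have j: "j < n" using assms by simp
  show ?thesis
  proof (cases "\<exists>l m. inversion k l \<and> (E ^^ m) j l")
    case True
    then obtain l m where lm: "inversion k l" "(E ^^ m) j l" by blast
    have R: "(Y * N x k) $$ (a, j) = (if (E ^^ Suc m) a k then x (k, l) else 0)"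
    proof (cases "\<exists>b. E a b")
      case True
      then obtain b where b: "E a b" by blast
      have "(E ^^ Suc m) a k \<longleftrightarrow> (E ^^ m) b k"
        using b E_inj by (metis relpowp_Suc_E2 relpowp_Suc_I2)
      then show ?thesis using Y_mult_index(1)[OF N_carrier(1) j assms(3) b] N_index[OF lm] E_less[OF b] by simp
    next
      case False
      then have "\<not> (E ^^ Suc m) a k" by (metis relpowp_Suc_E2)
      then show ?thesis using Y_mult_index(2)[OF N_carrier(1) j assms(3) False] by simp
    qed
    show ?thesis
    proof (cases "\<exists>i. E i j")
      case True
      then obtain i where i: "E i j" by blast
      then have il: "(E ^^ Suc m) i l" using lm(2) by (metis relpowp_Suc_I2)
      show ?thesis
        unfolding R mult_Y_index(1)[OF N_carrier(1) assms(3) j i] by (rule N_index[OF lm(1) il assms(3)])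
    next
      case False
      have "\<not> (E ^^ Suc m) a k"
      proof
        assume "(E ^^ Suc m) a k"
        then obtain b where b: "E a b" "(E ^^ m) b k" by (rule relpowp_Suc_E2)
        then have "p b < p j" using chain_mono[OF b(2) lm(2)] inversionD(4)[OF lm(1)] by simp
        then show False using E_ex[OF b(1) j] False by blast
      qed
      then show ?thesis using R mult_Y_index(2)[OF N_carrier(1) assms(3) j False] by simp
    qed
  next
    case False
    have "(Y * N x k) $$ (a, j) = 0"
      using Y_mult_index[OF N_carrier(1) j assms(3)] N_index_0[OF False _ j] E_less by metis
    moreover have "(N x k * Y) $$ (a, j) = 0"
    proof (cases "\<exists>i. E i j")
      case True
      then obtain i where i: "E i j" by blast
      have "\<nexists>l m. inversion k l \<and> (E ^^ m) i l"
      proof safe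
        fix l m assume lm: "inversion k l" "(E ^^ m) i l"
        show False
        proof (cases m)
          case 0
          then show ?thesis using lm i inversionD(5)[OF lm(1)] assms(1) by force
        next
          case (Suc m')
          then obtain j' where "E i j'" "(E ^^ m') j' l" using lm(2) by (metis relpowp_Suc_E2)
          then show ?thesis using False lm(1) E_inj[OF i] by blast
        qed
      qed
      then show ?thesis
        using mult_Y_index(1)[OF N_carrier(1) assms(3) j i] N_index_0 E_less[OF i] assms(3) by simp
    next
      case False
      then show ?thesis using mult_Y_index(2)[OF N_carrier(1) assms(3) j] by simp
    qed
    ultimately show ?thesis by simp
  qed
qed

text \<open>The image lies in the row of \<open>k\<close>, and this row contains no partner of
  \<open>k\<close>: one at or to the right of \<open>k\<close> would be at least \<open>k\<close>,
  and one to the left would have a right neighbour at most \<open>k\<close>.\<close>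

lemma N_square: "N x k * N x k = 0\<^sub>m n n"
proof (rule eq_matI)
  fix a j assume "a < dim_row (0\<^sub>m n n)" "j < dim_col (0\<^sub>m n n)"
  then have aj: "a < n" "j < n" by auto
  have "N x k $$ (a, i) * N x k $$ (i, j) = 0" if i: "i < n" for i
  proof (rule ccontr)
    assume "N x k $$ (a, i) * N x k $$ (i, j) \<noteq> 0"
    then have nz: "N x k $$ (a, i) \<noteq> 0" "N x k $$ (i, j) \<noteq> 0" by auto
    obtain l m where lm: "inversion k l" "(E ^^ m) i l" using N_nonzero[OF nz(1) aj(1) i] by metis
    obtain l' m' where lm': "inversion k l'" "(E ^^ m') j l'" "(E ^^ m') i k"
      using N_nonzero[OF nz(2) i aj(2)] by metis
    show False
    proof (cases "m' \<le> m")
      case True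
      then have "k \<le> l" using chain_le chain_comparable[OF lm'(3) lm(2)] by fastforce
      then show False using inversionD(1)[OF lm(1)] by simp
    next
      case False
      then have "m' - m = Suc (m' - m - 1)" "m \<le> m'" by simp_all
      then have "(E ^^ Suc (m' - m - 1)) l k" using chain_comparable[OF lm(2) lm'(3)] by (simp only:)
      then obtain r where "E l r" "(E ^^ (m' - m - 1)) r k" by (rule relpowp_Suc_E2)
      then show False using inversionD(5)[OF lm(1)] chain_le by fastforce
    qed
  qed
  then have "(\<Sum>i<n. N x k $$ (a, i) * N x k $$ (i, j)) = 0" by (intro sum.neutral) auto
  then show "(N x k * N x k) $$ (a, j) = 0\<^sub>m n n $$ (a, j)"
    unfolding mult_mat_entry[OF N_carrier(1) N_carrier(1) aj] using aj by simp
qed simp_all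

end

lemma mult_mat_zero_vec: "A \<in> carrier_mat m n \<Longrightarrow> A *\<^sub>v 0\<^sub>v n = (0\<^sub>v m :: complex vec)"
  by (intro eq_vecI) auto

section \<open>The unipotent factors and their ordered products\<close>

context strict_row_labels
begin

definition H :: "(nat \<times> nat \<Rightarrow> complex) \<Rightarrow> nat \<Rightarrow> complex mat" where
  "H x k = 1\<^sub>m n + N x k"

definition H_inv :: "(nat \<times> nat \<Rightarrow> complex) \<Rightarrow> nat \<Rightarrow> complex mat" where
  "H_inv x k = 1\<^sub>m n - N x k"

lemma H_carrier [simp]: "H x k \<in> carrier_mat n n" "H_inv x k \<in> carrier_mat n n"
  by (simp_all add: H_def H_inv_def minus_carrier_mat)

lemma H_inverse: "H x k * H_inv x k = 1\<^sub>m n" "H_inv x k * H x k = 1\<^sub>m n"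
proof -
  have "H x k * H_inv x k = 1\<^sub>m n - N x k * N x k"
    by (intro eq_matI) (simp_all add: H_def H_inv_def add_mult_distrib_mat[of _ n n _ _ n]
      mult_minus_distrib_mat[of _ n n _ n])
  then show "H x k * H_inv x k = 1\<^sub>m n" unfolding N_square by (simp, intro eq_matI) simp_all
  then show "H_inv x k * H x k = 1\<^sub>m n"
    by (rule mat_mult_left_right_inverse[OF H_carrier])
qed

lemma H_vec:
  "v \<in> carrier_vec n \<Longrightarrow> H x k *\<^sub>v v = v + N x k *\<^sub>v v"
  "v \<in> carrier_vec n \<Longrightarrow> H_inv x k *\<^sub>v v = v - N x k *\<^sub>v v"
  by (simp_all add: H_def H_inv_def add_mult_distrib_mat_vec[of _ n n] mult_vec_diff[of _ n])

lemma H_cong: "(\<And>l. x (k, l) = x' (k, l)) \<Longrightarrow> H x k = H x' k"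
  by (simp add: H_def N_def)

lemma N_tri: "tri n p (N x k)" "a < n \<Longrightarrow> N x k $$ (a, a) = 0"
proof -
  have *: "N x k $$ (a, b) = 0" if "a < n" "b < n" "p b \<le> p a" for a b
    using that N_nonzero[of x k a b] by (meson not_le)
  show "tri n p (N x k)" using * by (simp add: tri_def)
  show "a < n \<Longrightarrow> N x k $$ (a, a) = 0" using * by simp
qed

lemma H_tri: "tri n p (H x k)" "tri n p (H_inv x k)"
  using N_tri(1)[of x k] p_eq by (auto simp: tri_def H_def H_inv_def)

lemma H_diag: "a < n \<Longrightarrow> H x k $$ (a, a) = 1" "a < n \<Longrightarrow> H_inv x k $$ (a, a) = 1"
  using N_tri(2)[where x = x and k = k and a = a] carrier_matD[OF N_carrier(1)[of x k]] by (simp_all add: H_def H_inv_def)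

lemma N_image:
  assumes "v \<in> carrier_vec n" "k < m"
  shows "N x k *\<^sub>v v \<in> fsub n m"
proof -
  have "N x k $$ (a, b) * v $ b = 0" if "a < n" "b < n" "m \<le> a" for a b
    using N_nonzero[of x k a b] that assms(2) by (metis mult_zero_left not_le order.strict_trans2)
  then have "(\<Sum>b<n. N x k $$ (a, b) * v $ b) = 0" if "a < n" "m \<le> a" for a
    using that by (intro sum.neutral) auto
  then show ?thesis
    using mult_mat_vec_entry[OF N_carrier(1) assms(1)] mult_mat_vec_carrier[OF N_carrier(1) assms(1)]
    by (simp add: fsub_def)
qed

lemma H_fsub:
  assumes "v \<in> fsub n m" "k < m"
  shows "H x k *\<^sub>v v \<in> fsub n m" "H_inv x k *\<^sub>v v \<in> fsub n m"
  using N_image[OF fsub_carrier[OF assms(1)] assms(2), of x] assms(1) fsub_carrier[OF assms(1)]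
  by (auto simp: H_vec fsub_def)

lemma H_coordinate:
  assumes "v \<in> carrier_vec n" "k < a" "a < n"
  shows "(H_inv x k *\<^sub>v v) $ a = v $ a"
proof -
  have "N x k *\<^sub>v v \<in> fsub n a" using assms by (intro N_image)
  then show ?thesis using assms by (simp add: H_vec fsub_def)
qed

lemma N_unit_vec_ge: "k \<le> r \<Longrightarrow> r < n \<Longrightarrow> N x k *\<^sub>v unit_vec n r = 0\<^sub>v n"
proof (intro eq_vecI)
  fix a assume "k \<le> r" "r < n" "a < dim_vec (0\<^sub>v n)"
  moreover from this have "N x k $$ (a, r) = 0" using N_nonzero[of x k a r] by force
  ultimately show "(N x k *\<^sub>v unit_vec n r) $ a = 0\<^sub>v n $ a"
    using carrier_matD[OF N_carrier(1)[of x k]] by (simp add: mult_mat_unit_vec[OF N_carrier(1)])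
qed (use carrier_matD[OF N_carrier(1)[of x k]] in simp)

lemma H_unit_vec_ge: "k \<le> r \<Longrightarrow> r < n \<Longrightarrow> H x k *\<^sub>v unit_vec n r = unit_vec n r"
  by (simp add: H_vec N_unit_vec_ge)

lemma H_comm:
  assumes u: "u \<in> fsub n (Suc k)" and k: "k < n"
  shows "Y *\<^sub>v (H x k *\<^sub>v u) = H x k *\<^sub>v (Y *\<^sub>v u)"
proof -
  note uc = fsub_carrier[OF u]
  have Yu: "Y *\<^sub>v u \<in> carrier_vec n" "N x k *\<^sub>v u \<in> carrier_vec n"
    using uc mult_mat_vec_carrier[OF Y_carrier(1)] mult_mat_vec_carrier[OF N_carrier(1)] by auto
  have "Y *\<^sub>v (N x k *\<^sub>v u) = N x k *\<^sub>v (Y *\<^sub>v u)"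
  proof (rule eq_vecI)
    fix a assume "a < dim_vec (N x k *\<^sub>v (Y *\<^sub>v u))"
    then have a: "a < n" using carrier_matD[OF N_carrier(1)[of x k]] by simp
    have "(Y * N x k) $$ (a, j) * u $ j = (N x k * Y) $$ (a, j) * u $ j" if "j < n" for j
    proof (cases "j \<le> k")
      case True
      then show ?thesis using N_comm[OF True k a] by (simp only:)
    next
      case False
      then show ?thesis using u that by (simp add: fsub_def)
    qed
    then have "((Y * N x k) *\<^sub>v u) $ a = ((N x k * Y) *\<^sub>v u) $ a"
      unfolding mult_mat_vec_entry[OF mult_carrier_mat[OF Y_carrier(1) N_carrier(1)] uc a]
        mult_mat_vec_entry[OF mult_carrier_mat[OF N_carrier(1) Y_carrier(1)] uc a]
      by (intro sum.cong) simp_all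
    then show "(Y *\<^sub>v (N x k *\<^sub>v u)) $ a = (N x k *\<^sub>v (Y *\<^sub>v u)) $ a"
      using uc assoc_mult_mat_vec[OF Y_carrier(1) N_carrier(1) uc] assoc_mult_mat_vec[OF N_carrier(1) Y_carrier(1) uc]
      by simp
  qed (use carrier_matD[OF N_carrier(1)[of x k]] carrier_matD[OF Y_carrier(1)] in simp)
  then show ?thesis using uc Yu by (simp add: H_vec mult_add_distrib_mat_vec[of _ n n])
qed

text \<open>The product of the factors with index from \<open>i\<close> to \<open>j - 1\<close>,
  larger indices to the left, and 1 when the range is empty. Two indices are kept so that the full
  product can be cut at any label.\<close>

fun prd :: "(nat \<times> nat \<Rightarrow> complex) \<Rightarrow> nat \<Rightarrow> nat \<Rightarrow> complex mat" where
  "prd x i 0 = 1\<^sub>m n"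
| "prd x i (Suc j) = (if i \<le> j then H x j * prd x i j else 1\<^sub>m n)"

fun prd_inv :: "(nat \<times> nat \<Rightarrow> complex) \<Rightarrow> nat \<Rightarrow> nat \<Rightarrow> complex mat" where
  "prd_inv x i 0 = 1\<^sub>m n"
| "prd_inv x i (Suc j) = (if i \<le> j then prd_inv x i j * H_inv x j else 1\<^sub>m n)"

lemma prd_self [simp]: "prd x i i = 1\<^sub>m n" "prd_inv x i i = 1\<^sub>m n"
  by (cases i; simp)+

lemma prd_carrier [simp]: "prd x i j \<in> carrier_mat n n" "prd_inv x i j \<in> carrier_mat n n"
  by (induction j) (auto intro!: mult_carrier_mat)

lemma prd_inverse: "prd x i j * prd_inv x i j = 1\<^sub>m n" "prd_inv x i j * prd x i j = 1\<^sub>m n"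
proof -
  show "prd x i j * prd_inv x i j = 1\<^sub>m n"
  proof (induction j)
    case (Suc j)
    show ?case
      using Suc mat_assoc4[OF H_carrier(1) prd_carrier(1) prd_carrier(2) H_carrier(2), of x j x i j x i j x j]
      by (simp add: H_inverse right_mult_one_mat[OF H_carrier(1)])
  qed simp
  then show "prd_inv x i j * prd x i j = 1\<^sub>m n"
    by (rule mat_mult_left_right_inverse[OF prd_carrier])
qed

lemma prd_tri: "tri n p (prd x i j)" "tri n p (prd_inv x i j)"
  by (induction j) (auto intro!: tri_mult H_tri, auto simp: tri_def)

lemma prd_diag: "a < n \<Longrightarrow> prd x i j $$ (a, a) = 1" "a < n \<Longrightarrow> prd_inv x i j $$ (a, a) = 1"
  by (induction j) (simp_all add: tri_mult_diag[OF p_inj] H_tri prd_tri H_diag)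

lemma prd_GL: "prd x i j \<in> GL n"
proof -
  have "det (prd x i j) * det (prd_inv x i j) = 1"
    using det_mult[OF prd_carrier] prd_inverse by (metis det_one)
  then show ?thesis by (auto simp: GL_iff_det)
qed

lemma prd_split: "i \<le> k \<Longrightarrow> k \<le> j \<Longrightarrow> prd x i j = prd x k j * prd x i k"
proof (induction j)
  case (Suc j)
  show ?case
  proof (cases "k = Suc j")
    case False
    then have "k \<le> j" using Suc.prems by simp
    then have "prd x i (Suc j) = H x j * (prd x k j * prd x i k)"
      using Suc.IH[OF Suc.prems(1)] Suc.prems by simp
    also have "\<dots> = prd x k (Suc j) * prd x i k"
      using assoc_mult_mat[OF H_carrier(1) prd_carrier(1) prd_carrier(1)] \<open>k \<le> j\<close> by simp
    finally show ?thesis .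
  qed (simp del: prd.simps prd_inv.simps add: left_mult_one_mat[OF prd_carrier(1)] right_mult_one_mat[OF prd_carrier(2)])
qed simp

lemma prd_inv_split: "i \<le> k \<Longrightarrow> k \<le> j \<Longrightarrow> prd_inv x i j = prd_inv x i k * prd_inv x k j"
proof (induction j)
  case (Suc j)
  show ?case
  proof (cases "k = Suc j")
    case False
    then have "k \<le> j" using Suc.prems by simp
    then have "prd_inv x i (Suc j) = prd_inv x i k * prd_inv x k j * H_inv x j"
      using Suc.IH[OF Suc.prems(1)] Suc.prems by simp
    also have "\<dots> = prd_inv x i k * prd_inv x k (Suc j)"
      using assoc_mult_mat[OF prd_carrier(2) prd_carrier(2) H_carrier(2)] \<open>k \<le> j\<close> by simp
    finally show ?thesis .
  qed (simp del: prd.simps prd_inv.simps add: left_mult_one_mat[OF prd_carrier(1)] right_mult_one_mat[OF prd_carrier(2)])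
qed simp

lemma prd_cong: "(\<And>k l. i \<le> k \<Longrightarrow> x (k, l) = x' (k, l)) \<Longrightarrow> prd x i j = prd x' i j"
proof (induction j)
  case (Suc j)
  have "H x j = H x' j" if "i \<le> j" by (rule H_cong) (rule Suc.prems[OF that])
  then show ?case using Suc by simp
qed simp

lemma prd_inv_cong: "(\<And>k l. i \<le> k \<Longrightarrow> x (k, l) = x' (k, l)) \<Longrightarrow> prd_inv x i j = prd_inv x' i j"
proof (induction j)
  case (Suc j)
  have "H_inv x j = H_inv x' j" if "i \<le> j"
    using that Suc.prems by (simp add: H_inv_def N_def)
  then show ?case using Suc by simp
qed simp

lemma prd_vec_Suc:
  "u \<in> carrier_vec n \<Longrightarrow> i \<le> j \<Longrightarrow> prd x i (Suc j) *\<^sub>v u = H x j *\<^sub>v (prd x i j *\<^sub>v u)"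
  using assoc_mult_mat_vec[OF H_carrier(1) prd_carrier(1)] by simp

lemma prd_inv_vec_Suc:
  "u \<in> carrier_vec n \<Longrightarrow> i \<le> j \<Longrightarrow>
    prd_inv x i (Suc j) *\<^sub>v u = prd_inv x i j *\<^sub>v (H_inv x j *\<^sub>v u)"
  using assoc_mult_mat_vec[OF prd_carrier(2) H_carrier(2)] by simp

lemma fsub_mono: "u \<in> fsub n i \<Longrightarrow> i \<le> j \<Longrightarrow> u \<in> fsub n j"
  by (simp add: fsub_def)

lemma prd_fsub: "u \<in> fsub n i \<Longrightarrow> i \<le> j \<Longrightarrow> prd x i j *\<^sub>v u \<in> fsub n j"
proof (induction j)
  case 0
  then show ?case by (simp add: fsub_carrier)
next
  case (Suc j)
  show ?case
  proof (cases "i = Suc j")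
    case True
    then show ?thesis using Suc.prems by (simp add: fsub_carrier)
  next
    case False
    then have ij: "i \<le> j" using Suc.prems(2) by simp
    have "prd x i j *\<^sub>v u \<in> fsub n (Suc j)"
      using Suc.IH[OF Suc.prems(1) ij] by (rule fsub_mono) simp
    then have "H x j *\<^sub>v (prd x i j *\<^sub>v u) \<in> fsub n (Suc j)" by (rule H_fsub) simp
    then show ?thesis unfolding prd_vec_Suc[OF fsub_carrier[OF Suc.prems(1)] ij] .
  qed
qed

text \<open>\<open>H x j\<close> commutes with \<open>Y\<close> only on the span of the labels up to
  \<open>j\<close>. Starting in \<open>fsub n i\<close>, the earlier factors have produced a vector
  supported on labels below \<open>j\<close> when \<open>H x j\<close> is applied, so each factor
  acts where it commutes.\<close>

lemma prd_comm:
  "u \<in> fsub n i \<Longrightarrow> i \<le> j \<Longrightarrow> j \<le> n \<Longrightarrow> Y *\<^sub>v (prd x i j *\<^sub>v u) = prd x i j *\<^sub>v (Y *\<^sub>v u)"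
proof (induction j)
  case 0
  then show ?case by (simp add: fsub_carrier mult_mat_vec_carrier[OF Y_carrier(1)])
next
  case (Suc j)
  have Yu: "u \<in> carrier_vec n" "Y *\<^sub>v u \<in> carrier_vec n"
    using Suc.prems(1) by (auto intro: mult_mat_vec_carrier[OF Y_carrier(1)] fsub_carrier)
  show ?case
  proof (cases "i = Suc j")
    case True
    then show ?thesis using Yu by simp
  next
    case False
    then have ij: "i \<le> j" "j < n" using Suc.prems by auto
    have "prd x i j *\<^sub>v u \<in> fsub n (Suc j)"
      using prd_fsub[OF Suc.prems(1) ij(1)] by (rule fsub_mono) simp
    then have "Y *\<^sub>v (H x j *\<^sub>v (prd x i j *\<^sub>v u)) = H x j *\<^sub>v (Y *\<^sub>v (prd x i j *\<^sub>v u))"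
      using ij(2) by (rule H_comm)
    also have "Y *\<^sub>v (prd x i j *\<^sub>v u) = prd x i j *\<^sub>v (Y *\<^sub>v u)"
      using Suc.IH Suc.prems ij by simp
    finally show ?thesis unfolding prd_vec_Suc[OF Yu(1) ij(1)] prd_vec_Suc[OF Yu(2) ij(1)] .
  qed
qed

lemma prd_unit_vec: "j \<le> Suc r \<Longrightarrow> r < n \<Longrightarrow> prd x i j *\<^sub>v unit_vec n r = unit_vec n r"
proof (induction j)
  case (Suc j)
  show ?case
  proof (cases "i \<le> j")
    case True
    then show ?thesis using Suc by (simp add: prd_vec_Suc[OF unit_vec_carrier] H_unit_vec_ge del: prd.simps)
  qed simp
qed simp

lemma prd_row: "j \<le> a \<Longrightarrow> a < n \<Longrightarrow> b < n \<Longrightarrow> prd x i j $$ (a, b) = (1\<^sub>m n :: complex mat) $$ (a, b)"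
proof (induction j)
  case (Suc j)
  have "H x j $$ (a, c) * prd x i j $$ (c, b) = (if c = a then prd x i j $$ (a, b) else 0)" if c: "c < n" for c
  proof -
    have "N x j $$ (a, c) = 0" using N_nonzero[of x j a c] Suc.prems c by force
    then show ?thesis using Suc.prems c by (simp add: H_def)
  qed
  then have "(\<Sum>c<n. H x j $$ (a, c) * prd x i j $$ (c, b)) = (\<Sum>c<n. if c = a then prd x i j $$ (a, b) else 0)"
    by (intro sum.cong) simp_all
  then have "(H x j * prd x i j) $$ (a, b) = prd x i j $$ (a, b)"
    unfolding mult_mat_entry[OF H_carrier(1) prd_carrier(1) Suc.prems(2,3)] using Suc.prems by simp
  also have "\<dots> = (1\<^sub>m n :: complex mat) $$ (a, b)" using Suc by simp
  finally show ?case by (cases "i \<le> j") (simp_all only: prd.simps if_True if_False)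
qed simp

lemma prd_inv_coordinate:
  "v \<in> carrier_vec n \<Longrightarrow> k \<le> a \<Longrightarrow> a < n \<Longrightarrow> (prd_inv x i k *\<^sub>v v) $ a = v $ a"
proof (induction k arbitrary: v)
  case (Suc k)
  show ?case
  proof (cases "i \<le> k")
    case True
    have "(prd_inv x i k *\<^sub>v (H_inv x k *\<^sub>v v)) $ a = (H_inv x k *\<^sub>v v) $ a"
      using Suc.prems by (intro Suc.IH mult_mat_vec_carrier[OF H_carrier(2)]) simp_all
    also have "\<dots> = v $ a" using Suc.prems by (intro H_coordinate) simp_all
    finally show ?thesis unfolding prd_inv_vec_Suc[OF Suc.prems(1) True] .
  qed (use Suc.prems in simp)
qed simp

lemma prd_inv_fsub: "u \<in> fsub n c \<Longrightarrow> j \<le> c \<Longrightarrow> prd_inv x i j *\<^sub>v u \<in> fsub n c"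
proof (induction j arbitrary: u)
  case (Suc j)
  show ?case
  proof (cases "i \<le> j")
    case True
    have "H_inv x j *\<^sub>v u \<in> fsub n c" using Suc.prems by (intro H_fsub) simp_all
    then show ?thesis
      unfolding prd_inv_vec_Suc[OF fsub_carrier[OF Suc.prems(1)] True]
      using Suc.prems(2) by (intro Suc.IH) simp_all
  qed (use Suc.prems in \<open>simp add: fsub_carrier\<close>)
qed (simp add: fsub_carrier)

text \<open>The product is cut after \<open>r\<close>. The factors up to \<open>r\<close> fix
  \<open>e_r\<close>; those above \<open>r\<close> commute past \<open>Y\<close> and cancel against
  their inverses, so only the inverses of the factors up to \<open>r\<close> survive.\<close>

lemma conjugate_unit_vec:
  shows "E l r \<Longrightarrow>
      (prd_inv x 0 n * Y * prd x 0 n) *\<^sub>v unit_vec n r = prd_inv x 0 (Suc r) *\<^sub>v unit_vec n l"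
    and "\<nexists>l. E l r' \<Longrightarrow> r' < n \<Longrightarrow>
      (prd_inv x 0 n * Y * prd x 0 n) *\<^sub>v unit_vec n r' = 0\<^sub>v n"
proof -
  have *: "(prd_inv x 0 n * Y * prd x 0 n) *\<^sub>v unit_vec n r = prd_inv x 0 (Suc r) *\<^sub>v (Y *\<^sub>v unit_vec n r)"
    if r: "r < n" for r
  proof -
    have Yu: "Y *\<^sub>v unit_vec n r \<in> carrier_vec n" by (rule mult_mat_vec_carrier[OF Y_carrier(1)]) simp
    have c: "v \<in> carrier_vec n \<Longrightarrow> prd x i j *\<^sub>v v \<in> carrier_vec n" for v i j
      by (rule mult_mat_vec_carrier[OF prd_carrier(1)])
    have "prd x 0 n *\<^sub>v unit_vec n r = prd x (Suc r) n *\<^sub>v (prd x 0 (Suc r) *\<^sub>v unit_vec n r)"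
      using prd_split[of 0 "Suc r" n x] r assoc_mult_mat_vec[OF prd_carrier(1) prd_carrier(1) unit_vec_carrier]
      by (simp del: prd.simps)
    also have "\<dots> = prd x (Suc r) n *\<^sub>v unit_vec n r" using r by (simp add: prd_unit_vec del: prd.simps)
    finally have "Y *\<^sub>v (prd x 0 n *\<^sub>v unit_vec n r) = prd x (Suc r) n *\<^sub>v (Y *\<^sub>v unit_vec n r)"
      using r by (simp add: prd_comm unit_vec_fsub)
    moreover have "prd_inv x 0 n *\<^sub>v (prd x (Suc r) n *\<^sub>v (Y *\<^sub>v unit_vec n r))
        = prd_inv x 0 (Suc r) *\<^sub>v ((prd_inv x (Suc r) n * prd x (Suc r) n) *\<^sub>v (Y *\<^sub>v unit_vec n r))"
      using prd_inv_split[of 0 "Suc r" n x] r Yu c[OF Yu]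
      by (simp only: assoc_mult_mat_vec[OF prd_carrier(2) prd_carrier(2)]
        assoc_mult_mat_vec[OF prd_carrier(2) prd_carrier(1)])
    moreover have "(prd_inv x 0 n * Y * prd x 0 n) *\<^sub>v unit_vec n r
        = prd_inv x 0 n *\<^sub>v (Y *\<^sub>v (prd x 0 n *\<^sub>v unit_vec n r))"
      using c[of "unit_vec n r" 0 n]
      by (simp add: assoc_mult_mat_vec[of _ n n _ n] mult_carrier_mat[of _ n n])
    ultimately show ?thesis using Yu by (simp add: prd_inverse)
  qed
  show "(prd_inv x 0 n * Y * prd x 0 n) *\<^sub>v unit_vec n r = prd_inv x 0 (Suc r) *\<^sub>v unit_vec n l"
    if E: "E l r"
    using *[OF E_less(2)[OF E]] Y_unit_vec[OF E] by simp
  show "\<nexists>l. E l r' \<Longrightarrow> r' < n \<Longrightarrow>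
      (prd_inv x 0 n * Y * prd x 0 n) *\<^sub>v unit_vec n r' = 0\<^sub>v n"
    using *[of r'] Y_unit_vec_0[of r'] mult_mat_zero_vec[OF prd_carrier(2)] by (simp del: prd_inv.simps)
qed

end

lemma pull_poly_mat_mult:
  assumes "\<And>x. A x \<in> carrier_mat n n" "\<And>x. B x \<in> carrier_mat n n"
    and "\<And>i j. i < n \<Longrightarrow> j < n \<Longrightarrow> (\<lambda>x. A x $$ (i, j)) \<in> pull_poly C S m"
    and "\<And>i j. i < n \<Longrightarrow> j < n \<Longrightarrow> (\<lambda>x. B x $$ (i, j)) \<in> pull_poly C S m"
    and ij: "i < n" "j < n"
  shows "(\<lambda>x. (A x * B x) $$ (i, j)) \<in> pull_poly C S m"
  unfolding mult_mat_entry[OF assms(1,2) ij]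
  using assms by (intro pull_poly_sum pull_poly_mult) auto

section \<open>The Hessenberg condition in coordinates\<close>

context strict_row_labels
begin

text \<open>Column \<open>l\<close> can be nonzero only if \<open>l\<close> itself is a partner of
  \<open>j\<close>: a partner further right would be at least \<open>r\<close>, hence at least
  \<open>j\<close>. The column is then a multiple of \<open>e_j\<close>, so one entry decides
  it.\<close>

lemma N_unit_vec_left:
  assumes r: "E l r" "j \<le> r" and Nj: "N x j $$ (j, l) = 0"
  shows "N x j *\<^sub>v unit_vec n l = 0\<^sub>v n"
proof (rule eq_vecI)
  fix a assume "a < dim_vec (0\<^sub>v n)"
  then have a: "a < n" by simp
  have l: "l < n" using E_less(1)[OF r(1)] .
  have "N x j $$ (a, l) = 0"
  proof (rule ccontr)
    assume nz: "N x j $$ (a, l) \<noteq> 0"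
    then obtain l' m where lm: "inversion j l'" "(E ^^ m) l l'" "(E ^^ m) a j"
      using N_nonzero[OF nz a l] by metis
    show False
    proof (cases m)
      case 0
      then have "a = j" using lm(3) by simp
      then show False using nz Nj by simp
    next
      case (Suc m')
      then obtain r' where r': "E l r'" "(E ^^ m') r' l'" using lm(2) by (metis relpowp_Suc_E2)
      then have "r \<le> l'" using E_inj[OF r(1)] chain_le[OF r'(2)] by auto
      then show False using inversionD(1)[OF lm(1)] r(2) by simp
    qed
  qed
  then show "(N x j *\<^sub>v unit_vec n l) $ a = 0\<^sub>v n $ a"
    using a l by (simp add: mult_mat_unit_vec[OF N_carrier(1)] col_def)
qed simp

text \<open>The factors with the largest index act first. Those with index at least \<open>c\<close>
  fix \<open>e_l\<close>, because their coordinate at \<open>l\<close> vanishes, and the remaining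
  ones preserve \<open>fsub n c\<close>.\<close>

lemma prd_inv_unit_vec_fsub:
  assumes l: "l < n" "l < c" and x: "\<And>k. c \<le> k \<Longrightarrow> k < j \<Longrightarrow> inversion k l \<Longrightarrow> x (k, l) = 0"
    and r: "E l r" "j \<le> Suc r"
  shows "prd_inv x 0 j *\<^sub>v unit_vec n l \<in> fsub n c"
  using x r(2)
proof (induction j)
  case 0
  then show ?case using l by (simp add: unit_vec_fsub)
next
  case (Suc j)
  show ?case
  proof (cases "j < c")
    case True
    then show ?thesis using l by (intro prd_inv_fsub unit_vec_fsub) simp_all
  next
    case False
    have jn: "j < n" using Suc.prems(2) E_less[OF r(1)] by simp
    have "N x j $$ (j, l) = 0" using N_row[OF jn l(1), of x] Suc.prems(1)[of j] False by simp
    then have "N x j *\<^sub>v unit_vec n l = 0\<^sub>v n" using r(1) Suc.prems(2) by (intro N_unit_vec_left) simp_all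
    then have "H_inv x j *\<^sub>v unit_vec n l = unit_vec n l" by (simp add: H_vec)
    then have "prd_inv x 0 (Suc j) *\<^sub>v unit_vec n l = prd_inv x 0 j *\<^sub>v unit_vec n l"
      by (simp add: prd_inv_vec_Suc[OF unit_vec_carrier] del: prd_inv.simps)
    also have "\<dots> \<in> fsub n c" using Suc by simp
    finally show ?thesis .
  qed
qed

text \<open>For the largest \<open>k\<close> with \<open>x\<^sub>k\<^sub>l\<close> nonzero, \<open>-x\<^sub>k\<^sub>l\<close> is the \<open>k\<close>-th coordinate of the vector.\<close>

lemma prd_inv_unit_vec_fsubD:
  assumes l: "l < n" "l < c" and r: "E l r" "j \<le> Suc r"
    and mem: "prd_inv x 0 j *\<^sub>v unit_vec n l \<in> fsub n c"
    and k: "c \<le> k" "k < j" "inversion k l"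
  shows "x (k, l) = 0"
  using r(2) mem k(2)
proof (induction j)
  case (Suc j)
  have jn: "j < n" using Suc.prems(1) E_less[OF r(1)] by simp
  have jc: "c \<le> j" using Suc.prems(3) k(1) by simp
  have split: "prd_inv x 0 (Suc j) *\<^sub>v unit_vec n l = prd_inv x 0 j *\<^sub>v (H_inv x j *\<^sub>v unit_vec n l)"
    by (rule prd_inv_vec_Suc) simp_all
  have Hc: "H_inv x j *\<^sub>v unit_vec n l \<in> carrier_vec n" by (rule mult_mat_vec_carrier[OF H_carrier(2)]) simp
  \<comment> \<open>The factors with index below \<open>j\<close> leave coordinate \<open>j\<close>
    alone, so the coordinate with the largest first index is read off first. Once it vanishes,
    \<open>H_inv x j\<close> fixes \<open>e_l\<close> and the induction continues.\<close>
  have "(prd_inv x 0 (Suc j) *\<^sub>v unit_vec n l) $ j = (H_inv x j *\<^sub>v unit_vec n l) $ j"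
    unfolding split using Hc jn by (intro prd_inv_coordinate) simp_all
  then have zero: "(H_inv x j *\<^sub>v unit_vec n l) $ j = 0"
    using Suc.prems(2) jc jn by (simp add: fsub_def)
  have lj: "l < j" using l(2) jc by simp
  have Nj: "N x j $$ (j, l) = 0"
    using zero lj jn l by (simp add: H_vec mult_mat_unit_vec[OF N_carrier(1)])
  then have xj: "inversion j l \<Longrightarrow> x (j, l) = 0" using N_row[OF jn l(1), of x] by simp
  show ?case
  proof (cases "k = j")
    case True
    then show ?thesis using xj k(3) by simp
  next
    case False
    have "N x j *\<^sub>v unit_vec n l = 0\<^sub>v n" using r(1) Suc.prems(1) Nj by (intro N_unit_vec_left) simp_all
    then have "H_inv x j *\<^sub>v unit_vec n l = unit_vec n l" by (simp add: H_vec)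
    then have "prd_inv x 0 j *\<^sub>v unit_vec n l \<in> fsub n c" using Suc.prems(2) split by simp
    then show ?thesis using Suc.IH Suc.prems False by simp
  qed
qed simp

text \<open>The argument of \<open>h\<close> is counted from 0 here while its values are unchanged,
  so \<open>h b \<le> a\<close> says that row \<open>a\<close> lies outside
  \<open>fsub n (h b)\<close>. The columns can be treated one at a time: each is zero or is
  controlled by the left neighbour of its label.\<close>

lemma hess_condition_iff:
  assumes strict: "\<And>l r. E l r \<Longrightarrow> l < h r" and h: "\<And>r. r < n \<Longrightarrow> h r \<le> r"
  shows "(\<forall>a<n. \<forall>b<n. h b \<le> a \<longrightarrow> (prd_inv x 0 n * Y * prd x 0 n) $$ (a, b) = 0) \<longleftrightarrow>
    (\<forall>k l. inversion k l \<and> (\<exists>r. E l r \<and> h r \<le> k) \<longrightarrow> x (k, l) = 0)"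
proof -
  let ?Z = "prd_inv x 0 n * Y * prd x 0 n"
  have Zc: "?Z \<in> carrier_mat n n"
    by (rule mult_carrier_mat[OF mult_carrier_mat[OF prd_carrier(2) Y_carrier(1)] prd_carrier(1)])
  have col: "?Z $$ (a, b) = (?Z *\<^sub>v unit_vec n b) $ a" if "a < n" "b < n" for a b
    using that mult_mat_unit_vec[OF Zc that(2)] Zc by (metis carrier_matD index_col)
  have "(\<forall>a<n. h r \<le> a \<longrightarrow> ?Z $$ (a, r) = 0) \<longleftrightarrow>
      (\<forall>k l. inversion k l \<and> E l r \<and> h r \<le> k \<longrightarrow> x (k, l) = 0)" if r: "r < n" for r
  proof (cases "\<exists>l. E l r")
    case True
    then obtain l where l: "E l r" by blast
    have eq: "(\<forall>a<n. h r \<le> a \<longrightarrow> ?Z $$ (a, r) = 0) \<longleftrightarrow> prd_inv x 0 (Suc r) *\<^sub>v unit_vec n l \<in> fsub n (h r)"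
      using col[OF _ r] conjugate_unit_vec(1)[OF l, of x]
        mult_mat_vec_carrier[OF prd_carrier(2) unit_vec_carrier, of x 0 "Suc r" l]
      unfolding fsub_def by (simp del: prd_inv.simps)
    show ?thesis unfolding eq
    proof (intro iffI allI impI)
      fix k l' assume *: "prd_inv x 0 (Suc r) *\<^sub>v unit_vec n l \<in> fsub n (h r)"
        "inversion k l' \<and> E l' r \<and> h r \<le> k"
      then have "l' = l" using l E_fun by blast
      then show "x (k, l') = 0"
        using * prd_inv_unit_vec_fsubD[OF E_less(1)[OF l] strict[OF l] l le_refl *(1)] inversionD(5)[of k l r]
        by simp
    next
      assume "\<forall>k l. inversion k l \<and> E l r \<and> h r \<le> k \<longrightarrow> x (k, l) = 0"
      then show "prd_inv x 0 (Suc r) *\<^sub>v unit_vec n l \<in> fsub n (h r)"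
        using l by (intro prd_inv_unit_vec_fsub[OF E_less(1)[OF l] strict[OF l] _ l]) simp_all
    qed
  next
    case False
    then have "?Z $$ (a, r) = 0" if "a < n" for a
      using col[OF that r] conjugate_unit_vec(2)[OF False r] that E_less by simp
    then show ?thesis using False by blast
  qed
  note columns = this
  have "(\<forall>a<n. \<forall>b<n. h b \<le> a \<longrightarrow> ?Z $$ (a, b) = 0) \<longleftrightarrow>
      (\<forall>r<n. \<forall>a<n. h r \<le> a \<longrightarrow> ?Z $$ (a, r) = 0)" by blast
  also have "\<dots> \<longleftrightarrow> (\<forall>r<n. \<forall>k l. inversion k l \<and> E l r \<and> h r \<le> k \<longrightarrow> x (k, l) = 0)"
    by (intro all_cong columns)
  also have "\<dots> \<longleftrightarrow> (\<forall>k l. inversion k l \<and> (\<exists>r. E l r \<and> h r \<le> k) \<longrightarrow> x (k, l) = 0)"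
    using E_less(2) by blast
  finally show ?thesis .
qed

section \<open>Factorization of flags in the Springer fiber\<close>

lemma inverse_upper_rows:
  fixes T S :: "complex mat"
  assumes T: "T \<in> carrier_mat n n" "\<And>a. a < n \<Longrightarrow> T $$ (a, a) \<noteq> 0"
    and S: "S \<in> carrier_mat n n" "T * S = 1\<^sub>m n"
    and upper: "\<And>a b. a < n \<Longrightarrow> c \<le> a \<Longrightarrow> b < a \<Longrightarrow> T $$ (a, b) = 0"
    and ab: "a < n" "c \<le> a" "b < a"
  shows "S $$ (a, b) = 0"
  using ab
proof (induction "n - a" arbitrary: a rule: less_induct)
  case less
  have "T $$ (a, i) * S $$ (i, b) = 0" if i: "i < n" "i \<noteq> a" for i
  proof (cases "i < a")
    case True
    then show ?thesis using upper less.prems by simp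
  next
    case False
    then have "S $$ (i, b) = 0" using i less.prems by (intro less.hyps) auto
    then show ?thesis by simp
  qed
  then have "(\<Sum>i<n. T $$ (a, i) * S $$ (i, b)) = (\<Sum>i\<in>{a}. T $$ (a, i) * S $$ (i, b))"
    using less.prems by (intro sum.mono_neutral_right) auto
  moreover have "(\<Sum>i<n. T $$ (a, i) * S $$ (i, b)) = (1\<^sub>m n :: complex mat) $$ (a, b)"
    using mult_mat_entry[OF T(1) S(1), of a b] less.prems S(2) by simp
  ultimately show ?case using less.prems T(2)[of a] by simp
qed

text \<open>Row \<open>k\<close> of \<open>S * T = 1\<close> is a linear relation between the rows
  of \<open>T\<close> in the columns before \<open>k\<close>. Divided by \<open>S $$ (k, k)\<close>,
  it shows which combination of rows must be subtracted to clear row \<open>k\<close>. That this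
  subtraction is a factor \<open>H_inv x k\<close> means that the coefficients vanish off the
  inversions, and this is where the zero pattern of \<open>S * Y * T\<close> enters.\<close>

lemma factor_step:
  assumes k: "k < n"
    and T: "tri n p T" "\<And>a. a < n \<Longrightarrow> T $$ (a, a) \<noteq> 0"
    and S: "S \<in> carrier_mat n n" "T * S = 1\<^sub>m n" "S * T = 1\<^sub>m n"
    and upper: "\<And>a b. a < n \<Longrightarrow> k < a \<Longrightarrow> b < a \<Longrightarrow> T $$ (a, b) = 0"
    and Z: "\<And>a b. a < n \<Longrightarrow> b \<le> a \<Longrightarrow> (S * Y * T) $$ (a, b) = 0"
  obtains c where "\<And>x. (\<And>l. x (k, l) = (if inversion k l then c l else 0)) \<Longrightarrow>
      (\<forall>a b. a < n \<and> k \<le> a \<and> b < a \<longrightarrow> (H_inv x k * T) $$ (a, b) = 0) \<and>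
      (\<forall>a b. a < n \<and> b \<le> a \<longrightarrow> (S * H x k * Y * (H_inv x k * T)) $$ (a, b) = 0)"
proof -
  note Tc = tri_carrier[OF T(1)]
  have triS: "tri n p S" by (rule tri_inverse[OF p_inj T S(1,3)])
  have "T $$ (a, a) * S $$ (a, a) = 1" if "a < n" for a
    using tri_mult_diag[OF p_inj T(1) triS that] S(2) that by simp
  then have Skk: "S $$ (k, k) \<noteq> 0" using k by force
  have S0: "S $$ (a, b) = 0" if "a < n" "k < a" "b < a" for a b
    using inverse_upper_rows[OF Tc T(2) S(1,2), of "Suc k" a b] upper that by simp
  have Skj: "S $$ (k, j) = 0" if j: "j < k" "\<not> inversion k j" for j
  proof (cases "p j < p k")
    case True
    then show ?thesis using triD[OF triS] j k by simp
  next
    case False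
    then have "p k < p j" using p_eq[of j k] j k by fastforce
    then obtain r where r: "E j r" "r \<le> k" using j k by (auto simp: inversion_def not_less)
    have rn: "r < n" using r k by simp
    \<comment> \<open>The entry in question is the entry \<open>(k, r)\<close> of
      \<open>S * Y\<close>, and \<open>S * Y = (S * Y * T) * S\<close>. In row \<open>k\<close> the
      first factor vanishes up to column \<open>k\<close>, and in column \<open>r\<close> the second
      vanishes below row \<open>k\<close>, as \<open>r \<le> k\<close>.\<close>
    have "S * Y * (T * S) = S * (Y * T) * S" by (rule mat_assoc4[OF S(1) Y_carrier(1) Tc S(1)])
    also have "S * (Y * T) = S * Y * T" by (rule assoc_mult_mat[OF S(1) Y_carrier(1) Tc, symmetric])
    finally have "S * Y = S * Y * T * S"
      unfolding S(2) using right_mult_one_mat[OF mult_carrier_mat[OF S(1) Y_carrier(1)]] by simp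
    then have "S $$ (k, j) = (S * Y * T * S) $$ (k, r)"
      using mult_Y_index(1)[OF S(1) k rn r(1)] by simp
    also have "\<dots> = (\<Sum>a<n. (S * Y * T) $$ (k, a) * S $$ (a, r))"
      by (rule mult_mat_entry[OF mult_carrier_mat[OF mult_carrier_mat[OF S(1) Y_carrier(1)] Tc] S(1) k rn])
    also have "\<dots> = 0"
    proof (intro sum.neutral ballI)
      fix a assume "a \<in> {..<n}"
      then show "(S * Y * T) $$ (k, a) * S $$ (a, r) = 0"
        using Z[OF k, of a] S0[of a r] r(2) by (cases "a \<le> k") auto
    qed
    finally show ?thesis .
  qed
  \<comment> \<open>Normalized so that \<open>c k = -1\<close>: left of the diagonal, row
    \<open>k\<close> of \<open>T - N x k * T\<close> is minus the sum of the rows of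
    \<open>T\<close> with weights \<open>c i\<close>, which is a multiple of row \<open>k\<close> of
    \<open>S * T\<close>.\<close>
  define c where "c j = - S $$ (k, j) / S $$ (k, k)" for j
  have "(\<forall>a b. a < n \<and> k \<le> a \<and> b < a \<longrightarrow> (H_inv x k * T) $$ (a, b) = 0) \<and>
      (\<forall>a b. a < n \<and> b \<le> a \<longrightarrow> (S * H x k * Y * (H_inv x k * T)) $$ (a, b) = 0)"
    if x: "\<And>l. x (k, l) = (if inversion k l then c l else 0)" for x
  proof -
    let ?T' = "H_inv x k * T" and ?S' = "S * H x k"
    have T'c: "?T' \<in> carrier_mat n n" by (rule mult_carrier_mat[OF H_carrier(2) Tc])
    have S'c: "?S' \<in> carrier_mat n n" by (rule mult_carrier_mat[OF S(1) H_carrier(1)])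
    have T'_index: "?T' $$ (a, b) = T $$ (a, b) - (\<Sum>i<n. N x k $$ (a, i) * T $$ (i, b))"
      if "a < n" "b < n" for a b
    proof -
      have "?T' = T - N x k * T" unfolding H_inv_def
        using minus_mult_distrib_mat[OF one_carrier_mat N_carrier(1) Tc] left_mult_one_mat[OF Tc] by simp
      then show ?thesis
        using that Tc mult_mat_entry[OF N_carrier(1) Tc that] by (simp del: index_mult_mat(1))
    qed
    have T'0: "?T' $$ (a, b) = 0" if ab: "a < n" "k \<le> a" "b < a" for a b
    proof (cases "a = k")
      case False
      then have "N x k $$ (a, i) = 0" if "i < n" for i
        using N_nonzero[of x k a i] that ab by force
      then show ?thesis using T'_index[of a b] upper[of a b] ab False by simp
    next
      case True
      have b: "b < n" "b < k" using ab True by auto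
      have "N x k $$ (k, i) * T $$ (i, b)
          = (if i = k then 0 else c i * T $$ (i, b))" if i: "i < n" for i
      proof (cases "i < k")
        case True
        then show ?thesis using N_row[OF k i, of x] x[of i] Skj[OF True] by (auto simp: c_def)
      next
        case False
        then show ?thesis
          using upper[of i b] i b N_row[OF k i, of x] inversionD(1)[of k i] by (cases "i = k") auto
      qed
      then have "(\<Sum>i<n. N x k $$ (k, i) * T $$ (i, b)) = (\<Sum>i<n. if i = k then 0 else c i * T $$ (i, b))"
        by (intro sum.cong) auto
      also have "\<dots> = (\<Sum>i\<in>{..<n} - {k}. c i * T $$ (i, b))"
        by (intro sum.mono_neutral_cong_right) auto
      also have "\<dots> = (\<Sum>i<n. c i * T $$ (i, b)) - c k * T $$ (k, b)"
        using k by (simp add: sum_diff1)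
      also have "(\<Sum>i<n. c i * T $$ (i, b)) = - (\<Sum>i<n. S $$ (k, i) * T $$ (i, b)) / S $$ (k, k)"
        by (simp add: c_def sum_divide_distrib sum_negf)
      also have "(\<Sum>i<n. S $$ (k, i) * T $$ (i, b)) = 0"
        using mult_mat_entry[OF S(1) Tc k b(1)] S(3) b k by simp
      finally have "(\<Sum>i<n. N x k $$ (k, i) * T $$ (i, b)) = T $$ (k, b)"
        using Skk by (simp add: c_def)
      then show ?thesis using T'_index[OF k b(1)] True by simp
    qed
    have inv': "?T' * ?S' = 1\<^sub>m n"
    proof -
      have "?T' * ?S' = H_inv x k * (T * S) * H x k" by (rule mat_assoc4[OF H_carrier(2) Tc S(1) H_carrier(1)])
      then show ?thesis unfolding S(2) using right_mult_one_mat[OF H_carrier(2)] H_inverse(2) by simp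
    qed
    have T'diag: "?T' $$ (a, a) \<noteq> 0" if "a < n" for a
      using tri_mult_diag[OF p_inj H_tri(2) T(1) that] H_diag(2)[OF that] T(2)[OF that] by simp
    have S'0: "?S' $$ (a, b) = 0" if "a < n" "k \<le> a" "b < a" for a b
      by (rule inverse_upper_rows[OF T'c T'diag S'c inv' T'0 that])
    have "(?S' * Y * ?T') $$ (a, b) = 0" if ab: "a < n" "b \<le> a" for a b
    \<comment> \<open>For \<open>b \<le> k\<close> the column \<open>T e_b\<close> lies where
      \<open>H x k\<close> commutes with \<open>Y\<close>, so the conjugation leaves this column of
      \<open>S * Y * T\<close> unchanged. For larger \<open>b\<close> the relevant rows of both
      outer factors are already upper triangular and \<open>Y\<close> is strictly upper
      triangular.\<close>
    proof (cases "b \<le> k")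
      case True
      have b: "b < n" using ab by simp
      let ?e = "unit_vec n b :: complex vec"
      let ?u = "T *\<^sub>v ?e"
      have u: "?u \<in> fsub n (Suc k)"
        using upper True b Tc by (auto simp: fsub_def mult_mat_unit_vec[OF Tc b])
      note uc = fsub_carrier[OF u]
      have Hu: "H_inv x k *\<^sub>v ?u \<in> fsub n (Suc k)" using u by (intro H_fsub) simp_all
      have YHu: "Y *\<^sub>v (H_inv x k *\<^sub>v ?u) \<in> carrier_vec n" "Y *\<^sub>v ?u \<in> carrier_vec n"
        by (intro mult_mat_vec_carrier[OF Y_carrier(1)] fsub_carrier[OF Hu] uc)+
      have "(?S' * Y * ?T') *\<^sub>v ?e = (?S' * Y) *\<^sub>v (?T' *\<^sub>v ?e)"
        by (rule assoc_mult_mat_vec[OF mult_carrier_mat[OF S'c Y_carrier(1)] T'c]) simp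
      also have "?T' *\<^sub>v ?e = H_inv x k *\<^sub>v ?u" by (rule assoc_mult_mat_vec[OF H_carrier(2) Tc]) simp
      also have "(?S' * Y) *\<^sub>v \<dots> = ?S' *\<^sub>v (Y *\<^sub>v (H_inv x k *\<^sub>v ?u))"
        by (rule assoc_mult_mat_vec[OF S'c Y_carrier(1) fsub_carrier[OF Hu]])
      also have "\<dots> = S *\<^sub>v (H x k *\<^sub>v (Y *\<^sub>v (H_inv x k *\<^sub>v ?u)))"
        by (rule assoc_mult_mat_vec[OF S(1) H_carrier(1) YHu(1)])
      also have "H x k *\<^sub>v (Y *\<^sub>v (H_inv x k *\<^sub>v ?u)) = Y *\<^sub>v (H x k *\<^sub>v (H_inv x k *\<^sub>v ?u))"
        by (rule H_comm[OF Hu k, symmetric])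
      also have "H x k *\<^sub>v (H_inv x k *\<^sub>v ?u) = ?u"
        unfolding assoc_mult_mat_vec[OF H_carrier(1) H_carrier(2) uc, symmetric] H_inverse
        by (rule one_mult_mat_vec[OF uc])
      also have "S *\<^sub>v (Y *\<^sub>v ?u) = (S * Y) *\<^sub>v ?u"
        by (rule assoc_mult_mat_vec[OF S(1) Y_carrier(1) uc, symmetric])
      also have "\<dots> = (S * Y * T) *\<^sub>v ?e"
        by (rule assoc_mult_mat_vec[OF mult_carrier_mat[OF S(1) Y_carrier(1)] Tc, symmetric]) simp
      finally have "col (?S' * Y * ?T') b = col (S * Y * T) b"
        using mult_mat_unit_vec[OF mult_carrier_mat[OF mult_carrier_mat[OF S'c Y_carrier(1)] T'c] b]
          mult_mat_unit_vec[OF mult_carrier_mat[OF mult_carrier_mat[OF S(1) Y_carrier(1)] Tc] b] by simp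
      moreover have "A $$ (a, b) = col A b $ a" if "A \<in> carrier_mat n n" for A :: "complex mat"
        using that ab b by simp
      ultimately have "(?S' * Y * ?T') $$ (a, b) = (S * Y * T) $$ (a, b)"
        using mult_carrier_mat[OF mult_carrier_mat[OF S'c Y_carrier(1)] T'c]
          mult_carrier_mat[OF mult_carrier_mat[OF S(1) Y_carrier(1)] Tc] by metis
      then show ?thesis using Z[OF ab] by simp
    next
      case False
      have b: "b < n" using ab by simp
      have "?S' $$ (a, i) * (Y * ?T') $$ (i, b) = 0" if i: "i < n" for i
      proof (cases "i < a")
        case True
        then show ?thesis using S'0[of a i] ab False by simp
      next
        case ia: False
        have "(Y * ?T') $$ (i, b) = 0"
        proof (cases "\<exists>r. E i r")
          case True
          then obtain r where r: "E i r" by blast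
          have "?T' $$ (r, b) = 0" using E_strict[OF r] E_less(2)[OF r] ia ab False by (intro T'0) auto
          then show ?thesis using Y_mult_index(1)[OF T'c b i r] by simp
        next
          case False
          then show ?thesis by (rule Y_mult_index(2)[OF T'c b i])
        qed
        then show ?thesis by simp
      qed
      then have "(\<Sum>i<n. ?S' $$ (a, i) * (Y * ?T') $$ (i, b)) = 0" by (intro sum.neutral) simp
      moreover have "?S' * Y * ?T' = ?S' * (Y * ?T')" by (rule assoc_mult_mat[OF S'c Y_carrier(1) T'c])
      ultimately show ?thesis
        using mult_mat_entry[OF S'c mult_carrier_mat[OF Y_carrier(1) T'c] ab(1) b] by simp
    qed
    then show ?thesis using T'0 by blast
  qed
  then show thesis by (rule that)
qed

text \<open>Descending induction on \<open>k\<close>. Besides the cleared rows from \<open>k\<close>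
  on, the invariant records that the conjugate of \<open>Y\<close> stays strictly upper triangular,
  since the coefficients for the next row depend on it.\<close>

lemma factorization:
  assumes A: "tri n p A" "\<And>a. a < n \<Longrightarrow> A $$ (a, a) \<noteq> 0"
    and B: "B \<in> carrier_mat n n" "A * B = 1\<^sub>m n" "B * A = 1\<^sub>m n"
    and Z: "\<And>a b. a < n \<Longrightarrow> b \<le> a \<Longrightarrow> (B * Y * A) $$ (a, b) = 0"
  obtains x where "\<And>k l. \<not> inversion k l \<Longrightarrow> x (k, l) = 0" "tri n (\<lambda>a. a) (prd_inv x 0 n * A)"
proof -
  note Ac = tri_carrier[OF A(1)]
  have "\<exists>x. (\<forall>k l. \<not> inversion k l \<longrightarrow> x (k, l) = 0) \<and>
      (\<forall>a b. a < n \<and> k \<le> a \<and> b < a \<longrightarrow> (prd_inv x k n * A) $$ (a, b) = 0) \<and>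
      (\<forall>a b. a < n \<and> b \<le> a \<longrightarrow> (B * prd x k n * Y * (prd_inv x k n * A)) $$ (a, b) = 0)"
    if "k \<le> n" for k
    using that
  proof (induction k rule: inc_induct)
    case base
    have "B * prd x n n = B" "prd_inv x n n * A = A" for x
      using B(1) Ac by simp_all
    then show ?case using Z by (intro exI[of _ "\<lambda>_. 0"]) auto
  next
    case (step k)
    obtain x where x': "(\<forall>k l. \<not> inversion k l \<longrightarrow> x (k, l) = 0) \<and>
      (\<forall>a b. a < n \<and> Suc k \<le> a \<and> b < a \<longrightarrow> (prd_inv x (Suc k) n * A) $$ (a, b) = 0) \<and>
      (\<forall>a b. a < n \<and> b \<le> a \<longrightarrow>
        (B * prd x (Suc k) n * Y * (prd_inv x (Suc k) n * A)) $$ (a, b) = 0)"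
      using step.IH by (rule exE)
    have x: "\<not> inversion i l \<Longrightarrow> x (i, l) = 0"
      "a < n \<Longrightarrow> k < a \<Longrightarrow> b < a \<Longrightarrow> (prd_inv x (Suc k) n * A) $$ (a, b) = 0"
      "a < n \<Longrightarrow> b \<le> a \<Longrightarrow>
        (B * prd x (Suc k) n * Y * (prd_inv x (Suc k) n * A)) $$ (a, b) = 0" for i l a b
      using x' by (simp_all only: Suc_le_eq simp_thms)
    let ?T = "prd_inv x (Suc k) n * A" and ?S = "B * prd x (Suc k) n"
    have T: "tri n p ?T" by (rule tri_mult[OF prd_tri(2) A(1)])
    have Td: "?T $$ (a, a) \<noteq> 0" if "a < n" for a
      using tri_mult_diag[OF p_inj prd_tri(2) A(1) that] prd_diag(2)[OF that] A(2)[OF that] by simp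
    have Sc: "?S \<in> carrier_mat n n" by (rule mult_carrier_mat[OF B(1) prd_carrier(1)])
    have TS: "?T * ?S = 1\<^sub>m n"
      unfolding mat_assoc4[OF prd_carrier(2) Ac B(1) prd_carrier(1)] B(2)
      by (simp add: right_mult_one_mat[OF prd_carrier(2)] prd_inverse)
    have ST: "?S * ?T = 1\<^sub>m n" by (rule mat_mult_left_right_inverse[OF tri_carrier[OF T] Sc TS])
    obtain c where c: "\<And>x. (\<And>l. x (k, l) = (if inversion k l then c l else 0)) \<Longrightarrow>
        (\<forall>a b. a < n \<and> k \<le> a \<and> b < a \<longrightarrow> (H_inv x k * ?T) $$ (a, b) = 0) \<and>
        (\<forall>a b. a < n \<and> b \<le> a \<longrightarrow> (?S * H x k * Y * (H_inv x k * ?T)) $$ (a, b) = 0)"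
      using factor_step[OF step.hyps(2) T Td Sc TS ST x(2,3)] by blast
    \<comment> \<open>Only values with first index \<open>k\<close> are overwritten, and the factors
      with larger index do not read them.\<close>
    define x' where "x' = (\<lambda>(i, l). if i = k then if inversion k l then c l else 0 else x (i, l))"
    have eq: "prd x' (Suc k) n = prd x (Suc k) n" by (rule prd_cong) (simp add: x'_def)
    have eq_inv: "prd_inv x' (Suc k) n = prd_inv x (Suc k) n" by (rule prd_inv_cong) (simp add: x'_def)
    have single: "prd x' k (Suc k) = H x' k" "prd_inv x' k (Suc k) = H_inv x' k"
      by (simp_all add: right_mult_one_mat[OF H_carrier(1)] left_mult_one_mat[OF H_carrier(2)])
    have "prd_inv x' k n = H_inv x' k * prd_inv x (Suc k) n"
      "prd x' k n = prd x (Suc k) n * H x' k"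
      using prd_inv_split[of k "Suc k" n x'] prd_split[of k "Suc k" n x'] step.hyps
      by (simp_all only: eq eq_inv single le_SucI Suc_leI le_refl)
    then have "prd_inv x' k n * A = H_inv x' k * ?T" "B * prd x' k n = ?S * H x' k"
      using assoc_mult_mat[OF H_carrier(2) prd_carrier(2) Ac] assoc_mult_mat[OF B(1) prd_carrier(1) H_carrier(1)]
      by (simp_all only:)
    moreover have "\<forall>k l. \<not> inversion k l \<longrightarrow> x' (k, l) = 0" using x(1) by (auto simp: x'_def)
    moreover have "x' (k, l) = (if inversion k l then c l else 0)" for l by (simp add: x'_def)
    ultimately show ?case using c[of x'] by (intro exI[of _ x']) simp
  qed
  from this[OF le0] obtain x where x': "(\<forall>k l. \<not> inversion k l \<longrightarrow> x (k, l) = 0) \<and>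
      (\<forall>a b. a < n \<and> 0 \<le> a \<and> b < a \<longrightarrow> (prd_inv x 0 n * A) $$ (a, b) = 0) \<and>
      (\<forall>a b. a < n \<and> b \<le> a \<longrightarrow> (B * prd x 0 n * Y * (prd_inv x 0 n * A)) $$ (a, b) = 0)"
    by (rule exE)
  have "\<not> inversion k l \<Longrightarrow> x (k, l) = 0"
    "a < n \<Longrightarrow> b < a \<Longrightarrow> (prd_inv x 0 n * A) $$ (a, b) = 0" for k l a b
    using x' by (simp_all only: simp_thms le0)
  moreover have "prd_inv x 0 n * A \<in> carrier_mat n n" by (rule mult_carrier_mat[OF prd_carrier(2) Ac])
  ultimately show thesis by (intro that[of x]) (simp_all add: tri_def)
qed

text \<open>Row \<open>k\<close> of \<open>H\<^sub>k U = H\<^sub>k\<^sub>-\<^sub>1 \<dots> H\<^sub>0 T\<close> with \<open>T\<close> upper triangular is a unitriangular system (in the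
  order \<open>p\<close>) for the coordinates \<open>x (k, l)\<close>.\<close>

lemma coordinates_polynomial:
  assumes M: "\<And>x. tri n p (M x)" "\<And>x a. a < n \<Longrightarrow> M x $$ (a, a) = 1"
    and T: "\<And>x. x \<in> S \<Longrightarrow> tri n (\<lambda>a. a) (T x)" "\<And>x. x \<in> S \<Longrightarrow> M x = prd x 0 n * T x"
    and poly: "\<And>i j. i < n \<Longrightarrow> j < n \<Longrightarrow> (\<lambda>x. M x $$ (i, j)) \<in> pull_poly C S m"
    and kl: "inversion k l"
  shows "(\<lambda>x. x (k, l)) \<in> pull_poly C S m"
  using kl
proof (induction "n - k" arbitrary: k l rule: less_induct)
  case (less k l0)
  have k: "k < n" using inversionD(2)[OF less.prems] .
  \<comment> \<open>For \<open>x\<close> in \<open>S\<close> this is \<open>H_k ... H_0 T\<close>.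
    Besides the entries of \<open>M x\<close> its definition uses only coordinates with first index
    above \<open>k\<close>, which the outer induction supplies.\<close>
  let ?U = "\<lambda>x. prd_inv x (Suc k) n * M x"
  note Mc = tri_carrier[OF M(1)]
  have N_poly: "(\<lambda>x. N x j $$ (a, b)) \<in> pull_poly C S m" if "k < j" "a < n" "b < n" for a b j
  proof -
    have "(\<lambda>x. \<Sum>lm\<in>{(l, m). l < n \<and> m < n \<and> inversion j l \<and> (E ^^ m) a j \<and> (E ^^ m) b l}. x (j, fst lm))
        \<in> pull_poly C S m"
      by (rule pull_poly_sum) (use less.hyps that k in force)
    then show ?thesis using that by (simp add: N_def split_beta)
  qed
  have Hinv_poly: "(\<lambda>x. H_inv x j $$ (a, b)) \<in> pull_poly C S m" if "k < j" "a < n" "b < n" for a b j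
    using that N_poly[OF that] by (simp add: H_inv_def pull_poly_diff pull_poly_const)
  have prd_poly: "(\<lambda>x. prd_inv x (Suc k) j $$ (a, b)) \<in> pull_poly C S m" if "a < n" "b < n" for a b j
    using that
  proof (induction j arbitrary: a b)
    case 0
    then show ?case by (simp add: pull_poly_const)
  next
    case (Suc j)
    show ?case
    proof (cases "Suc k \<le> j")
      case True
      then have "(\<lambda>x. (prd_inv x (Suc k) j * H_inv x j) $$ (a, b)) \<in> pull_poly C S m"
        using Suc by (intro pull_poly_mat_mult Hinv_poly) auto
      then show ?thesis using True by simp
    next
      case False
      then show ?thesis using Suc.prems by (simp add: pull_poly_const)
    qed
  qed
  have U_poly: "(\<lambda>x. ?U x $$ (a, b)) \<in> pull_poly C S m" if "a < n" "b < n" for a b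
    using that by (intro pull_poly_mat_mult[OF prd_carrier(2) Mc] prd_poly poly)
  have U: "tri n p (?U x)" "a < n \<Longrightarrow> ?U x $$ (a, a) = 1" for x a
    using tri_mult[OF prd_tri(2) M(1)] tri_mult_diag[OF p_inj prd_tri(2) M(1)] prd_diag(2) M(2) by simp_all
  \<comment> \<open>Removing \<open>H x k\<close> leaves \<open>prd x 0 k * T x\<close>. Its row
    \<open>k\<close> is row \<open>k\<close> of \<open>T x\<close>, because the factors below
    \<open>k\<close> do not touch that row, and it vanishes left of the diagonal.\<close>
  have row: "?U x $$ (k, b) = (\<Sum>j<n. N x k $$ (k, j) * ?U x $$ (j, b))" if x: "x \<in> S" and b: "b < k" for x b
  proof -
    note Tc = tri_carrier[OF T(1)[OF x]]
    have bn: "b < n" using b k by simp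
    have "H_inv x k * ?U x = prd_inv x k n * M x"
    proof -
      have "prd_inv x k (Suc k) = H_inv x k" by (simp add: left_mult_one_mat[OF H_carrier(2)])
      then have "prd_inv x k n = H_inv x k * prd_inv x (Suc k) n"
        using prd_inv_split[of k "Suc k" n x] k by simp
      then show ?thesis using assoc_mult_mat[OF H_carrier(2) prd_carrier(2) Mc] by simp
    qed
    also have "\<dots> = prd_inv x k n * (prd x k n * prd x 0 k * T x)"
      using T(2)[OF x] prd_split[of 0 k n x] k by simp
    also have "\<dots> = prd_inv x k n * (prd x k n * (prd x 0 k * T x))"
      using assoc_mult_mat[OF prd_carrier(1) prd_carrier(1) Tc] by simp
    also have "\<dots> = prd_inv x k n * prd x k n * (prd x 0 k * T x)"
      by (rule assoc_mult_mat[OF prd_carrier(2) prd_carrier(1) mult_carrier_mat[OF prd_carrier(1) Tc], symmetric])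
    also have "\<dots> = prd x 0 k * T x"
      unfolding prd_inverse by (rule left_mult_one_mat[OF mult_carrier_mat[OF prd_carrier(1) Tc]])
    finally have eq: "H_inv x k * ?U x = prd x 0 k * T x" .
    have "prd x 0 k $$ (k, i) * T x $$ (i, b) = 0" if i: "i < n" for i
    proof (cases "b < i")
      case True
      then show ?thesis using triD[OF T(1)[OF x] i bn] by simp
    next
      case False
      then have "prd x 0 k $$ (k, i) = 0" using prd_row[OF le_refl k i] b k i by simp
      then show ?thesis by simp
    qed
    then have "(prd x 0 k * T x) $$ (k, b) = 0"
      unfolding mult_mat_entry[OF prd_carrier(1) Tc k bn] by (intro sum.neutral) simp
    moreover have "H_inv x k * ?U x = ?U x - N x k * ?U x"
      unfolding H_inv_def
      using minus_mult_distrib_mat[OF one_carrier_mat N_carrier(1) tri_carrier[OF U(1)[of x]]]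
        left_mult_one_mat[OF tri_carrier[OF U(1)[of x]]] by simp
    ultimately have "(?U x - N x k * ?U x) $$ (k, b) = 0" using eq by simp
    moreover have "(?U x - N x k * ?U x) $$ (k, b) = ?U x $$ (k, b) - (N x k * ?U x) $$ (k, b)"
      using carrier_matD(2)[OF Mc[of x]] k bn by (intro index_minus_mat(1)) simp_all
    moreover have "(N x k * ?U x) $$ (k, b) = (\<Sum>j<n. N x k $$ (k, j) * ?U x $$ (j, b))"
      by (rule mult_mat_entry[OF N_carrier(1) tri_carrier[OF U(1)[of x]] k bn])
    ultimately show ?thesis by (simp only: right_minus_eq)
  qed
  have "(\<lambda>x. x (k, b)) \<in> pull_poly C S m" if "inversion k b" for b
    using that
  proof (induction "p b" arbitrary: b rule: less_induct)
    case (less b)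
    have b: "b < k" "b < n" using inversionD(1,3)[OF less.prems] by auto
    \<comment> \<open>The coordinates recovered before \<open>b\<close>. Triangularity of
      \<open>?U x\<close> in the order \<open>p\<close> kills the terms after \<open>b\<close>, and
      its diagonal entry 1 isolates \<open>x (k, b)\<close>.\<close>
    let ?J = "{j. j < n \<and> inversion k j \<and> p j < p b}"
    have "(\<lambda>x. ?U x $$ (k, b) - (\<Sum>j\<in>?J. x (k, j) * ?U x $$ (j, b))) \<in> pull_poly C S m"
      using less.hyps k b by (intro pull_poly_diff pull_poly_sum pull_poly_mult U_poly) auto
    moreover have "?U x $$ (k, b) - (\<Sum>j\<in>?J. x (k, j) * ?U x $$ (j, b)) = x (k, b)" if x: "x \<in> S" for x
    proof -
      have "N x k $$ (k, j) * ?U x $$ (j, b) = 0" if "j < n" "j \<notin> insert b ?J" for j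
      proof (cases "inversion k j")
        case True
        then have "p b < p j" using that p_eq[of j b] b by (cases "p j < p b") force+
        then show ?thesis using triD[OF U(1) that(1) b(2)] by simp
      qed (use N_row[OF k that(1)] in simp)
      then have "(\<Sum>j<n. N x k $$ (k, j) * ?U x $$ (j, b)) = (\<Sum>j\<in>insert b ?J. N x k $$ (k, j) * ?U x $$ (j, b))"
        using b by (intro sum.mono_neutral_right) auto
      also have "\<dots> = (\<Sum>j\<in>insert b ?J. x (k, j) * ?U x $$ (j, b))"
        using less.prems b by (intro sum.cong) (auto simp: N_row[OF k])
      also have "\<dots> = x (k, b) + (\<Sum>j\<in>?J. x (k, j) * ?U x $$ (j, b))"
        using U(2)[OF b(2)] by simp
      finally show ?thesis using row[OF x b(1)] by simp
    qed
    ultimately show ?case by (rule pull_poly_cong)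
  qed
  then show ?case using less.prems .
qed

end

section \<open>Permutations counted from 0 and their matrices\<close>

definition pos :: "(nat \<Rightarrow> nat) \<Rightarrow> nat \<Rightarrow> nat" where
  "pos w j = w (Suc j) - 1"

lemma pos_bij:
  assumes "w permutes {1..n}"
  shows "bij_betw (pos w) {..<n} {..<n}"
proof -
  have P: "bij_betw (\<lambda>x. x - 1) {1..n} {..<n}"
    by (rule bij_betw_byWitness[where f' = Suc]) auto
  have S: "bij_betw Suc {..<n} {1..n}"
    by (rule bij_betw_byWitness[where f' = "\<lambda>x. x - 1"]) auto
  show ?thesis
    using bij_betw_trans[OF bij_betw_trans[OF S permutes_imp_bij[OF assms]] P] by (simp add: o_def pos_def[abs_def])
qed

lemma Suc_pos: "w permutes {1..n} \<Longrightarrow> j < n \<Longrightarrow> Suc (pos w j) = w (Suc j)"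
  using permutes_in_image[of w "{1..n}" "Suc j"] by (simp add: pos_def)

lemma pos_less: "w permutes {1..n} \<Longrightarrow> j < n \<Longrightarrow> pos w j < n"
  using bij_betwE[OF pos_bij] by auto

lemma pos_inj: "w permutes {1..n} \<Longrightarrow> inj_on (pos w) {..<n}"
  using pos_bij by (auto simp: bij_betw_def)

lemma perm_mat_carrier [simp]: "perm_mat n w \<in> carrier_mat n n"
  by (simp add: perm_mat_def)

lemma perm_mat_index:
  assumes "w permutes {1..n}" "i < n" "j < n"
  shows "perm_mat n w $$ (i, j) = of_bool (i = pos w j)"
  using assms Suc_pos[OF assms(1,3)] by (auto simp: perm_mat_def)

lemma mult_perm_mat_index:
  assumes w: "w permutes {1..n}" and A: "A \<in> carrier_mat n n" and ij: "i < n" "j < n"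
  shows "(A * perm_mat n w) $$ (i, j) = A $$ (i, pos w j)"
proof -
  have "(A * perm_mat n w) $$ (i, j) = (\<Sum>k<n. if k = pos w j then A $$ (i, k) else 0)"
    unfolding mult_mat_entry[OF A perm_mat_carrier ij]
    using w ij by (intro sum.cong) (auto simp: perm_mat_index)
  then show ?thesis using pos_less[OF w ij(2)] by simp
qed

lemma perm_mat_mult_index:
  assumes w: "w permutes {1..n}" and A: "A \<in> carrier_mat n n" and ij: "i < n" "j < n"
  shows "(perm_mat n w * A) $$ (pos w i, j) = A $$ (i, j)"
proof -
  have "perm_mat n w $$ (pos w i, k) * A $$ (k, j) = (if k = i then A $$ (k, j) else 0)" if "k < n" for k
    using that perm_mat_index[OF w pos_less[OF w ij(1)] that] inj_onD[OF pos_inj[OF w], of i k] ij by auto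
  then have "(perm_mat n w * A) $$ (pos w i, j) = (\<Sum>k<n. if k = i then A $$ (k, j) else 0)"
    unfolding mult_mat_entry[OF perm_mat_carrier A pos_less[OF w ij(1)] ij(2)] by (intro sum.cong) auto
  then show ?thesis using ij by simp
qed

lemma transpose_perm_mat:
  assumes w: "w permutes {1..n}"
  shows "transpose_mat (perm_mat n w) * perm_mat n w = 1\<^sub>m n"
    "perm_mat n w * transpose_mat (perm_mat n w) = 1\<^sub>m n"
proof -
  let ?Q = "transpose_mat (perm_mat n w)"
  have Q: "?Q \<in> carrier_mat n n" by (simp add: transpose_carrier_mat)
  show *: "?Q * perm_mat n w = 1\<^sub>m n"
  proof (rule eq_matI)
    fix i j assume "i < dim_row (1\<^sub>m n :: complex mat)" "j < dim_col (1\<^sub>m n :: complex mat)"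
    then have ij: "i < n" "j < n" by auto
    have "?Q $$ (i, pos w j) = of_bool (pos w j = pos w i)"
      using ij pos_less[OF w ij(2)] perm_mat_index[OF w pos_less[OF w ij(2)] ij(1)]
      by (simp add: perm_mat_def)
    then show "(?Q * perm_mat n w) $$ (i, j) = 1\<^sub>m n $$ (i, j)"
      using mult_perm_mat_index[OF w Q ij] inj_onD[OF pos_inj[OF w], of i j] ij by auto
  qed (simp_all add: perm_mat_def)
  show "perm_mat n w * ?Q = 1\<^sub>m n" by (rule mat_mult_left_right_inverse[OF Q perm_mat_carrier *])
qed

lemma perm_mat_GL: "w permutes {1..n} \<Longrightarrow> perm_mat n w \<in> GL n"
  using det_mult[of "transpose_mat (perm_mat n w)" n "perm_mat n w"] transpose_perm_mat(1)[of w n]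
  by (auto simp: GL_iff_det)

section \<open>Minors and the big cell of a permutation\<close>

text \<open>Rows \<open>p 0, \<dots>, p (j - 1), p k\<close> and columns \<open>0, \<dots>, j\<close>.\<close>

definition minor :: "(nat \<Rightarrow> nat) \<Rightarrow> nat \<Rightarrow> nat \<Rightarrow> complex mat \<Rightarrow> complex" where
  "minor p k j g = det (mat (Suc j) (Suc j) (\<lambda>(a, b). g $$ (p (if a < j then a else k), b)))"

lemma minor_poly:
  assumes "\<And>a. a < n \<Longrightarrow> p a < n" "k < n" "j < n"
  shows "minor p k j \<in> poly_funs (entries n)"
proof -
  have "(\<lambda>g. g $$ (p (if a < j then a else k), b)) \<in> poly_funs (entries n)" if "a < Suc j" "b < Suc j" for a b
  proof (rule poly_funs.gen)
    have "p (if a < j then a else k) < n" "b < n" using assms that by auto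
    then show "(\<lambda>g. g $$ (p (if a < j then a else k), b)) \<in> entries n" by blast
  qed
  then have "(\<lambda>g. \<Sum>s \<in> {s. s permutes {0..<Suc j}}. signof s *
      (\<Prod>i = 0..<Suc j. g $$ (p (if i < j then i else k), s i))) \<in> poly_funs (entries n)"
    by (intro poly_funs_sum poly_funs.mult poly_funs.const poly_funs_prod)
      (auto dest: permutes_in_image)
  moreover have "minor p k j = (\<lambda>g. \<Sum>s \<in> {s. s permutes {0..<Suc j}}. signof s *
      (\<Prod>i = 0..<Suc j. g $$ (p (if i < j then i else k), s i)))"
  proof
    fix g
    show "minor p k j g = (\<Sum>s \<in> {s. s permutes {0..<Suc j}}. signof s *
      (\<Prod>i = 0..<Suc j. g $$ (p (if i < j then i else k), s i)))"
      unfolding minor_def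
      by (subst det_def'[OF mat_carrier], intro sum.cong refl arg_cong2[where f = "(*)"] prod.cong)
        (auto dest: permutes_in_image)
  qed
  ultimately show ?thesis by simp
qed

text \<open>The first \<open>Suc j\<close> columns of \<open>g * T\<close> are combinations of those
  of \<open>g\<close> by the leading block of \<open>T\<close>. The determinant of this block does
  not depend on \<open>k\<close>, so it cancels in ratios of minors with the same
  \<open>j\<close>.\<close>

lemma minor_mult_tri:
  assumes p: "\<And>a. a < n \<Longrightarrow> p a < n" and kj: "k < n" "j < n"
    and g: "g \<in> carrier_mat n n" and T: "tri n (\<lambda>a. a) T"
  shows "minor p k j (g * T) = minor p k j g * det (mat (Suc j) (Suc j) (\<lambda>ab. T $$ ab))"
proof -
  let ?G = "mat (Suc j) (Suc j) (\<lambda>(a, b). g $$ (p (if a < j then a else k), b))"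
  let ?T = "mat (Suc j) (Suc j) (\<lambda>ab. T $$ ab)"
  have "mat (Suc j) (Suc j) (\<lambda>(a, b). (g * T) $$ (p (if a < j then a else k), b)) = ?G * ?T"
  proof (rule eq_matI)
    fix a b assume "a < dim_row (?G * ?T)" "b < dim_col (?G * ?T)"
    then have ab: "a < Suc j" "b < Suc j" by auto
    let ?r = "p (if a < j then a else k)"
    have r: "?r < n" "b < n" using p kj ab by auto
    have "(g * T) $$ (?r, b) = (\<Sum>c<n. g $$ (?r, c) * T $$ (c, b))"
      by (rule mult_mat_entry[OF g tri_carrier[OF T] r])
    also have "\<dots> = (\<Sum>c<Suc j. g $$ (?r, c) * T $$ (c, b))"
      using kj ab r(2) triD[OF T] by (intro sum.mono_neutral_right) auto
    also have "\<dots> = (\<Sum>c<Suc j. ?G $$ (a, c) * ?T $$ (c, b))" using ab by (intro sum.cong) auto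
    also have "\<dots> = (?G * ?T) $$ (a, b)"
      by (rule mult_mat_entry[symmetric, of _ "Suc j" "Suc j" _ "Suc j"]) (use ab in auto)
    finally show "mat (Suc j) (Suc j) (\<lambda>(a, b). (g * T) $$ (p (if a < j then a else k), b)) $$ (a, b)
        = (?G * ?T) $$ (a, b)" using ab by simp
  qed auto
  then show ?thesis unfolding minor_def by (simp add: det_mult[of _ "Suc j"])
qed

lemma det_leading_tri:
  assumes T: "T \<in> GL n" "tri n (\<lambda>a. a) T" and j: "j < n"
  shows "det (mat (Suc j) (Suc j) (\<lambda>ab. T $$ ab)) \<noteq> 0"
proof -
  let ?T = "mat (Suc j) (Suc j) (\<lambda>ab. T $$ ab)"
  have "upper_triangular ?T" using triD[OF T(2)] j by (intro upper_triangularI) auto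
  then have "det ?T = prod_list (diag_mat ?T)" by (rule det_upper_triangular) auto
  then show ?thesis using GL_tri_diag[OF T] j by (auto simp: diag_mat_def prod_list_zero_iff)
qed

text \<open>The selected rows of \<open>M\<close> form a lower triangular block whose diagonal
  entries are 1 except for the last one, \<open>M $$ (k, j)\<close>. Hence the minors read off the
  entries of \<open>M\<close>.\<close>

lemma minor_lower_unitriangular:
  assumes w: "w permutes {1..n}" and M: "M \<in> carrier_mat n n" and kj: "k < n" "j \<le> k"
    and low: "\<And>a b. a < b \<Longrightarrow> b < n \<Longrightarrow> M $$ (a, b) = 0" and diag: "\<And>a. a < n \<Longrightarrow> M $$ (a, a) = 1"
  shows "minor (pos w) k j (perm_mat n w * M) = M $$ (k, j)"
proof -
  let ?G = "mat (Suc j) (Suc j) (\<lambda>(a, b). (perm_mat n w * M) $$ (pos w (if a < j then a else k), b))"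
  have G: "?G $$ (a, b) = M $$ (if a < j then a else k, b)" if "a < Suc j" "b < Suc j" for a b
    using that kj perm_mat_mult_index[OF w M, of "if a < j then a else k" b] by auto
  have "det ?G = prod_list (diag_mat ?G)"
  proof (rule det_lower_triangular)
    show "?G $$ (a, b) = 0" if "a < b" "b < Suc j" for a b using that G[of a b] low[of a b] kj by auto
  qed auto
  also have "diag_mat ?G = map (\<lambda>i. ?G $$ (i, i)) [0..<Suc j]"
    by (simp only: diag_mat_def dim_row_mat)
  also have "prod_list \<dots> = (\<Prod>i<Suc j. ?G $$ (i, i))"
    using prod.distinct_set_conv_list[of "[0..<Suc j]" "\<lambda>i. ?G $$ (i, i)"]
    by (simp only: set_upt distinct_upt atLeast0LessThan)
  also have "\<dots> = (\<Prod>i<j. ?G $$ (i, i)) * ?G $$ (j, j)" by (rule prod.lessThan_Suc)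
  also have "(\<Prod>i<j. ?G $$ (i, i)) = 1"
  proof (intro prod.neutral ballI)
    fix i assume "i \<in> {..<j}"
    then show "?G $$ (i, i) = 1" using G[of i i] kj diag[of i] by simp
  qed
  finally show ?thesis using G[of j j] by (simp add: minor_def)
qed

text \<open>This is \<open>w B^- B / B\<close> with \<open>B^-\<close> the lower triangular group:
  the minors are the leading principal minors of \<open>w\<inverse> g\<close>, and their
  nonvanishing is the condition for an LU factorization.\<close>

definition big_cell :: "nat \<Rightarrow> (nat \<Rightarrow> nat) \<Rightarrow> (nat \<Rightarrow> complex vec set) set" where
  "big_cell n w = flag_of n ` {g \<in> GL n. \<forall>j<n. minor (pos w) j j g \<noteq> 0}"

lemma flag_of_big_cell_iff:
  assumes w: "w permutes {1..n}" and g: "g \<in> GL n"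
  shows "flag_of n g \<in> big_cell n w \<longleftrightarrow> (\<forall>j<n. minor (pos w) j j g \<noteq> 0)"
proof
  assume "flag_of n g \<in> big_cell n w"
  then obtain h where h: "h \<in> GL n" "\<forall>j<n. minor (pos w) j j h \<noteq> 0" "flag_of n h = flag_of n g"
    by (auto simp: big_cell_def)
  obtain T where T: "T \<in> GL n" "tri n (\<lambda>a. a) T" "g = h * T" using flag_of_eqD[OF h(1) g h(3)] by blast
  then show "\<forall>j<n. minor (pos w) j j g \<noteq> 0"
    using minor_mult_tri[of n "pos w" _ _ h T] pos_less[OF w] h GL_carrier[OF h(1)] det_leading_tri by auto
qed (use g in \<open>auto simp: big_cell_def\<close>)

lemma openin_big_cell:
  assumes w: "w permutes {1..n}"
  shows "openin (flag_top n) (big_cell n w)"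
proof -
  have "(\<lambda>g. \<Prod>j<n. minor (pos w) j j g) \<in> poly_funs (entries n)"
    by (intro poly_funs_prod minor_poly) (auto simp: pos_less[OF w])
  moreover have "{g \<in> GL n. flag_of n g \<in> big_cell n w} = {g \<in> GL n. (\<Prod>j<n. minor (pos w) j j g) \<noteq> 0}"
    using flag_of_big_cell_iff[OF w] by auto
  moreover have "big_cell n w \<subseteq> Flags n" by (auto simp: big_cell_def intro: flag_of_Flags)
  ultimately show ?thesis
    using openin_zariski_nonzero[of "\<lambda>g. \<Prod>j<n. minor (pos w) j j g" "entries n" "GL n"]
    by (simp only: openin_flag_top ztop_GL_variety simp_thms)
qed

text \<open>On the big cell of \<open>w\<close> the ratio does not depend on the chosen representative.\<close>

definition cell_coord :: "nat \<Rightarrow> (nat \<Rightarrow> nat) \<Rightarrow> nat \<Rightarrow> nat \<Rightarrow> (nat \<Rightarrow> complex vec set) \<Rightarrow> complex" where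
  "cell_coord n w k j V = (let g = SOME g. g \<in> GL n \<and> flag_of n g = V in
     minor (pos w) k j g / minor (pos w) j j g)"

lemma cell_coord_flag_of:
  assumes w: "w permutes {1..n}" and kj: "k < n" "j < n" and g: "g \<in> GL n"
  shows "cell_coord n w k j (flag_of n g) = minor (pos w) k j g / minor (pos w) j j g"
proof -
  define h where "h = (SOME h. h \<in> GL n \<and> flag_of n h = flag_of n g)"
  have "h \<in> GL n \<and> flag_of n h = flag_of n g" unfolding h_def by (rule someI[of _ g]) (use g in simp)
  then have h: "h \<in> GL n" "flag_of n h = flag_of n g" by auto
  obtain T where T: "T \<in> GL n" "tri n (\<lambda>a. a) T" "g = h * T" using flag_of_eqD[OF h(1) g h(2)] by blast
  have "cell_coord n w k j (flag_of n g) = minor (pos w) k j h / minor (pos w) j j h"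
    by (simp add: cell_coord_def h_def Let_def)
  also have "\<dots> = minor (pos w) k j g / minor (pos w) j j g"
    unfolding T(3) using minor_mult_tri[of n "pos w" _ j h T] kj pos_less[OF w] GL_carrier[OF h(1)]
      T(2) det_leading_tri[OF T(1,2) kj(2)] by simp
  finally show ?thesis .
qed

lemma cell_coord_ratfuns:
  assumes w: "w permutes {1..n}" and kj: "k < n" "j < n"
  shows "cell_coord n w k j \<in> ratfuns n (big_cell n w)"
proof (rule ratfunsI)
  show "minor (pos w) k j \<in> poly_funs (entries n)" "minor (pos w) j j \<in> poly_funs (entries n)"
    using kj by (auto intro!: minor_poly simp: pos_less[OF w])
qed (use cell_coord_flag_of[OF w kj] flag_of_big_cell_iff[OF w] kj in auto)

text \<open>A nonzero minor has a nonzero Leibniz term. Each factor of this term is an entry of the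
  upper triangular \<open>b\<close>, which gives \<open>pos w i \<le> pos v (s i)\<close>; summation
  over \<open>i\<close> removes the unknown permutation \<open>s\<close>.\<close>

lemma minor_perm_compare:
  assumes w: "w permutes {1..n}" and v: "v permutes {1..n}" and b: "tri n (\<lambda>a. a) b" and j: "j < n"
    and nz: "minor (pos w) j j (b * perm_mat n v) \<noteq> 0"
  shows "(\<Sum>i\<le>j. pos w i) \<le> (\<Sum>i\<le>j. pos v i)"
proof -
  let ?G = "mat (Suc j) (Suc j) (\<lambda>(a, c). (b * perm_mat n v) $$ (pos w (if a < j then a else j), c))"
  have "(\<Sum>s \<in> {s. s permutes {0..<Suc j}}. signof s * (\<Prod>i = 0..<Suc j. ?G $$ (i, s i))) \<noteq> 0"
    using nz unfolding minor_def by (subst det_def'[symmetric]) auto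
  then obtain s where s: "s permutes {0..<Suc j}" "(\<Prod>i = 0..<Suc j. ?G $$ (i, s i)) \<noteq> 0"
    by (metis (no_types, lifting) mem_Collect_eq mult_zero_right sum.neutral)
  have "pos w i \<le> pos v (s i)" if i: "i \<le> j" for i
  proof (rule ccontr)
    assume "\<not> pos w i \<le> pos v (s i)"
    moreover have si: "s i \<le> j" using permutes_in_image[OF s(1), of i] i by auto
    ultimately have "b $$ (pos w i, pos v (s i)) = 0"
      using triD[OF b pos_less[OF w] pos_less[OF v]] i j by simp
    then have "?G $$ (i, s i) = 0"
      using i si j mult_perm_mat_index[OF v tri_carrier[OF b] pos_less[OF w], of i "s i"]
      by (cases "i < j") (auto simp: not_less)
    moreover have "i \<in> {0..<Suc j}" using i by simp
    ultimately show False using s(2) by (metis (no_types, lifting) finite_atLeastLessThan prod_zero_iff)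
  qed
  then have "(\<Sum>i\<le>j. pos w i) \<le> (\<Sum>i\<le>j. pos v (s i))" by (intro sum_mono) auto
  also have "\<dots> = (\<Sum>i\<in>s ` {..j}. pos v i)"
    using permutes_inj_on[OF s(1)] by (subst sum.reindex) (auto intro: inj_on_subset)
  also have "s ` {..j} = {..j}"
    using permutes_image[OF s(1)] by (simp add: atLeast0LessThan lessThan_Suc_atMost)
  finally show ?thesis .
qed

text \<open>The function by which the Schubert cells are ordered in the paving.\<close>

definition cell_height :: "nat \<Rightarrow> (nat \<Rightarrow> nat) \<Rightarrow> nat" where
  "cell_height n w = (\<Sum>j<n. \<Sum>i\<le>j. pos w i)"

text \<open>Every partial sum for \<open>w\<close> is at most the one for \<open>v\<close>. Equal
  totals force equality of all partial sums, and consecutive partial sums determine the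
  values.\<close>

lemma big_cell_meets_schubert:
  assumes w: "w permutes {1..n}" and v: "v permutes {1..n}"
    and V: "V \<in> big_cell n w" "V \<in> schubert_cell n v"
  shows "cell_height n w \<le> cell_height n v"
    and "cell_height n w = cell_height n v \<Longrightarrow> w = v"
proof -
  obtain b where b: "b \<in> Borel n" "V = flag_of n (b * perm_mat n v)"
    using V(2) by (auto simp: schubert_cell_def)
  then have le: "(\<Sum>i\<le>j. pos w i) \<le> (\<Sum>i\<le>j. pos v i)" if "j < n" for j
    using V(1) flag_of_big_cell_iff[OF w GL_mult[OF _ perm_mat_GL[OF v]], of b] that
    by (intro minor_perm_compare[OF w v]) (auto simp: Borel_iff)
  then show "cell_height n w \<le> cell_height n v" unfolding cell_height_def by (rule sum_mono) (simp add: le)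
  assume eq: "cell_height n w = cell_height n v"
  have sums: "(\<Sum>i\<le>j. pos w i) = (\<Sum>i\<le>j. pos v i)" if j: "j < n" for j
  proof (rule ccontr)
    assume "(\<Sum>i\<le>j. pos w i) \<noteq> (\<Sum>i\<le>j. pos v i)"
    then have "cell_height n w < cell_height n v"
      unfolding cell_height_def using le j by (intro sum_strict_mono_ex1) (auto simp: le_less)
    then show False using eq by simp
  qed
  have "pos w j = pos v j" if j: "j < n" for j
  proof (cases j)
    case 0
    then show ?thesis using sums[OF j] by simp
  next
    case (Suc i)
    then show ?thesis using sums[OF j] sums[of i] j by simp
  qed
  then have "w (Suc j) = v (Suc j)" if "j < n" for j using Suc_pos w v that by metis
  then have "w x = v x" if "x \<in> {1..n}" for x using that by (cases x) auto
  then show "w = v" using w v by (metis ext permutes_not_in)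
qed

section \<open>Schubert cells\<close>

text \<open>Column \<open>j\<close> of \<open>T\<close> is sought with support on labels
  \<open>i \<le> j\<close> that do not come after \<open>j\<close> in the order \<open>p\<close>; so
  \<open>T\<close> is triangular in both orders. The equations for \<open>a \<le> j\<close> with
  \<open>p a \<le> p j\<close> form a triangular system, and the remaining entries above the
  diagonal vanish because \<open>A * T\<close> is still triangular in the order \<open>p\<close>.
  This is the usual normal form of the points of a Schubert cell.\<close>

lemma lower_unitriangular_form:
  assumes p: "inj_on p {..<n}" and A: "tri n p A" and diag: "\<And>a. a < n \<Longrightarrow> A $$ (a, a) \<noteq> 0"
    and det: "A \<in> GL n"
  shows "\<exists>T. T \<in> GL n \<and> tri n (\<lambda>a. a) T \<and> tri n p (A * T) \<and>
    (\<forall>a b. a < b \<and> b < n \<longrightarrow> (A * T) $$ (a, b) = 0) \<and> (\<forall>a<n. (A * T) $$ (a, a) = 1)"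
proof -
  \<comment> \<open>Back substitution in the order \<open>p\<close>, where \<open>m\<close> bounds
    the levels treated. The right-hand side \<open>t\<close> is kept general because the unknown at
    the top level alters the equations of all lower levels.\<close>
  have solve: "\<exists>c. (\<forall>i. c i \<noteq> 0 \<longrightarrow> i \<le> j \<and> p i < m) \<and>
      (\<forall>a\<le>j. p a < m \<longrightarrow> (\<Sum>i<n. A $$ (a, i) * c i) = t a)" if j: "j < n" for j m t
  proof (induction m arbitrary: t)
    case 0
    then show ?case by (intro exI[of _ "\<lambda>_. 0"]) simp
  next
    case (Suc m)
    show ?case
    proof (cases "\<exists>i0\<le>j. p i0 = m")
      case False
      then show ?thesis using Suc.IH[of t] less_Suc_eq by metis
    next
      case True
      then obtain i0 where i0: "i0 \<le> j" "p i0 = m" by blast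
      have i0n: "i0 < n" using i0 j by simp
      let ?x = "t i0 / A $$ (i0, i0)"
      obtain c where c: "\<And>i. c i \<noteq> 0 \<Longrightarrow> i \<le> j \<and> p i < m"
        "\<And>a. a \<le> j \<Longrightarrow> p a < m \<Longrightarrow> (\<Sum>i<n. A $$ (a, i) * c i) = t a - A $$ (a, i0) * ?x"
        using Suc.IH[of "\<lambda>a. t a - A $$ (a, i0) * ?x"] by blast
      have ci0: "c i0 = 0" using c(1)[of i0] i0 by auto
      have split: "(\<Sum>i<n. A $$ (a, i) * (c(i0 := ?x)) i) = (\<Sum>i<n. A $$ (a, i) * c i) + A $$ (a, i0) * ?x" for a
      proof -
        have "(\<Sum>i<n. A $$ (a, i) * (c(i0 := ?x)) i)
            = (\<Sum>i<n. A $$ (a, i) * c i + (if i = i0 then A $$ (a, i0) * ?x else 0))"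
          using ci0 by (intro sum.cong) auto
        then show ?thesis using i0n by (simp add: sum.distrib)
      qed
      have "(\<Sum>i<n. A $$ (a, i) * (c(i0 := ?x)) i) = t a" if a: "a \<le> j" "p a < Suc m" for a
      proof (cases "p a < m")
        case True
        then show ?thesis using split c(2)[OF a(1)] by simp
      next
        case False
        then have "a = i0" using a i0 j p by (auto intro: inj_onD)
        moreover have "A $$ (i0, i) * c i = 0" if "i < n" for i
          using c(1)[of i] triD[OF A i0n that] i0(2) by (cases "c i = 0") auto
        then have "(\<Sum>i<n. A $$ (i0, i) * c i) = 0" by (intro sum.neutral) simp
        ultimately show ?thesis using split[of i0] diag[OF i0n] by simp
      qed
      moreover have "(c(i0 := ?x)) i \<noteq> 0 \<Longrightarrow> i \<le> j \<and> p i < Suc m" for i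
        using c(1)[of i] i0 by (cases "i = i0") auto
      ultimately show ?thesis by blast
    qed
  qed
  have "\<forall>j. \<exists>c. j < n \<longrightarrow> (\<forall>i. c i \<noteq> 0 \<longrightarrow> i \<le> j \<and> p i < Suc (p j)) \<and>
      (\<forall>a\<le>j. p a < Suc (p j) \<longrightarrow> (\<Sum>i<n. A $$ (a, i) * c i) = of_bool (a = j))"
    using solve[of _ "Suc (p _)" "\<lambda>a. of_bool (a = _)"] by blast
  then obtain c where c: "\<And>j i. j < n \<Longrightarrow> c j i \<noteq> 0 \<Longrightarrow> i \<le> j \<and> p i \<le> p j"
    "\<And>j a. j < n \<Longrightarrow> a \<le> j \<Longrightarrow> p a \<le> p j \<Longrightarrow> (\<Sum>i<n. A $$ (a, i) * c j i) = of_bool (a = j)"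
    by (metis less_Suc_eq_le)
  let ?T = "mat n n (\<lambda>(i, j). c j i)"
  note Ac = tri_carrier[OF A]
  have Tc: "?T \<in> carrier_mat n n" by simp
  have T: "tri n (\<lambda>a. a) ?T" "tri n p ?T"
    using c(1) by (fastforce simp: tri_def)+
  have AT: "(A * ?T) $$ (a, j) = (\<Sum>i<n. A $$ (a, i) * c j i)" if "a < n" "j < n" for a j
    using that by (subst mult_mat_entry[OF Ac Tc that]) simp
  have triAT: "tri n p (A * ?T)" by (rule tri_mult[OF A T(2)])
  have one: "(A * ?T) $$ (a, a) = 1" if "a < n" for a using AT[OF that that] c(2)[OF that, of a] by simp
  have zero: "(A * ?T) $$ (a, b) = 0" if ab: "a < b" "b < n" for a b
  proof (cases "p a \<le> p b")
    case True
    then show ?thesis using AT[of a b] c(2)[OF ab(2), of a] ab by simp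
  next
    case False
    then show ?thesis using triD[OF triAT, of a b] ab by simp
  qed
  have "det (A * ?T) = prod_list (diag_mat (A * ?T))"
    using zero mult_carrier_mat[OF Ac Tc] by (intro det_lower_triangular) auto
  also have "\<dots> \<noteq> 0" using one Ac by (auto simp: diag_mat_def prod_list_zero_iff)
  finally have "det ?T \<noteq> 0" using det_mult[OF Ac Tc] by simp
  then have "?T \<in> GL n" by (simp add: GL_iff_det)
  then show ?thesis using T triAT zero one by (intro exI[of _ ?T]) simp
qed

text \<open>Existence in the Bruhat decomposition, by Gaussian elimination: from each
  \<open>V (Suc i) - V i\<close> a vector is chosen whose last nonzero coordinate comes as early as
  possible. These positions are distinct and form a permutation, and the chosen vectors are the
  columns of \<open>b * perm_mat n w\<close>.\<close>

lemma Flags_schubert_cell: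
  assumes V: "V \<in> Flags n"
  obtains w where "w permutes {1..n}" "V \<in> schubert_cell n w"
proof -
  have sub: "submodule class_ring (V i) (Cn n)" if "i \<le> n" for i
    using V that by (auto simp: Flags_def VectorSpace.subspace_def)
  have Vc: "V i \<subseteq> carrier_vec n" if "i \<le> n" for i
    using submodule.subset[OF sub[OF that]] by (simp add: module_vec_simps)
  have add: "u + v \<in> V i" if "i \<le> n" "u \<in> V i" "v \<in> V i" for i u v
    using submodule.m_closed[OF sub] that by (simp add: module_vec_simps)
  have smult: "c \<cdot>\<^sub>v v \<in> V i" if "i \<le> n" "v \<in> V i" for i c v
    using submodule.smult_closed[OF sub] that by (simp add: module_vec_simps)
  have zero: "0\<^sub>v n \<in> V i" if "i \<le> n" for i
    using submodule.zero_closed[OF sub[OF that]] by (simp add: module_vec_simps)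
  have mono: "V i \<subseteq> V j" if "i \<le> j" "j \<le> n" for i j
    using that
  proof (induction j rule: dec_induct)
    case (step j)
    then have "V j \<subset> V (Suc j)" using V by (simp add: Flags_def)
    then show ?case using step by auto
  qed simp
  define lead where "lead v t \<longleftrightarrow> t < n \<and> v $ t \<noteq> 0 \<and> (\<forall>j<n. t < j \<longrightarrow> v $ j = 0)" for v :: "complex vec" and t
  have ex_lead: "\<exists>t. lead v t" if "v \<in> carrier_vec n" "v \<noteq> 0\<^sub>v n" for v
  proof -
    let ?J = "{j. j < n \<and> v $ j \<noteq> 0}"
    have "?J \<noteq> {}" using that by (auto simp: vec_eq_iff)
    then have "Max ?J \<in> ?J" by (intro Max_in) auto
    moreover have "v $ j = 0" if "j < n" "Max ?J < j" for j
    proof (rule ccontr)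
      assume "v $ j \<noteq> 0"
      then have "j \<le> Max ?J" using that by (intro Max_ge) auto
      then show False using that by simp
    qed
    ultimately show ?thesis unfolding lead_def by blast
  qed
  define Q where "Q i t \<longleftrightarrow> (\<exists>v \<in> V (Suc i) - V i. lead v t)" for i t
  define t where "t i = (LEAST t. Q i t)" for i
  have "\<exists>t. Q i t" if i: "i < n" for i
  proof -
    have "V i \<subset> V (Suc i)" using V i by (simp add: Flags_def)
    then obtain v where v: "v \<in> V (Suc i) - V i" by blast
    then have "v \<in> carrier_vec n" "v \<noteq> 0\<^sub>v n" using Vc[of "Suc i"] zero[of i] i by auto
    then show ?thesis using ex_lead v unfolding Q_def by blast
  qed
  then have Qt: "Q i (t i)" if "i < n" for i unfolding t_def using that by (metis LeastI_ex)
  then have "\<forall>i. \<exists>v. i < n \<longrightarrow> v \<in> V (Suc i) - V i \<and> lead v (t i)" unfolding Q_def by blast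
  then obtain v where v: "\<And>i. i < n \<Longrightarrow> v i \<in> V (Suc i)" "\<And>i. i < n \<Longrightarrow> v i \<notin> V i"
    "\<And>i. i < n \<Longrightarrow> lead (v i) (t i)" by (metis DiffD1 DiffD2)
  have vc: "v i \<in> carrier_vec n" if "i < n" for i using v(1)[OF that] Vc[of "Suc i"] that by auto
  have tn: "t i < n" if "i < n" for i using v(3)[OF that] by (simp add: lead_def)
  have neq: "t i \<noteq> t j" if ij: "i < j" "j < n" for i j
  proof
    assume eq: "t i = t j"
    have i: "i < n" using ij by simp
    \<comment> \<open>This multiple of \<open>v i\<close> cancels the last coordinate of
      \<open>v j\<close>. As \<open>v i\<close> lies in \<open>V j\<close>, the sum stays in
      \<open>V (Suc j) - V j\<close>, and its earlier leading position contradicts the minimality of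
      \<open>t j\<close>.\<close>
    let ?c = "- (v j $ t j) / (v i $ t j)"
    let ?u = "v j + ?c \<cdot>\<^sub>v v i"
    have vij: "v i \<in> V j" using v(1)[OF i] mono[of "Suc i" j] ij by auto
    have uV: "?u \<in> V (Suc j)"
      using add[of "Suc j"] smult[of j "v i" ?c] vij v(1)[OF ij(2)] mono[of j "Suc j"] ij by auto
    have "?u + (- ?c) \<cdot>\<^sub>v v i = v j" using vc[OF i] vc[OF ij(2)] by (intro eq_vecI) auto
    then have unV: "?u \<notin> V j" using add[of j ?u "(- ?c) \<cdot>\<^sub>v v i"] smult[of j "v i" "- ?c"] vij v(2)[OF ij(2)] ij by auto
    then have "?u \<noteq> 0\<^sub>v n" using zero[of j] ij by auto
    moreover have uc: "?u \<in> carrier_vec n" using vc[OF i] vc[OF ij(2)] by simp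
    ultimately obtain s where s: "lead ?u s" using ex_lead by blast
    have "?u $ l = 0" if "l < n" "t j \<le> l" for l
      using that v(3)[OF i] v(3)[OF ij(2)] vc[OF i] vc[OF ij(2)] eq by (cases "l = t j") (auto simp: lead_def)
    then have "s < t j" using s by (force simp: lead_def)
    moreover have "Q j s" unfolding Q_def using uV unV s by blast
    ultimately show False unfolding t_def using not_less_Least by blast
  qed
  have t_inj: "inj_on t {..<n}"
    using neq by (intro inj_onI) (metis lessThan_iff linorder_neqE_nat)
  have t_bij: "bij_betw t {..<n} {..<n}"
    using t_inj tn endo_inj_surj[of "{..<n}" t] by (auto simp: bij_betw_def)
  define w where "w j = (if j \<in> {1..n} then Suc (t (j - 1)) else j)" for j
  have w: "w permutes {1..n}"
  proof (rule bij_imp_permutes)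
    have "bij_betw (\<lambda>j. Suc (t (j - 1))) {1..n} {1..n}"
    proof -
      have P: "bij_betw (\<lambda>x. x - 1) {1..n} {..<n}"
        by (rule bij_betw_byWitness[where f' = Suc]) auto
      have S: "bij_betw Suc {..<n} {1..n}"
        by (rule bij_betw_byWitness[where f' = "\<lambda>x. x - 1"]) auto
      show ?thesis using bij_betw_trans[OF bij_betw_trans[OF P t_bij] S] by (simp add: o_def)
    qed
    then show "bij_betw w {1..n} {1..n}" by (rule bij_betw_cong[THEN iffD1, rotated]) (simp add: w_def)
  qed (auto simp: w_def)
  have pos: "pos w j = t j" if "j < n" for j using that by (simp add: w_def pos_def)
  define b where "b = mat n n (\<lambda>(a, c). v (inv_into {..<n} t c) $ a)"
  have binv: "inv_into {..<n} t c < n \<and> t (inv_into {..<n} t c) = c" if "c < n" for c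
    using that t_bij by (metis bij_betw_def f_inv_into_f inv_into_into lessThan_iff)
  have bt: "b $$ (a, t j) = v j $ a" if "a < n" "j < n" for a j
    using that tn[of j] t_inj by (simp add: b_def inv_into_f_f)
  have b_tri: "tri n (\<lambda>a. a) b" unfolding tri_def
  proof (intro conjI allI impI)
    show "b $$ (a, c) = 0" if "a < n" "c < n" "c < a" for a c
      using that binv[OF that(2)] v(3)[of "inv_into {..<n} t c"] by (auto simp: b_def lead_def)
  qed (simp add: b_def)
  have bc: "b \<in> carrier_mat n n" by (simp add: b_def)
  have "b $$ (c, c) \<noteq> 0" if "c < n" for c
    using that binv[OF that] v(3)[of "inv_into {..<n} t c"] by (auto simp: b_def lead_def)
  then have "det b \<noteq> 0"
    using det_upper_triangular[OF _ bc] b_tri bc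
    by (auto simp: upper_triangular_iff_tri diag_mat_def prod_list_zero_iff)
  then have b: "b \<in> Borel n" using bc b_tri by (simp add: Borel_iff GL_iff_det)
  define A where "A = b * perm_mat n w"
  have A_index: "A $$ (a, j) = v j $ a" if "a < n" "j < n" for a j
    unfolding A_def using mult_perm_mat_index[OF w bc that] pos[OF that(2)] bt[OF that] by simp
  have A: "A \<in> GL n" unfolding A_def using b perm_mat_GL[OF w] by (auto simp: Borel_iff GL_mult)
  have Ac: "A \<in> carrier_mat n n" by (rule GL_carrier[OF A])
  have A_col: "A *\<^sub>v unit_vec n j = v j" if "j < n" for j
    unfolding mult_mat_unit_vec[OF Ac that]
    by (rule eq_vecI) (use that Ac A_index vc[OF that] in auto)
  have AV: "A *\<^sub>v u \<in> V i" if "u \<in> fsub n i" "i \<le> n" for u i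
    using that
  proof (rule fsub_induct)
    show "A *\<^sub>v 0\<^sub>v n \<in> V i"
    proof -
      have "A *\<^sub>v 0\<^sub>v n = 0\<^sub>v n" using Ac by (intro eq_vecI) auto
      then show ?thesis using zero that(2) by simp
    qed
    fix u c j assume u: "u \<in> carrier_vec n" "A *\<^sub>v u \<in> V i" and j: "j < i"
    have jn: "j < n" using j that(2) by simp
    have "A *\<^sub>v (u + c \<cdot>\<^sub>v unit_vec n j) = A *\<^sub>v u + c \<cdot>\<^sub>v v j"
      using Ac u(1) A_col[OF jn] by (simp add: mult_add_distrib_mat_vec mult_mat_vec)
    moreover have "v j \<in> V i" using v(1)[OF jn] mono[of "Suc j" i] j that(2) by auto
    ultimately show "A *\<^sub>v (u + c \<cdot>\<^sub>v unit_vec n j) \<in> V i"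
      using add[OF that(2) u(2)] smult[OF that(2)] by simp
  qed
  have "V = flag_of n A"
  proof (rule extensionalityI)
    show "V \<in> extensional {0..n}" using V by (simp add: Flags_def)
    show "flag_of n A \<in> extensional {0..n}" by (rule flag_of_extensional)
    fix i assume "i \<in> {0..n}"
    then have i: "i \<le> n" by simp
    have "V i \<subseteq> (\<lambda>u. A *\<^sub>v u) ` fsub n i"
    proof
      fix x assume x: "x \<in> V i"
      obtain B where B: "B \<in> GL n" "A * B = 1\<^sub>m n" using GL_inverse[OF A] by metis
      have xc: "x \<in> carrier_vec n" using x Vc[OF i] by auto
      let ?c = "B *\<^sub>v x"
      have cc: "?c \<in> carrier_vec n" by (rule mult_mat_vec_carrier[OF GL_carrier[OF B(1)] xc])
      have Ax: "A *\<^sub>v ?c = x"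
        using assoc_mult_mat_vec[OF Ac GL_carrier[OF B(1)] xc] B(2) xc by simp
      \<comment> \<open>Downwards from \<open>n\<close>: a nonzero coordinate of \<open>x\<close> at
        some \<open>j \<ge> i\<close> would express \<open>v j\<close> through \<open>x\<close> and
        columns before \<open>j\<close>, all of which lie in \<open>V j\<close>.\<close>
      have "?c \<in> fsub n j" if "i \<le> j" "j \<le> n" for j
        using that
      proof (induction "n - j" arbitrary: j)
        case 0
        then show ?case using cc by (simp add: fsub_def)
      next
        case (Suc d)
        then have jn: "j < n" by simp
        have c: "?c \<in> fsub n (Suc j)" using Suc.hyps Suc.prems by (intro Suc.hyps(1)) auto
        have "?c $ j = 0"
        proof (rule ccontr)
          assume nz: "?c $ j \<noteq> 0"
          let ?d = "?c + (- ?c $ j) \<cdot>\<^sub>v unit_vec n j"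
          have d: "?d \<in> fsub n j" by (rule fsub_Suc_decompose[OF c jn])
          have "A *\<^sub>v ?d = x + (- ?c $ j) \<cdot>\<^sub>v v j"
            using Ac cc A_col[OF jn] Ax by (simp add: mult_add_distrib_mat_vec mult_mat_vec)
          then have "v j = (1 / ?c $ j) \<cdot>\<^sub>v (x + (-1) \<cdot>\<^sub>v (A *\<^sub>v ?d))"
            using nz vc[OF jn] xc by (intro eq_vecI) (auto simp: field_simps)
          also have "\<dots> \<in> V j"
            using AV[OF d] x mono[of i j] Suc.prems by (intro smult add) auto
          finally show False using v(2)[OF jn] by simp
        qed
        then show ?case using c by (auto simp: fsub_def not_less_eq_eq le_less)
      qed
      then have "?c \<in> fsub n i" using i by simp
      then show "x \<in> (\<lambda>u. A *\<^sub>v u) ` fsub n i" using Ax by (metis imageI)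
    qed
    then show "V i = flag_of n A i" using AV i Ac by (auto simp: flag_of_eq)
  qed
  then have "V \<in> schubert_cell n w" unfolding schubert_cell_def A_def using b by blast
  then show thesis using that w by blast
qed

section \<open>Tableaux\<close>

lemma boxes_Sigma: "boxes lam = Sigma {..<length lam} (\<lambda>r. {..<lam ! r})"
  by (auto simp: boxes_def)

lemma finite_boxes [simp]: "finite (boxes lam)"
  by (simp add: boxes_Sigma)

lemma card_boxes: "card (boxes lam) = sum_list lam"
  by (simp add: boxes_Sigma sum_list_sum_nth atLeast0LessThan)

text \<open>The reading order of the base filling: \<open>base_label\<close> counts the boxes up to
  the given one in this order.\<close>

definition box_less :: "nat \<times> nat \<Rightarrow> nat \<times> nat \<Rightarrow> bool" where
  "box_less b b' \<longleftrightarrow> snd b < snd b' \<or> snd b = snd b' \<and> fst b > fst b'"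

lemma base_label_mono:
  assumes "b \<in> boxes lam" "b' \<in> boxes lam" "box_less b b'"
  shows "base_label lam b < base_label lam b'"
proof -
  obtain r c r' c' where b: "b = (r, c)" "b' = (r', c')" by fastforce
  have "{(i, j) \<in> boxes lam. j < c \<or> (j = c \<and> r \<le> i)} \<subset> {(i, j) \<in> boxes lam. j < c' \<or> (j = c' \<and> r' \<le> i)}"
  proof
    show "{(i, j) \<in> boxes lam. j < c \<or> (j = c \<and> r \<le> i)} \<subseteq> {(i, j) \<in> boxes lam. j < c' \<or> (j = c' \<and> r' \<le> i)}"
      using assms(3) unfolding b box_less_def by auto
    have "(r', c') \<in> {(i, j) \<in> boxes lam. j < c' \<or> (j = c' \<and> r' \<le> i)}"
      "(r', c') \<notin> {(i, j) \<in> boxes lam. j < c \<or> (j = c \<and> r \<le> i)}"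
      using assms unfolding b box_less_def by auto
    then show "{(i, j) \<in> boxes lam. j < c \<or> (j = c \<and> r \<le> i)} \<noteq> {(i, j) \<in> boxes lam. j < c' \<or> (j = c' \<and> r' \<le> i)}"
      by blast
  qed
  moreover have "finite {(i, j) \<in> boxes lam. j < c' \<or> (j = c' \<and> r' \<le> i)}"
    by (rule finite_subset[OF _ finite_boxes[of lam]]) auto
  ultimately show ?thesis unfolding b base_label_def by (simp add: psubset_card_mono)
qed

lemma box_less_total: "b = b' \<or> box_less b b' \<or> box_less b' b"
  by (cases b; cases b') (auto simp: box_less_def)

lemma base_label_less_iff:
  assumes "b \<in> boxes lam" "b' \<in> boxes lam"
  shows "base_label lam b < base_label lam b' \<longleftrightarrow> box_less b b'"
  using base_label_mono[OF assms] base_label_mono[OF assms(2,1)] box_less_total[of b b'] by auto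

lemma base_label_bij: "bij_betw (base_label lam) (boxes lam) {1..sum_list lam}"
proof -
  have inj: "inj_on (base_label lam) (boxes lam)"
    by (rule inj_onI) (metis base_label_mono box_less_total less_irrefl)
  have "base_label lam ` boxes lam \<subseteq> {1..sum_list lam}"
  proof safe
    fix r c assume b: "(r, c) \<in> boxes lam"
    let ?D = "{(i, j) \<in> boxes lam. j < c \<or> (j = c \<and> r \<le> i)}"
    have "(r, c) \<in> ?D" "?D \<subseteq> boxes lam" using b by auto
    then have "?D \<noteq> {}" "finite ?D" "card ?D \<le> sum_list lam"
      using finite_subset[OF _ finite_boxes] card_mono[OF finite_boxes, of ?D lam] card_boxes by auto
    then show "base_label lam (r, c) \<in> {1..sum_list lam}"
      by (simp add: base_label_def Suc_le_eq card_gt_0_iff)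
  qed
  moreover have "card (base_label lam ` boxes lam) = card {1..sum_list lam}"
    using card_image[OF inj] card_boxes by simp
  ultimately have "base_label lam ` boxes lam = {1..sum_list lam}"
    by (intro card_subset_eq) auto
  then show ?thesis using inj by (simp add: bij_betw_def)
qed

definition left_of :: "nat list \<Rightarrow> nat \<Rightarrow> nat \<Rightarrow> bool" where
  "left_of lam a b \<longleftrightarrow> (\<exists>r c. (r, c) \<in> boxes lam \<and> (r, Suc c) \<in> boxes lam \<and>
     a = base_label lam (r, c) \<and> b = base_label lam (r, Suc c))"

lemma X_mat_carrier [simp]: "X_mat n lam \<in> carrier_mat n n"
  by (simp add: X_mat_def)

lemma X_mat_index:
  assumes "i < n" "j < n"
  shows "X_mat n lam $$ (i, j) = of_bool (left_of lam (Suc i) (Suc j))"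
proof -
  let ?S = "{(base_label lam (r, c), base_label lam (r, Suc c)) | r c.
       (r, c) \<in> boxes lam \<and> (r, Suc c) \<in> boxes lam}"
  have "?S \<subseteq> base_label lam ` boxes lam \<times> base_label lam ` boxes lam" by auto
  then have fin: "finite ?S" by (rule finite_subset) simp
  have "X_mat n lam $$ (i, j) = (\<Sum>ab \<in> ?S. if ab = (Suc i, Suc j) then 1 else 0)"
    using assms by (auto simp: X_mat_def elem_mat_def split_beta intro!: sum.cong)
  also have "\<dots> = of_bool ((Suc i, Suc j) \<in> ?S)" using fin by simp
  also have "(Suc i, Suc j) \<in> ?S \<longleftrightarrow> left_of lam (Suc i) (Suc j)"
    by (auto simp: left_of_def)
  finally show ?thesis .
qed

text \<open>In \<open>R(w)\<close> the label \<open>k\<close> sits in the box with base label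
  \<open>w k\<close>; hence these are the labels, counted from 0, of horizontally adjacent boxes of
  \<open>R(w)\<close>.\<close>

definition nbr :: "nat \<Rightarrow> nat list \<Rightarrow> (nat \<Rightarrow> nat) \<Rightarrow> nat \<Rightarrow> nat \<Rightarrow> bool" where
  "nbr n lam w l r \<longleftrightarrow> l < n \<and> r < n \<and> left_of lam (w (Suc l)) (w (Suc r))"

lemma nbrE:
  assumes "nbr n lam w l r"
  obtains i c where "(i, c) \<in> boxes lam" "(i, Suc c) \<in> boxes lam"
    "w (Suc l) = base_label lam (i, c)" "w (Suc r) = base_label lam (i, Suc c)" "l < n" "r < n"
  using assms unfolding nbr_def left_of_def by blast

section \<open>The filling \<open>R(w)\<close> and its labels\<close>

locale filling =
  fixes n :: nat and lam :: "nat list" and w :: "nat \<Rightarrow> nat"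
  assumes n_pos: "n > 0" and n_sum: "sum_list lam = n" and w: "w permutes {1..n}"
begin

abbreviation P :: "complex mat" where "P \<equiv> perm_mat n w"

lemma label_ex:
  assumes "l < n"
  obtains r c where "(r, c) \<in> boxes lam" "base_label lam (r, c) = w (Suc l)"
proof -
  have "w (Suc l) \<in> {1..n}" using permutes_in_image[OF w, of "Suc l"] assms by simp
  then have "w (Suc l) \<in> base_label lam ` boxes lam"
    using base_label_bij[of lam] n_sum by (simp add: bij_betw_def)
  then obtain b where "b \<in> boxes lam" "base_label lam b = w (Suc l)" by auto
  then show thesis using that by (cases b) auto
qed

lemma label_eq: "b \<in> boxes lam \<Longrightarrow> b' \<in> boxes lam \<Longrightarrow> base_label lam b = base_label lam b' \<longleftrightarrow> b = b'"
  using base_label_bij[of lam] by (auto simp: bij_betw_def inj_on_eq_iff)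

lemma pos_less_iff: "a < n \<Longrightarrow> b < n \<Longrightarrow> pos w a < pos w b \<longleftrightarrow> w (Suc a) < w (Suc b)"
  using Suc_pos[OF w, of a] Suc_pos[OF w, of b] by (metis Suc_less_eq)

lemma left_box: "(r, Suc c) \<in> boxes lam \<Longrightarrow> (r, c) \<in> boxes lam"
  by (auto simp: boxes_def)

lemma w_eq: "w a = w b \<longleftrightarrow> a = b"
  using permutes_inj[OF w] by (auto simp: inj_eq)

text \<open>A step to the left lowers the column by one and keeps the row, so it preserves the
  reading order. This accounts for all the conditions except \<open>E_ex\<close>, which rests on the
  rows being left-justified.\<close>

sublocale row_labels n "pos w" "nbr n lam w"
proof
  show "inj_on (pos w) {..<n}" by (rule pos_inj[OF w])
  show "nbr n lam w l r \<Longrightarrow> l < n" "nbr n lam w l r \<Longrightarrow> r < n" for l r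
    by (auto simp: nbr_def)
  show "l = l'" if nb: "nbr n lam w l r" "nbr n lam w l' r" for l l' r
  proof -
    obtain i c where b: "(i, c) \<in> boxes lam" "(i, Suc c) \<in> boxes lam"
      "w (Suc l) = base_label lam (i, c)" "w (Suc r) = base_label lam (i, Suc c)"
      using nbrE[OF nb(1)] by metis
    obtain i' c' where b': "(i', c') \<in> boxes lam" "(i', Suc c') \<in> boxes lam"
      "w (Suc l') = base_label lam (i', c')" "w (Suc r) = base_label lam (i', Suc c')"
      using nbrE[OF nb(2)] by metis
    have "(i, Suc c) = (i', Suc c')" using label_eq[OF b(2) b'(2)] b(4) b'(4) by simp
    then have "w (Suc l) = w (Suc l')" using b(3) b'(3) by simp
    then show ?thesis by (simp add: w_eq)
  qed
  show "pos w l < pos w l'" if nb: "nbr n lam w l r" "nbr n lam w l' r'" "pos w r < pos w r'" for l l' r r'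
  proof -
    obtain i c where b: "(i, c) \<in> boxes lam" "(i, Suc c) \<in> boxes lam"
      "w (Suc l) = base_label lam (i, c)" "w (Suc r) = base_label lam (i, Suc c)" "l < n" "r < n"
      using nbrE[OF nb(1)] by metis
    obtain i' c' where b': "(i', c') \<in> boxes lam" "(i', Suc c') \<in> boxes lam"
      "w (Suc l') = base_label lam (i', c')" "w (Suc r') = base_label lam (i', Suc c')" "l' < n" "r' < n"
      using nbrE[OF nb(2)] by metis
    have "box_less (i, Suc c) (i', Suc c')"
      using nb(3) base_label_less_iff[OF b(2) b'(2)] b b' by (simp add: pos_less_iff)
    then have "box_less (i, c) (i', c')" by (simp add: box_less_def)
    then show ?thesis using base_label_less_iff[OF b(1) b'(1)] b b' by (simp add: pos_less_iff)
  qed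
  show "pos w l < pos w r" if nb: "nbr n lam w l r" for l r
  proof -
    obtain i c where b: "(i, c) \<in> boxes lam" "(i, Suc c) \<in> boxes lam"
      "w (Suc l) = base_label lam (i, c)" "w (Suc r) = base_label lam (i, Suc c)" "l < n" "r < n"
      using nbrE[OF nb(1)] by metis
    then show ?thesis using base_label_less_iff[OF b(1,2)] by (simp add: pos_less_iff box_less_def)
  qed
  show "\<exists>l'. nbr n lam w l' r'" if nb: "nbr n lam w l r" "r' < n" "pos w r < pos w r'" for l r r'
  proof -
    obtain i c where b: "(i, Suc c) \<in> boxes lam" "w (Suc r) = base_label lam (i, Suc c)" "r < n"
      using nbrE[OF nb(1)] by metis
    obtain i' c' where b': "(i', c') \<in> boxes lam" "base_label lam (i', c') = w (Suc r')"
      using label_ex[OF nb(2)] by blast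
    have "box_less (i, Suc c) (i', c')"
      using nb(2,3) base_label_less_iff[OF b(1) b'(1)] b b' by (simp add: pos_less_iff)
    \<comment> \<open>The box of \<open>r\<close> is outside the first column, and the box of
      \<open>r'\<close> is read later, so it is outside the first column as well.\<close>
    then obtain d where d: "c' = Suc d" by (cases c') (auto simp: box_less_def)
    have box: "(i', d) \<in> boxes lam" using b'(1) d by (simp add: left_box)
    have "base_label lam (i', d) \<in> {1..n}"
      using bij_betwE[OF base_label_bij[of lam]] box n_sum by auto
    then have "inv_into UNIV w (base_label lam (i', d)) \<in> {1..n}"
      using permutes_in_image[OF permutes_inv[OF w]] by simp
    then obtain l' where l': "Suc l' = inv_into UNIV w (base_label lam (i', d))" "l' < n"
      by (metis Suc_le_eq atLeastAtMost_iff not0_implies_Suc not_one_le_zero)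
    then have "w (Suc l') = base_label lam (i', d)" using permutes_inverses(1)[OF w] by simp
    then have "nbr n lam w l' r'"
      using l' nb(2) box b' d unfolding nbr_def left_of_def by metis
    then show ?thesis by blast
  qed
qed

lemma R_filling_eq_iff:
  assumes "b \<in> boxes lam"
  shows "R_filling lam w b = k \<longleftrightarrow> base_label lam b = w k"
  using assms permutes_inverses[OF w] by (auto simp: R_filling_def)

lemma R_filling_ex:
  assumes "b \<in> boxes lam"
  obtains l where "l < n" "R_filling lam w b = Suc l" "base_label lam b = w (Suc l)"
proof -
  have "base_label lam b \<in> {1..n}"
    using bij_betwE[OF base_label_bij[of lam]] assms n_sum by auto
  then have "inv_into UNIV w (base_label lam b) \<in> {1..n}"
    using permutes_in_image[OF permutes_inv[OF w]] by simp
  then have "R_filling lam w b \<in> {1..n}" using assms by (simp add: R_filling_def)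
  then obtain l where "R_filling lam w b = Suc l" "l < n"
    by (metis Suc_le_eq atLeastAtMost_iff not0_implies_Suc not_one_le_zero)
  then show thesis using that R_filling_eq_iff[OF assms] by blast
qed

lemma h_strict_iff:
  "h_strict h lam (R_filling lam w) \<longleftrightarrow> (\<forall>l r. nbr n lam w l r \<longrightarrow> l < h (Suc r))"
proof
  assume *: "h_strict h lam (R_filling lam w)"
  show "\<forall>l r. nbr n lam w l r \<longrightarrow> l < h (Suc r)"
  proof (intro allI impI)
    fix l r assume lr: "nbr n lam w l r"
    obtain i c where b: "(i, c) \<in> boxes lam" "(i, Suc c) \<in> boxes lam"
      "w (Suc l) = base_label lam (i, c)" "w (Suc r) = base_label lam (i, Suc c)"
      using nbrE[OF lr] by metis
    then have "R_filling lam w (i, c) = Suc l" "R_filling lam w (i, Suc c) = Suc r"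
      by (simp_all add: R_filling_eq_iff)
    moreover have "R_filling lam w (i, c) \<le> h (R_filling lam w (i, Suc c))"
      using * b(1,2) unfolding h_strict_def by blast
    ultimately show "l < h (Suc r)" by simp
  qed
next
  assume *: "\<forall>l r. nbr n lam w l r \<longrightarrow> l < h (Suc r)"
  show "h_strict h lam (R_filling lam w)" unfolding h_strict_def
  proof safe
    fix i c assume b: "(i, c) \<in> boxes lam" "(i, Suc c) \<in> boxes lam"
    obtain l where l: "l < n" "R_filling lam w (i, c) = Suc l" "base_label lam (i, c) = w (Suc l)"
      using R_filling_ex[OF b(1)] .
    obtain r where r: "r < n" "R_filling lam w (i, Suc c) = Suc r" "base_label lam (i, Suc c) = w (Suc r)"
      using R_filling_ex[OF b(2)] .
    have "nbr n lam w l r" unfolding nbr_def left_of_def using b l r by metis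
    then show "R_filling lam w (i, c) \<le> h (R_filling lam w (i, Suc c))" using * l r by (simp add: Suc_le_eq)
  qed
qed

text \<open>Base labels are ordered like boxes in reading order, which turns the position condition
  into \<open>pos w k < pos w l\<close>. Each label has exactly one box, so the condition on the box
  to the right can be put in terms of \<open>nbr\<close>. As labels are shifted but values of
  \<open>h\<close> are not, \<open>Suc k \<le> h (Suc r)\<close> appears as
  \<open>k < h (Suc r)\<close>.\<close>

lemma hess_inv_Suc_iff:
  "(Suc k, Suc l) \<in> hess_inv lam h w \<longleftrightarrow>
     l < k \<and> k < n \<and> pos w k < pos w l \<and> (\<forall>r. nbr n lam w l r \<longrightarrow> k < h (Suc r))"
proof
  assume "(Suc k, Suc l) \<in> hess_inv lam h w"
  then obtain i c i' c' where *: "l < k" "(i, c) \<in> boxes lam" "(i', c') \<in> boxes lam"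
    "R_filling lam w (i, c) = Suc k" "R_filling lam w (i', c') = Suc l"
    "box_less (i, c) (i', c')"
    "(i', Suc c') \<in> boxes lam \<Longrightarrow> Suc k \<le> h (R_filling lam w (i', Suc c'))"
    unfolding hess_inv_def box_less_def by auto
  have kn: "k < n" using R_filling_ex[OF *(2)] *(4) by (metis Suc_inject)
  have lab: "base_label lam (i, c) = w (Suc k)" "base_label lam (i', c') = w (Suc l)"
    using *(2-5) R_filling_eq_iff by auto
  have "k < h (Suc r)" if r: "nbr n lam w l r" for r
  proof -
    obtain i2 c2 where b: "(i2, c2) \<in> boxes lam" "(i2, Suc c2) \<in> boxes lam"
      "w (Suc l) = base_label lam (i2, c2)" "w (Suc r) = base_label lam (i2, Suc c2)"
      using nbrE[OF r] by metis
    then have eq: "(i2, c2) = (i', c')" using label_eq[OF b(1) *(3)] lab by simp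
    have "R_filling lam w (i2, Suc c2) = Suc r" using R_filling_eq_iff[OF b(2)] b(4) by simp
    then show ?thesis using b(2) *(7) eq by simp
  qed
  then show "l < k \<and> k < n \<and> pos w k < pos w l \<and> (\<forall>r. nbr n lam w l r \<longrightarrow> k < h (Suc r))"
    using *(1,6) kn base_label_less_iff[OF *(2,3)] lab by (simp add: pos_less_iff)
next
  assume *: "l < k \<and> k < n \<and> pos w k < pos w l \<and> (\<forall>r. nbr n lam w l r \<longrightarrow> k < h (Suc r))"
  then have kl: "k < n" "l < n" by auto
  obtain i c where b: "(i, c) \<in> boxes lam" "base_label lam (i, c) = w (Suc k)" using label_ex[OF kl(1)] .
  obtain i' c' where b': "(i', c') \<in> boxes lam" "base_label lam (i', c') = w (Suc l)" using label_ex[OF kl(2)] .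
  have less: "box_less (i, c) (i', c')"
    using * base_label_less_iff[OF b(1) b'(1)] b b' kl by (simp add: pos_less_iff)
  have right: "Suc k \<le> h (R_filling lam w (i', Suc c'))" if box: "(i', Suc c') \<in> boxes lam"
  proof -
    obtain r where r: "r < n" "R_filling lam w (i', Suc c') = Suc r" "base_label lam (i', Suc c') = w (Suc r)"
      using R_filling_ex[OF box] .
    then have "nbr n lam w l r" unfolding nbr_def left_of_def using b' box kl by metis
    then show ?thesis using * r by (simp add: Suc_le_eq)
  qed
  have fill: "R_filling lam w (i, c) = Suc k" "R_filling lam w (i', c') = Suc l"
    using b b' R_filling_eq_iff by auto
  have "\<exists>r c r' c'. (r, c) \<in> boxes lam \<and> (r', c') \<in> boxes lam \<and>
        R_filling lam w (r, c) = Suc k \<and> R_filling lam w (r', c') = Suc l \<and>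
        ((c = c' \<and> r > r') \<or> c < c') \<and>
        ((r', Suc c') \<in> boxes lam \<longrightarrow> Suc k \<le> h (R_filling lam w (r', Suc c')))"
    by (rule exI[of _ i], rule exI[of _ c], rule exI[of _ i'], rule exI[of _ c'])
      (use b(1) b'(1) fill less right in \<open>auto simp: box_less_def\<close>)
  moreover have "Suc l < Suc k" using * by simp
  ultimately show "(Suc k, Suc l) \<in> hess_inv lam h w" unfolding hess_inv_def by blast
qed

lemma hess_inv_pos:
  assumes "(k, l) \<in> hess_inv lam h w"
  obtains k' l' where "k = Suc k'" "l = Suc l'"
proof -
  obtain b b' where b: "b \<in> boxes lam" "b' \<in> boxes lam" "R_filling lam w b = k" "R_filling lam w b' = l"
    using assms unfolding hess_inv_def by blast
  obtain k' where "R_filling lam w b = Suc k'" using R_filling_ex[OF b(1)] by metis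
  moreover obtain l' where "R_filling lam w b' = Suc l'" using R_filling_ex[OF b(2)] by metis
  ultimately show thesis using that b by simp
qed

lemma springer_inv_Suc_iff: "(Suc k, Suc l) \<in> springer_inv lam w \<longleftrightarrow> inversion k l"
  unfolding springer_inv_def hess_inv_Suc_iff inversion_def by (simp add: springer_fun_def)

text \<open>\<open>P\<close> sends the unit vector of a label to that of its box, so the shift of
  boxes corresponds to the shift of labels.\<close>

lemma X_P: "X_mat n lam * P = P * Y"
proof (rule eq_matI)
  fix i j assume "i < dim_row (P * Y)" "j < dim_col (P * Y)"
  then have ij: "i < n" "j < n" by (simp_all add: perm_mat_def)
  then obtain a where a: "a < n" "i = pos w a"
    using pos_bij[OF w] by (metis (no_types, lifting) bij_betw_def image_iff lessThan_iff)
  have "(X_mat n lam * P) $$ (i, j) = of_bool (left_of lam (Suc i) (Suc (pos w j)))"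
    using mult_perm_mat_index[OF w X_mat_carrier ij] X_mat_index[OF ij(1) pos_less[OF w ij(2)]] by simp
  also have "\<dots> = of_bool (nbr n lam w a j)"
    using a ij Suc_pos[OF w] by (simp add: nbr_def)
  also have "\<dots> = (P * Y) $$ (i, j)"
    unfolding a(2) perm_mat_mult_index[OF w Y_carrier(1) a(1) ij(2)] using a ij by (simp add: Y_index)
  finally show "(X_mat n lam * P) $$ (i, j) = (P * Y) $$ (i, j)" .
qed (simp_all add: perm_mat_def X_mat_def)

lemma std_basis_w:
  assumes j: "j < n"
  shows "std_basis n (w (Suc j)) = P *\<^sub>v unit_vec n j"
proof -
  have "unit_vec n (pos w j) = col P j"
  proof (rule eq_vecI)
    fix a assume "a < dim_vec (col P j)"
    then have a: "a < n" by (simp add: perm_mat_def)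
    then show "unit_vec n (pos w j) $ a = col P j $ a"
      using perm_mat_index[OF w a j] j pos_less[OF w j] carrier_matD[OF perm_mat_carrier[of n w]] by simp
  qed (simp add: perm_mat_def)
  then show ?thesis using mult_mat_unit_vec[OF perm_mat_carrier j] by (simp add: std_basis_def pos_def)
qed

lemma X_pow_std_basis:
  assumes "l < n"
  shows "(X_mat n lam ^\<^sub>m m) *\<^sub>v std_basis n (w (Suc l)) = P *\<^sub>v ((Y ^\<^sub>m m) *\<^sub>v unit_vec n l)"
proof -
  have Xm: "X_mat n lam ^\<^sub>m m \<in> carrier_mat n n" "Y ^\<^sub>m m \<in> carrier_mat n n" for m
    by (simp_all add: pow_carrier_mat)
  have "(X_mat n lam ^\<^sub>m m) * P = P * (Y ^\<^sub>m m)"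
  proof (induction m)
    case 0
    then show ?case by (simp add: left_mult_one_mat[of _ n n] right_mult_one_mat[of _ n n] X_mat_def)
  next
    case (Suc m)
    have "(X_mat n lam ^\<^sub>m Suc m) * P = X_mat n lam ^\<^sub>m m * (X_mat n lam * P)"
      using assoc_mult_mat[OF Xm(1)[of m] X_mat_carrier perm_mat_carrier] by simp
    also have "\<dots> = X_mat n lam ^\<^sub>m m * P * Y"
      unfolding X_P by (rule assoc_mult_mat[OF Xm(1) perm_mat_carrier Y_carrier(1), symmetric])
    also have "\<dots> = P * (Y ^\<^sub>m m * Y)"
      unfolding Suc by (rule assoc_mult_mat[OF perm_mat_carrier Xm(2) Y_carrier(1)])
    finally show ?case by simp
  qed
  then show ?thesis
    using assoc_mult_mat_vec[OF Xm(1) perm_mat_carrier unit_vec_carrier, of m w l]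
      assoc_mult_mat_vec[OF perm_mat_carrier Xm(2) unit_vec_carrier, of w m l] assms
    by (simp add: std_basis_w)
qed

lemma Y_pow_unit_vec_index:
  assumes "l < n" "a < n"
  shows "((Y ^\<^sub>m m) *\<^sub>v unit_vec n l) $ a = of_bool ((nbr n lam w ^^ m) a l)"
proof -
  have c: "Y ^\<^sub>m m \<in> carrier_mat n n" by (simp add: pow_carrier_mat)
  then have "((Y ^\<^sub>m m) *\<^sub>v unit_vec n l) $ a = (Y ^\<^sub>m m) $$ (a, l)"
    using assms by (simp add: mult_mat_unit_vec[OF c] carrier_matD[OF c])
  then show ?thesis using Y_pow_index assms by simp
qed

text \<open>Translates the condition in the definition of \<open>B_k(w)\<close> into chains of left
  neighbours. At most one label lies \<open>m\<close> steps to the left of \<open>l\<close>, so the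
  power of \<open>Y\<close> yields a unit vector or zero and a single coordinate decides.\<close>

lemma std_basis_eq_X_pow_iff:
  assumes "j < n" "l < n"
  shows "std_basis n (w (Suc j)) = (X_mat n lam ^\<^sub>m m) *\<^sub>v std_basis n (w (Suc l)) \<longleftrightarrow>
    (nbr n lam w ^^ m) j l"
proof -
  have c: "(Y ^\<^sub>m m) *\<^sub>v unit_vec n l \<in> carrier_vec n"
    by (rule mult_mat_vec_carrier[of _ n n]) (simp_all add: pow_carrier_mat)
  have "unit_vec n j = (Y ^\<^sub>m m) *\<^sub>v unit_vec n l \<longleftrightarrow> (nbr n lam w ^^ m) j l"
  proof
    assume "unit_vec n j = (Y ^\<^sub>m m) *\<^sub>v unit_vec n l"
    then have "((Y ^\<^sub>m m) *\<^sub>v unit_vec n l) $ j = 1" using assms by (metis index_unit_vec(2))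
    then show "(nbr n lam w ^^ m) j l" using Y_pow_unit_vec_index[OF assms(2,1)] by simp
  next
    assume jl: "(nbr n lam w ^^ m) j l"
    show "unit_vec n j = (Y ^\<^sub>m m) *\<^sub>v unit_vec n l"
    proof (rule eq_vecI)
      fix a assume "a < dim_vec ((Y ^\<^sub>m m) *\<^sub>v unit_vec n l)"
      then have a: "a < n" using c by simp
      show "unit_vec n j $ a = ((Y ^\<^sub>m m) *\<^sub>v unit_vec n l) $ a"
      proof (cases "a = j")
        case True
        then show ?thesis using Y_pow_unit_vec_index[OF assms(2) a, of m] jl a by simp
      next
        case False
        then have "\<not> (nbr n lam w ^^ m) a l" using chain_left_unique[OF jl] by blast
        then show ?thesis using Y_pow_unit_vec_index[OF assms(2) a, of m] False a assms(1) by simp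
      qed
    qed (use c in simp)
  qed
  then show ?thesis
    unfolding X_pow_std_basis[OF assms(2)] std_basis_w[OF assms(1)]
    using GL_mult_vec_cancel[OF perm_mat_GL[OF w] unit_vec_carrier c] by simp
qed

end

section \<open>The groups \<open>B_k(w)\<close> in label coordinates\<close>

locale strict_filling = filling +
  assumes strict: "nbr n lam w l r \<Longrightarrow> l < r"
begin

sublocale strict_row_labels n "pos w" "nbr n lam w"
  by unfold_locales (rule strict)

text \<open>From coordinates indexed by labels in \<open>{1..n}\<close> to labels counted from 0.\<close>

abbreviation shift :: "(nat \<times> nat \<Rightarrow> complex) \<Rightarrow> nat \<times> nat \<Rightarrow> complex" where
  "shift x \<equiv> (\<lambda>(k, l). x (Suc k, Suc l))"

text \<open>The definition prescribes \<open>g\<close> on the basis \<open>P e_j\<close>, that is,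
  the columns of \<open>g * P\<close>. By \<open>chain_inversion_unique\<close> at most one pair of
  a partner and a distance applies to each \<open>j\<close>, so the quantified requirements reduce
  to one equation per column.\<close>

lemma has_coords_iff:
  assumes k: "k < n"
  shows "has_coords n lam w (Suc k) x g \<longleftrightarrow> g \<in> carrier_mat n n \<and> g * P = P * H (shift x) k"
proof (cases "g \<in> carrier_mat n n")
  case False
  then show ?thesis by (simp add: has_coords_def)
next
  case g: True
  let ?e = "\<lambda>j. unit_vec n j :: complex vec" and ?Y = "\<lambda>m. (Y ^\<^sub>m m) *\<^sub>v unit_vec n k"
  have Yc: "?Y m \<in> carrier_vec n" for m by (rule mult_mat_vec_carrier[of _ n n]) (simp_all add: pow_carrier_mat)
  have PHc: "P * H (shift x) k \<in> carrier_mat n n" by (rule mult_carrier_mat[OF perm_mat_carrier H_carrier(1)])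
  have gPc: "g * P \<in> carrier_mat n n" by (rule mult_carrier_mat[OF g perm_mat_carrier])
  have gP: "g *\<^sub>v (P *\<^sub>v ?e j) = col (g * P) j" if "j < n" for j
    using assoc_mult_mat_vec[OF g perm_mat_carrier unit_vec_carrier] mult_mat_unit_vec[OF gPc that] by simp
  have PH: "col (P * H (shift x) k) j = P *\<^sub>v ?e j + P *\<^sub>v (N (shift x) k *\<^sub>v ?e j)" if "j < n" for j
  proof -
    have Nc: "N (shift x) k *\<^sub>v ?e j \<in> carrier_vec n" by (rule mult_mat_vec_carrier[OF N_carrier(1)]) simp
    have "col (P * H (shift x) k) j = P *\<^sub>v (H (shift x) k *\<^sub>v ?e j)"
      using assoc_mult_mat_vec[OF perm_mat_carrier H_carrier(1) unit_vec_carrier] mult_mat_unit_vec[OF PHc that] by simp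
    also have "H (shift x) k *\<^sub>v ?e j = ?e j + N (shift x) k *\<^sub>v ?e j" by (rule H_vec) simp
    finally show ?thesis using mult_add_distrib_mat_vec[OF perm_mat_carrier unit_vec_carrier Nc] by simp
  qed
  have N1: "N (shift x) k *\<^sub>v ?e j = x (Suc k, Suc l) \<cdot>\<^sub>v ?Y m"
    if "inversion k l" "(nbr n lam w ^^ m) j l" "j < n" for j l m
  proof (rule eq_vecI)
    fix a assume "a < dim_vec (x (Suc k, Suc l) \<cdot>\<^sub>v ?Y m)"
    then have a: "a < n" using Yc[of m] by simp
    show "(N (shift x) k *\<^sub>v ?e j) $ a = (x (Suc k, Suc l) \<cdot>\<^sub>v ?Y m) $ a"
      using N_index[OF that(1,2) a, of "shift x"] Y_pow_unit_vec_index[OF k a, of m] a that(3) Yc[of m]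
      by (simp add: mult_mat_unit_vec[OF N_carrier(1)])
  qed (use Yc[of m] in simp)
  have N0: "N (shift x) k *\<^sub>v ?e j = 0\<^sub>v n"
    if "\<nexists>l m. inversion k l \<and> (nbr n lam w ^^ m) j l" "j < n" for j
    using N_index_0[OF that(1) _ that(2)] that(2)
    by (intro eq_vecI) (simp_all add: mult_mat_unit_vec[OF N_carrier(1)])
  have cond: "((Suc k, l) \<in> springer_inv lam w \<and>
      std_basis n (w (Suc j)) = (X_mat n lam ^\<^sub>m m) *\<^sub>v std_basis n (w l)) \<longleftrightarrow>
      (\<exists>l'. l = Suc l' \<and> inversion k l' \<and> (nbr n lam w ^^ m) j l')" if "j < n" for j l m
  proof
    assume *: "(Suc k, l) \<in> springer_inv lam w \<and>
      std_basis n (w (Suc j)) = (X_mat n lam ^\<^sub>m m) *\<^sub>v std_basis n (w l)"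
    then obtain l' where l': "l = Suc l'" using hess_inv_pos unfolding springer_inv_def by blast
    then have "inversion k l'" using * springer_inv_Suc_iff by simp
    then show "\<exists>l'. l = Suc l' \<and> inversion k l' \<and> (nbr n lam w ^^ m) j l'"
      using * l' std_basis_eq_X_pow_iff[OF that inversionD(3)] by auto
  next
    assume "\<exists>l'. l = Suc l' \<and> inversion k l' \<and> (nbr n lam w ^^ m) j l'"
    then show "(Suc k, l) \<in> springer_inv lam w \<and>
      std_basis n (w (Suc j)) = (X_mat n lam ^\<^sub>m m) *\<^sub>v std_basis n (w l)"
      using std_basis_eq_X_pow_iff[OF that inversionD(3)] springer_inv_Suc_iff by auto
  qed
  have "has_coords n lam w (Suc k) x g \<longleftrightarrow> (\<forall>j<n.
      (\<forall>m l. inversion k l \<and> (nbr n lam w ^^ m) j l \<longrightarrow>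
         g *\<^sub>v (P *\<^sub>v ?e j) = P *\<^sub>v ?e j + x (Suc k, Suc l) \<cdot>\<^sub>v (P *\<^sub>v ?Y m)) \<and>
      ((\<nexists>m l. inversion k l \<and> (nbr n lam w ^^ m) j l) \<longrightarrow> g *\<^sub>v (P *\<^sub>v ?e j) = P *\<^sub>v ?e j))"
  proof -
    have all: "(\<forall>j \<in> {1..n}. Q j) \<longleftrightarrow> (\<forall>j<n. Q (Suc j))" for Q
    proof safe
      fix j assume "\<forall>j<n. Q (Suc j)" "j \<in> {1..n}"
      then show "Q j" by (cases j) auto
    qed auto
    have "has_coords n lam w (Suc k) x g \<longleftrightarrow> (\<forall>j<n.
      (\<forall>m l. (Suc k, l) \<in> springer_inv lam w \<and>
           std_basis n (w (Suc j)) = (X_mat n lam ^\<^sub>m m) *\<^sub>v std_basis n (w l) \<longrightarrow>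
         g *\<^sub>v std_basis n (w (Suc j)) = std_basis n (w (Suc j)) + x (Suc k, l) \<cdot>\<^sub>v
           ((X_mat n lam ^\<^sub>m m) *\<^sub>v std_basis n (w (Suc k)))) \<and>
      ((\<nexists>m l. (Suc k, l) \<in> springer_inv lam w \<and>
           std_basis n (w (Suc j)) = (X_mat n lam ^\<^sub>m m) *\<^sub>v std_basis n (w l)) \<longrightarrow>
         g *\<^sub>v std_basis n (w (Suc j)) = std_basis n (w (Suc j))))"
      unfolding has_coords_def all using g by simp
    also have "\<dots> \<longleftrightarrow> (\<forall>j<n.
      (\<forall>m l. (\<exists>l'. l = Suc l' \<and> inversion k l' \<and> (nbr n lam w ^^ m) j l') \<longrightarrow>
         g *\<^sub>v (P *\<^sub>v ?e j) = P *\<^sub>v ?e j + x (Suc k, l) \<cdot>\<^sub>v (P *\<^sub>v ?Y m)) \<and>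
      ((\<nexists>m l. \<exists>l'. l = Suc l' \<and> inversion k l' \<and> (nbr n lam w ^^ m) j l') \<longrightarrow>
         g *\<^sub>v (P *\<^sub>v ?e j) = P *\<^sub>v ?e j))"
      by (intro all_cong) (simp only: cond, simp only: std_basis_w X_pow_std_basis[OF k])
    also have "\<dots> \<longleftrightarrow> (\<forall>j<n.
      (\<forall>m l. inversion k l \<and> (nbr n lam w ^^ m) j l \<longrightarrow>
         g *\<^sub>v (P *\<^sub>v ?e j) = P *\<^sub>v ?e j + x (Suc k, Suc l) \<cdot>\<^sub>v (P *\<^sub>v ?Y m)) \<and>
      ((\<nexists>m l. inversion k l \<and> (nbr n lam w ^^ m) j l) \<longrightarrow> g *\<^sub>v (P *\<^sub>v ?e j) = P *\<^sub>v ?e j))"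
      by (intro all_cong) blast
    finally show ?thesis .
  qed
  also have "\<dots> \<longleftrightarrow> (\<forall>j<n. col (g * P) j = col (P * H (shift x) k) j)"
  proof (intro all_cong)
    fix j assume j: "j < n"
    show "((\<forall>m l. inversion k l \<and> (nbr n lam w ^^ m) j l \<longrightarrow>
         g *\<^sub>v (P *\<^sub>v ?e j) = P *\<^sub>v ?e j + x (Suc k, Suc l) \<cdot>\<^sub>v (P *\<^sub>v ?Y m)) \<and>
      ((\<nexists>m l. inversion k l \<and> (nbr n lam w ^^ m) j l) \<longrightarrow> g *\<^sub>v (P *\<^sub>v ?e j) = P *\<^sub>v ?e j)) \<longleftrightarrow>
      col (g * P) j = col (P * H (shift x) k) j"
    proof (cases "\<exists>m l. inversion k l \<and> (nbr n lam w ^^ m) j l")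
      case True
      then obtain m l where ml: "inversion k l" "(nbr n lam w ^^ m) j l" by blast
      have "(inversion k l' \<and> (nbr n lam w ^^ m') j l') \<longleftrightarrow> l' = l \<and> m' = m" for l' m'
        using chain_inversion_unique[OF ml, of l' m'] ml by blast
      moreover have "col (P * H (shift x) k) j = P *\<^sub>v ?e j + x (Suc k, Suc l) \<cdot>\<^sub>v (P *\<^sub>v ?Y m)"
        unfolding PH[OF j] N1[OF ml j] using mult_mat_vec[OF perm_mat_carrier Yc] by simp
      ultimately show ?thesis using True gP[OF j] by simp
    next
      case False
      have "P *\<^sub>v ?e j \<in> carrier_vec n" by (rule mult_mat_vec_carrier[OF perm_mat_carrier]) simp
      moreover have "P *\<^sub>v 0\<^sub>v n = 0\<^sub>v n" by (rule mult_mat_zero_vec[OF perm_mat_carrier])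
      moreover have "N (shift x) k *\<^sub>v ?e j = 0\<^sub>v n" using False by (intro N0[OF _ j]) blast
      ultimately have "col (P * H (shift x) k) j = P *\<^sub>v ?e j" using PH[OF j] by simp
      then show ?thesis unfolding gP[OF j] using False by auto
    qed
  qed
  also have "\<dots> \<longleftrightarrow> g * P = P * H (shift x) k"
  proof
    assume "\<forall>j<n. col (g * P) j = col (P * H (shift x) k) j"
    then show "g * P = P * H (shift x) k"
      using carrier_matD[OF gPc] carrier_matD[OF PHc] by (intro mat_col_eqI) (simp_all only:)
  qed simp
  finally show ?thesis using g by simp
qed

lemma gprod_eq:
  assumes "\<And>k. k \<in> {2..n} \<Longrightarrow> has_coords n lam w k x (g k)"
  shows "gprod n w g = P * prd (shift x) 0 n"
proof -
  let ?x = "shift x"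
  have "fold (\<lambda>k A. g k * A) [2..<Suc m] P = P * prd ?x 1 m" if "1 \<le> m" "m \<le> n" for m
    using that
  proof (induction m rule: dec_induct)
    case base
    then show ?case by (simp add: right_mult_one_mat[of _ n n] perm_mat_def)
  next
    case (step m)
    have "has_coords n lam w (Suc m) x (g (Suc m))" using step by (intro assms) auto
    then have gm: "g (Suc m) \<in> carrier_mat n n" "g (Suc m) * P = P * H ?x m"
      using has_coords_iff[of m x "g (Suc m)"] step by auto
    have "[2..<Suc (Suc m)] = [2..<Suc m] @ [Suc m]" using step by simp
    then have "fold (\<lambda>k A. g k * A) [2..<Suc (Suc m)] P = g (Suc m) * (P * prd ?x 1 m)"
      using step by simp
    also have "\<dots> = g (Suc m) * P * prd ?x 1 m"
      by (rule assoc_mult_mat[OF gm(1) perm_mat_carrier prd_carrier(1), symmetric])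
    also have "\<dots> = P * (H ?x m * prd ?x 1 m)"
      unfolding gm(2) by (rule assoc_mult_mat[OF perm_mat_carrier H_carrier(1) prd_carrier(1)])
    also have "H ?x m * prd ?x 1 m = prd ?x 1 (Suc m)" using step by simp
    finally show ?case .
  qed
  then have "gprod n w g = P * prd ?x 1 n" using n_pos by (simp add: gprod_def)
  \<comment> \<open>The product begins with \<open>g 2\<close>, which corresponds to
    \<open>H 1\<close>. The factor \<open>H 0\<close> is the identity because the smallest label is
    never the first entry of an inversion.\<close>
  moreover have "prd ?x 0 1 = 1\<^sub>m n"
  proof (rule eq_matI)
    fix a b assume "a < dim_row (1\<^sub>m n :: complex mat)" "b < dim_col (1\<^sub>m n :: complex mat)"
    then show "prd ?x 0 1 $$ (a, b) = (1\<^sub>m n :: complex mat) $$ (a, b)"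
      using N_nonzero[of ?x 0 a b] right_mult_one_mat[OF H_carrier(1)[of ?x 0]]
      by (auto simp: H_def)
  qed (simp_all add: H_def)
  then have "prd ?x 0 n = prd ?x 1 n"
    using prd_split[of 0 1 n ?x] n_pos right_mult_one_mat[OF prd_carrier(1)] by simp
  ultimately show ?thesis by simp
qed

text \<open>\<open>P\<close> is invertible, so the equation for \<open>g * P\<close> determines
  \<open>g\<close>. This gives the definite description in \<open>phi_map\<close> its
  meaning.\<close>

lemma has_coords_ex1: "k \<in> {2..n} \<Longrightarrow> \<exists>!g. has_coords n lam w k x g"
proof -
  assume k: "k \<in> {2..n}"
  then obtain j where j: "k = Suc j" "j < n" by (cases k) auto
  let ?Q = "transpose_mat P"
  have Q: "?Q \<in> carrier_mat n n" by (simp add: transpose_carrier_mat)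
  let ?g = "P * H (shift x) j * ?Q"
  have PH: "P * H (shift x) j \<in> carrier_mat n n" by (rule mult_carrier_mat[OF perm_mat_carrier H_carrier(1)])
  show ?thesis unfolding j(1) has_coords_iff[OF j(2)]
  proof (intro ex1I conjI)
    show "?g \<in> carrier_mat n n" by (rule mult_carrier_mat[OF PH Q])
    show "?g * P = P * H (shift x) j"
      unfolding assoc_mult_mat[OF PH Q perm_mat_carrier] transpose_perm_mat(1)[OF w]
      by (rule right_mult_one_mat[OF PH])
    fix g assume g: "g \<in> carrier_mat n n \<and> g * P = P * H (shift x) j"
    have "g = g * (P * ?Q)" unfolding transpose_perm_mat(2)[OF w] using g right_mult_one_mat[of g n n] by simp
    also have "\<dots> = g * P * ?Q" by (rule assoc_mult_mat[OF conjunct1[OF g] perm_mat_carrier Q, symmetric])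
    finally show "g = ?g" using g by simp
  qed
qed

lemma phi_map_eq: "phi_map n lam w x = flag_of n (P * prd (shift x) 0 n)"
  unfolding phi_map_def by (subst gprod_eq[of x]) (use theI'[OF has_coords_ex1] in auto)

end

section \<open>Schubert cells and Hessenberg varieties in label coordinates\<close>

context filling
begin

lemma Hess_label_iff:
  assumes A: "A \<in> GL n" and B: "B \<in> carrier_mat n n" "A * B = 1\<^sub>m n" "B * A = 1\<^sub>m n"
    and h: "hessenberg_fun n h"
  shows "flag_of n (P * A) \<in> Hess n (X_mat n lam) h \<longleftrightarrow>
    (\<forall>a<n. \<forall>b<n. h (Suc b) \<le> a \<longrightarrow> (B * Y * A) $$ (a, b) = 0)"
proof -
  let ?Q = "transpose_mat P"
  have Q: "?Q \<in> carrier_mat n n" by (simp add: transpose_carrier_mat)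
  note Ac = GL_carrier[OF A]
  note BQ = mult_carrier_mat[OF B(1) Q] and PA = mult_carrier_mat[OF perm_mat_carrier Ac]
  have "(P * A) * (B * ?Q) = P * (A * B) * ?Q" by (rule mat_assoc4[OF perm_mat_carrier Ac B(1) Q])
  then have 1: "(P * A) * (B * ?Q) = 1\<^sub>m n"
    unfolding B(2) using right_mult_one_mat[OF perm_mat_carrier[of n w]] transpose_perm_mat(2)[OF w] by simp
  have 2: "(B * ?Q) * (P * A) = 1\<^sub>m n" by (rule mat_mult_left_right_inverse[OF PA BQ 1])
  have "?Q * X_mat n lam * P = ?Q * (P * Y)"
    unfolding X_P[symmetric] by (rule assoc_mult_mat[OF Q X_mat_carrier perm_mat_carrier])
  also have "\<dots> = ?Q * P * Y" by (rule assoc_mult_mat[OF Q perm_mat_carrier Y_carrier(1), symmetric])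
  also have "\<dots> = Y" unfolding transpose_perm_mat(1)[OF w] by (rule left_mult_one_mat[OF Y_carrier(1)])
  finally have QXP: "?Q * X_mat n lam * P = Y" .
  have "B * ?Q * X_mat n lam * (P * A) = B * (?Q * X_mat n lam) * (P * A)"
    unfolding assoc_mult_mat[OF B(1) Q X_mat_carrier] ..
  also have "\<dots> = B * (?Q * X_mat n lam * P) * A"
    unfolding assoc_mult_mat[OF mult_carrier_mat[OF B(1) mult_carrier_mat[OF Q X_mat_carrier]] perm_mat_carrier Ac, symmetric]
      assoc_mult_mat[OF B(1) mult_carrier_mat[OF Q X_mat_carrier] perm_mat_carrier] ..
  finally have eq: "B * ?Q * X_mat n lam * (P * A) = B * Y * A" unfolding QXP .
  have "P * A \<in> GL n" using perm_mat_GL[OF w] A by (rule GL_mult)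
  then show ?thesis using Hess_flag_of_iff[OF _ BQ 1 2 X_mat_carrier h] eq by simp
qed

text \<open>With \<open>A = P\<inverse> b P\<close> the representative \<open>b * P\<close> becomes
  \<open>P * A\<close>, and conjugation turns the upper triangular \<open>b\<close> into a matrix
  triangular in the order \<open>pos w\<close>.\<close>

lemma schubert_label_form:
  assumes "V \<in> schubert_cell n w"
  obtains A B where "A \<in> GL n" "tri n (pos w) A" "\<And>a. a < n \<Longrightarrow> A $$ (a, a) \<noteq> 0"
    "B \<in> carrier_mat n n" "A * B = 1\<^sub>m n" "B * A = 1\<^sub>m n" "V = flag_of n (P * A)"
proof -
  obtain b where b: "b \<in> Borel n" "V = flag_of n (b * P)"
    using assms by (auto simp: schubert_cell_def)
  let ?Q = "transpose_mat P"
  have Q: "?Q \<in> carrier_mat n n" by (simp add: transpose_carrier_mat)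
  have bGL: "b \<in> GL n" and btri: "tri n (\<lambda>a. a) b" using b by (auto simp: Borel_iff)
  note bc = GL_carrier[OF bGL]
  note bP = mult_carrier_mat[OF bc perm_mat_carrier[of n w]]
  let ?A = "?Q * (b * P)"
  have PA: "P * ?A = b * P"
    unfolding assoc_mult_mat[OF perm_mat_carrier Q bP, symmetric] transpose_perm_mat(2)[OF w]
    by (rule left_mult_one_mat[OF bP])
  have Ac: "?A \<in> carrier_mat n n" by (rule mult_carrier_mat[OF Q bP])
  have idx: "?A $$ (a, c) = b $$ (pos w a, pos w c)" if "a < n" "c < n" for a c
    using perm_mat_mult_index[OF w Ac that] mult_perm_mat_index[OF w bc pos_less[OF w that(1)] that(2)]
    unfolding PA by simp
  have "det P * det ?A = det b * det P"
    using det_mult[OF perm_mat_carrier Ac] det_mult[OF bc perm_mat_carrier] PA by metis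
  then have A: "?A \<in> GL n" using Ac bGL perm_mat_GL[OF w] by (auto simp: GL_iff_det)
  obtain B where B: "B \<in> GL n" "?A * B = 1\<^sub>m n" "B * ?A = 1\<^sub>m n" using GL_inverse[OF A] by metis
  have "tri n (pos w) ?A"
    using Ac idx triD[OF btri pos_less[OF w] pos_less[OF w]] unfolding tri_def by simp
  moreover have "?A $$ (a, a) \<noteq> 0" if "a < n" for a
    using idx[OF that that] GL_tri_diag[OF bGL btri pos_less[OF w that]] by simp
  ultimately show thesis using that[OF A _ _ GL_carrier[OF B(1)] B(2,3)] b(2) PA by simp
qed

lemma flag_in_schubert:
  assumes "A \<in> GL n" "tri n (pos w) A"
  shows "flag_of n (P * A) \<in> schubert_cell n w"
proof -
  let ?Q = "transpose_mat P"
  have Q: "?Q \<in> carrier_mat n n" by (simp add: transpose_carrier_mat)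
  note Ac = GL_carrier[OF assms(1)]
  note PA = mult_carrier_mat[OF perm_mat_carrier[of n w] Ac]
  let ?b = "P * A * ?Q"
  have bc: "?b \<in> carrier_mat n n" by (rule mult_carrier_mat[OF PA Q])
  have bP: "?b * P = P * A"
    unfolding assoc_mult_mat[OF PA Q perm_mat_carrier] transpose_perm_mat(1)[OF w]
    by (rule right_mult_one_mat[OF PA])
  have "det ?b * det P = det P * det A"
    using det_mult[OF bc perm_mat_carrier[of n w]] det_mult[OF perm_mat_carrier[of n w] Ac] bP by metis
  then have b: "?b \<in> GL n" using bc assms(1) perm_mat_GL[OF w] by (auto simp: GL_iff_det)
  have "tri n (\<lambda>a. a) ?b" unfolding tri_def
  proof (intro conjI allI impI bc)
    fix i j assume ij: "i < n" "j < n" "j < i"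
    obtain a c where ac: "a < n" "i = pos w a" "c < n" "j = pos w c"
      using pos_bij[OF w] ij(1,2) by (metis (no_types, lifting) bij_betw_def image_iff lessThan_iff)
    have "?b $$ (i, j) = (?b * P) $$ (i, c)"
      using mult_perm_mat_index[OF w bc ij(1) ac(3)] ac(4) by simp
    also have "\<dots> = A $$ (a, c)"
      unfolding bP ac(2) by (rule perm_mat_mult_index[OF w Ac ac(1,3)])
    also have "\<dots> = 0" using triD[OF assms(2) ac(1,3)] ac ij(3) by simp
    finally show "?b $$ (i, j) = 0" .
  qed
  then have "?b \<in> Borel n" using b by (simp add: Borel_iff)
  then show ?thesis unfolding schubert_cell_def using bP by force
qed

text \<open>One point of the Hessenberg variety in the cell already forces the filling to be
  \<open>h\<close>-strict, so every nonempty intersection falls under the parametrization.\<close>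

lemma schubert_Hess_strict:
  assumes h: "hessenberg_fun n h" and V: "V \<in> schubert_cell n w" "V \<in> Hess n (X_mat n lam) h"
    and nbr: "nbr n lam w l r"
  shows "l < h (Suc r)"
proof -
  obtain A B where A: "A \<in> GL n" "tri n (pos w) A" "\<And>a. a < n \<Longrightarrow> A $$ (a, a) \<noteq> 0"
    and B: "B \<in> carrier_mat n n" "A * B = 1\<^sub>m n" "B * A = 1\<^sub>m n" and eq: "V = flag_of n (P * A)"
    using schubert_label_form[OF V(1)] by blast
  have "\<forall>a<n. \<forall>b<n. h (Suc b) \<le> a \<longrightarrow> (B * Y * A) $$ (a, b) = 0"
    using V(2) Hess_label_iff[OF A(1) B h] eq by simp
  then show ?thesis
    using left_neighbour_less[OF A(2,3) B(1,2) nbr, of "h (Suc r)"] E_less(2)[OF nbr] by blast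
qed

end

section \<open>The parametrization of a Hessenberg cell\<close>

locale hess_filling = filling +
  fixes h :: "nat \<Rightarrow> nat"
  assumes h: "hessenberg_fun n h" and h_strict: "nbr n lam w l r \<Longrightarrow> l < h (Suc r)"
begin

lemma h_le: "r < n \<Longrightarrow> h (Suc r) \<le> r"
  using h bspec[of "{1..n}" "\<lambda>i. h i < i" "Suc r"] by (simp add: hessenberg_fun_def less_Suc_eq_le)

sublocale strict_filling
proof
  fix l r assume "nbr n lam w l r"
  then show "l < r" using h_strict[of l r] h_le[of r] E_less(2)[of l r] by simp
qed

lemma hess_inv_subset: "hess_inv lam h w \<subseteq> springer_inv lam w"
proof safe
  fix k l assume *: "(k, l) \<in> hess_inv lam h w"
  then obtain k' l' where kl: "k = Suc k'" "l = Suc l'" using hess_inv_pos by blast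
  have "inversion k' l'" unfolding inversion_def
    using * h_le E_less(2) unfolding kl hess_inv_Suc_iff by (meson order.strict_trans2)
  then show "(k, l) \<in> springer_inv lam w" unfolding kl springer_inv_Suc_iff .
qed

text \<open>In labels counted from 0, a Springer inversion fails to be a Hessenberg inversion
  precisely when \<open>l\<close> has a right neighbour \<open>r\<close> with
  \<open>h (Suc r) \<le> k\<close>; these are the coordinates singled out by
  \<open>hess_condition_iff\<close>.\<close>

lemma Hess_iff:
  "flag_of n (P * prd (shift x) 0 n) \<in> Hess n (X_mat n lam) h \<longleftrightarrow>
    (\<forall>(k, l) \<in> springer_inv lam w - hess_inv lam h w. x (k, l) = 0)"
proof -
  have "flag_of n (P * prd (shift x) 0 n) \<in> Hess n (X_mat n lam) h \<longleftrightarrow>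
      (\<forall>k l. inversion k l \<and> (\<exists>r. nbr n lam w l r \<and> h (Suc r) \<le> k) \<longrightarrow> shift x (k, l) = 0)"
    unfolding Hess_label_iff[OF prd_GL prd_carrier(2) prd_inverse h]
    by (rule hess_condition_iff) (use h_strict h_le in auto)
  also have "\<dots> \<longleftrightarrow> (\<forall>k l. (Suc k, Suc l) \<in> springer_inv lam w \<and> (Suc k, Suc l) \<notin> hess_inv lam h w
      \<longrightarrow> x (Suc k, Suc l) = 0)"
    unfolding springer_inv_Suc_iff hess_inv_Suc_iff using inversionD(1,2,4) by (fastforce simp: not_less)
  also have "\<dots> \<longleftrightarrow> (\<forall>(k, l) \<in> springer_inv lam w - hess_inv lam h w. x (k, l) = 0)"
  proof
    assume *: "\<forall>k l. (Suc k, Suc l) \<in> springer_inv lam w \<and> (Suc k, Suc l) \<notin> hess_inv lam h w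
      \<longrightarrow> x (Suc k, Suc l) = 0"
    show "\<forall>(k, l) \<in> springer_inv lam w - hess_inv lam h w. x (k, l) = 0"
    proof safe
      fix k l assume kl: "(k, l) \<in> springer_inv lam w" "(k, l) \<notin> hess_inv lam h w"
      obtain k' l' where "k = Suc k'" "l = Suc l'"
        using hess_inv_pos kl(1) unfolding springer_inv_def by blast
      then show "x (k, l) = 0" using * kl by blast
    qed
  qed blast
  finally show ?thesis .
qed

lemma phi_map_mem:
  assumes "x \<in> affine_pts (hess_inv lam h w)"
  shows "phi_map n lam w x \<in> schubert_cell n w \<inter> Hess n (X_mat n lam) h"
proof
  show "phi_map n lam w x \<in> schubert_cell n w"
    unfolding phi_map_eq by (rule flag_in_schubert[OF prd_GL prd_tri(1)])
  show "phi_map n lam w x \<in> Hess n (X_mat n lam) h"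
    unfolding phi_map_eq Hess_iff using assms by (auto simp: affine_pts_def)
qed

text \<open>Since \<open>h (Suc r) \<le> r\<close>, the flag lies in the Springer fiber and
  \<open>factorization\<close> applies. The remaining upper triangular factor does not change the
  flag, and \<open>Hess_iff\<close> makes the surplus coordinates vanish.\<close>

lemma phi_map_surj:
  assumes V: "V \<in> schubert_cell n w \<inter> Hess n (X_mat n lam) h"
  obtains x where "x \<in> affine_pts (hess_inv lam h w)" "phi_map n lam w x = V"
proof -
  obtain A B where A: "A \<in> GL n" "tri n (pos w) A" "\<And>a. a < n \<Longrightarrow> A $$ (a, a) \<noteq> 0"
    and B: "B \<in> carrier_mat n n" "A * B = 1\<^sub>m n" "B * A = 1\<^sub>m n" and eq: "V = flag_of n (P * A)"
    using schubert_label_form[OF IntD1[OF V]] by blast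
  have "\<forall>a<n. \<forall>b<n. h (Suc b) \<le> a \<longrightarrow> (B * Y * A) $$ (a, b) = 0"
    using V Hess_label_iff[OF A(1) B h] eq by simp
  then have "(B * Y * A) $$ (a, b) = 0" if "a < n" "b \<le> a" for a b
    using that h_le[of b] by simp
  then obtain y where y: "\<And>k l. \<not> inversion k l \<Longrightarrow> y (k, l) = 0"
    "tri n (\<lambda>a. a) (prd_inv y 0 n * A)"
    using factorization[OF A(2,3) B] by metis
  let ?T = "prd_inv y 0 n * A"
  note Ac = GL_carrier[OF A(1)]
  have Tc: "?T \<in> carrier_mat n n" by (rule tri_carrier[OF y(2)])
  have AT: "A = prd y 0 n * ?T"
    unfolding assoc_mult_mat[OF prd_carrier(1) prd_carrier(2) Ac, symmetric] prd_inverse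
    by (rule left_mult_one_mat[OF Ac, symmetric])
  have "det A = det (prd y 0 n) * det ?T"
    using det_mult[OF prd_carrier(1) Tc] AT by metis
  then have T: "?T \<in> GL n" using A(1) Tc by (auto simp: GL_iff_det)
  \<comment> \<open>Return to labels counted from 1; the value 0 at a label 0 is what membership in
    \<open>affine_pts\<close> requires.\<close>
  define x where "x = (\<lambda>(k, l). if k > 0 \<and> l > 0 then y (k - 1, l - 1) else 0)"
  have sx: "shift x = y" by (auto simp: x_def)
  have "P * A = P * prd y 0 n * ?T"
    using assoc_mult_mat[OF perm_mat_carrier prd_carrier(1) Tc] AT by metis
  then have V': "V = flag_of n (P * prd (shift x) 0 n)"
    using flag_of_mult_tri[OF GL_mult[OF perm_mat_GL[OF w] prd_GL] T y(2)] eq sx by metis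
  have "x (k, l) = 0" if "(k, l) \<notin> hess_inv lam h w" for k l
  proof (cases "(k, l) \<in> springer_inv lam w")
    case True
    then show ?thesis using V V' that Hess_iff[of x] by auto
  next
    case False
    show ?thesis
    proof (cases "k > 0 \<and> l > 0")
      case True
      then obtain k' l' where kl: "k = Suc k'" "l = Suc l'" by (metis gr0_implies_Suc)
      then have "\<not> inversion k' l'" using False springer_inv_Suc_iff by simp
      then show ?thesis using y(1) kl by (simp add: x_def)
    qed (auto simp: x_def)
  qed
  then have "x \<in> affine_pts (hess_inv lam h w)" by (auto simp: affine_pts_def)
  then show thesis using that V' phi_map_eq by simp
qed

text \<open>A representative in lower unitriangular form has all the minors
  \<open>minor (pos w) j j\<close> equal to 1.\<close>

lemma schubert_subset_big_cell: "schubert_cell n w \<subseteq> big_cell n w"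
proof
  fix V assume "V \<in> schubert_cell n w"
  then obtain A where A: "A \<in> GL n" "tri n (pos w) A" "\<And>a. a < n \<Longrightarrow> A $$ (a, a) \<noteq> 0"
    "V = flag_of n (P * A)" using schubert_label_form by blast
  obtain T where T': "T \<in> GL n \<and> tri n (\<lambda>a. a) T \<and> tri n (pos w) (A * T) \<and>
    (\<forall>a b. a < b \<and> b < n \<longrightarrow> (A * T) $$ (a, b) = 0) \<and> (\<forall>a<n. (A * T) $$ (a, a) = 1)"
    using lower_unitriangular_form[OF p_inj A(2,3,1)] by (rule exE)
  have T: "T \<in> GL n" "tri n (\<lambda>a. a) T" "tri n (pos w) (A * T)"
    "a < b \<Longrightarrow> b < n \<Longrightarrow> (A * T) $$ (a, b) = 0" "a < n \<Longrightarrow> (A * T) $$ (a, a) = 1" for a b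
    using T' by blast+
  have GL: "P * A \<in> GL n" using perm_mat_GL[OF w] A(1) by (rule GL_mult)
  have eq: "P * A * T = P * (A * T)"
    by (rule assoc_mult_mat[OF perm_mat_carrier GL_carrier[OF A(1)] GL_carrier[OF T(1)]])
  have "minor (pos w) j j (P * (A * T)) = 1" if "j < n" for j
    using minor_lower_unitriangular[OF w tri_carrier[OF T(3)] that le_refl T(4,5)] T(5) that by simp
  moreover have "P * (A * T) \<in> GL n" unfolding eq[symmetric] by (rule GL_mult[OF GL T(1)])
  ultimately have "flag_of n (P * (A * T)) \<in> big_cell n w"
    using flag_of_big_cell_iff[OF w] by simp
  then show "V \<in> big_cell n w" using flag_of_mult_tri[OF GL T(1,2)] A(4) eq by simp
qed

text \<open>An upper triangular factor does not change the flag, so the entries on and below the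
  diagonal of the lower unitriangular form of \<open>prd x 0 n\<close> are cell coordinates of the
  flag, and \<open>coordinates_polynomial\<close> recovers the parameters from them. The matrix
  \<open>T\<close> is chosen for each \<open>x\<close> separately; only the entries of the product
  have to be controlled.\<close>

lemma coordinates_from_cell:
  assumes "inversion k l"
  obtains F where "F \<in> poly_funs (coords ({..<n} \<times> {..<n}))"
    "\<And>x. x (k, l) = F (\<lambda>(i, j). cell_coord n w i j (flag_of n (P * prd x 0 n)))"
proof -
  have "\<exists>T. T \<in> GL n \<and> tri n (\<lambda>a. a) T \<and> tri n (pos w) (prd x 0 n * T) \<and>
      (\<forall>a b. a < b \<and> b < n \<longrightarrow> (prd x 0 n * T) $$ (a, b) = 0) \<and>
      (\<forall>a<n. (prd x 0 n * T) $$ (a, a) = 1)" for x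
    by (rule lower_unitriangular_form[OF p_inj prd_tri(1) _ prd_GL]) (simp add: prd_diag(1))
  then have "\<exists>T. \<forall>x. T x \<in> GL n \<and> tri n (\<lambda>a. a) (T x) \<and> tri n (pos w) (prd x 0 n * T x) \<and>
      (\<forall>a b. a < b \<and> b < n \<longrightarrow> (prd x 0 n * T x) $$ (a, b) = 0) \<and>
      (\<forall>a<n. (prd x 0 n * T x) $$ (a, a) = 1)"
    by (intro choice allI)
  then obtain T where T': "\<forall>x. T x \<in> GL n \<and> tri n (\<lambda>a. a) (T x) \<and> tri n (pos w) (prd x 0 n * T x) \<and>
      (\<forall>a b. a < b \<and> b < n \<longrightarrow> (prd x 0 n * T x) $$ (a, b) = 0) \<and>
      (\<forall>a<n. (prd x 0 n * T x) $$ (a, a) = 1)" by (rule exE)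
  have T: "T x \<in> GL n" "tri n (\<lambda>a. a) (T x)" "tri n (pos w) (prd x 0 n * T x)"
    "a < b \<Longrightarrow> b < n \<Longrightarrow> (prd x 0 n * T x) $$ (a, b) = 0"
    "a < n \<Longrightarrow> (prd x 0 n * T x) $$ (a, a) = 1" for x a b
    using T' by blast+
  let ?m = "\<lambda>x (i, j). cell_coord n w i j (flag_of n (P * prd x 0 n))"
  have entry: "(prd x 0 n * T x) $$ (i, j) = ?m x (i, j)" if ij: "i < n" "j \<le> i" for x i j
  proof -
    have GL: "P * prd x 0 n \<in> GL n" using perm_mat_GL[OF w] prd_GL by (rule GL_mult)
    have eq: "P * prd x 0 n * T x = P * (prd x 0 n * T x)"
      by (rule assoc_mult_mat[OF perm_mat_carrier prd_carrier(1) GL_carrier[OF T(1)]])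
    have GLT: "P * (prd x 0 n * T x) \<in> GL n" unfolding eq[symmetric] by (rule GL_mult[OF GL T(1)])
    have jn: "j < n" using ij by simp
    have minor: "minor (pos w) a j (P * (prd x 0 n * T x)) = (prd x 0 n * T x) $$ (a, j)"
      if "a < n" "j \<le> a" for a
      by (rule minor_lower_unitriangular[OF w tri_carrier[OF T(3)] that]) (use T(4,5) in simp_all)
    have "?m x (i, j) = cell_coord n w i j (flag_of n (P * (prd x 0 n * T x)))"
      using flag_of_mult_tri[OF GL T(1)[of x] T(2)[of x]] unfolding eq by simp
    also have "\<dots> = (prd x 0 n * T x) $$ (i, j)"
      unfolding cell_coord_flag_of[OF w ij(1) jn GLT] minor[OF ij] minor[OF jn le_refl] T(5)[OF jn] by simp
    finally show ?thesis by simp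
  qed
  have "(\<lambda>x. (prd x 0 n * T x) $$ (i, j)) \<in> pull_poly (coords ({..<n} \<times> {..<n})) UNIV ?m"
    if ij: "i < n" "j < n" for i j
  proof (cases "j \<le> i")
    case True
    have "(\<lambda>c. c (i, j)) \<in> poly_funs (coords ({..<n} \<times> {..<n}))"
      by (rule poly_funs.gen) (use ij in auto)
    then show ?thesis by (rule pull_polyI) (use entry[OF ij(1) True] in simp)
  next
    case False
    then show ?thesis
      using T(4)[of i j] ij by (intro pull_polyI[OF poly_funs.const[of 0]]) simp
  qed
  then have "(\<lambda>x. x (k, l)) \<in> pull_poly (coords ({..<n} \<times> {..<n})) UNIV ?m"
    by (intro coordinates_polynomial[where M = "\<lambda>x. prd x 0 n * T x" and T = T, OF T(3,5,2) refl _ assms])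
  then show thesis using that by (auto elim!: pull_polyE)
qed

text \<open>The inverse applies the polynomials of \<open>coordinates_from_cell\<close> to the cell
  coordinates, which are quotients on the whole big cell. It is a left inverse by the choice of
  these polynomials, and surjectivity of \<open>phi_map\<close> onto the intersection makes it
  two-sided.\<close>

lemma phi_map_iso:
  "variety_iso (affine_space (hess_inv lam h w))
     (subvariety (flag_variety n) (schubert_cell n w \<inter> Hess n (X_mat n lam) h))
     (phi_map n lam w)"
proof -
  let ?I = "hess_inv lam h w" and ?Y = "schubert_cell n w \<inter> Hess n (X_mat n lam) h"
  let ?G = "\<lambda>x. P * prd (shift x) 0 n"
  have prd_poly: "(\<lambda>x. prd (shift x) 0 m $$ (a, b)) \<in> pull_poly (coords ?I) (affine_pts ?I) (\<lambda>x. x)"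
    if "a < n" "b < n" for a b m
    using that
  proof (induction m arbitrary: a b)
    case 0
    then show ?case by (simp add: pull_poly_const)
  next
    case (Suc m)
    have x: "(\<lambda>x. x i) \<in> pull_poly (coords ?I) (affine_pts ?I) (\<lambda>x. x)" for i
    proof (cases "i \<in> ?I")
      case True
      then have "(\<lambda>x. x i) \<in> poly_funs (coords ?I)" by (intro poly_funs.gen) auto
      then show ?thesis by (rule pull_polyI) simp
    next
      case False
      then show ?thesis by (cases i, intro pull_polyI[OF poly_funs.const[of 0]]) (simp add: affine_pts_def)
    qed
    have N: "(\<lambda>x. N (shift x) m $$ (i, j)) \<in> pull_poly (coords ?I) (affine_pts ?I) (\<lambda>x. x)"
      if "i < n" "j < n" for i j
      using that by (simp add: N_def split_beta) (intro pull_poly_sum x)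
    have "(\<lambda>x. H (shift x) m $$ (i, j)) \<in> pull_poly (coords ?I) (affine_pts ?I) (\<lambda>x. x)"
      if "i < n" "j < n" for i j
      using that N[OF that] by (simp add: H_def pull_poly_add pull_poly_const)
    then have "(\<lambda>x. (H (shift x) m * prd (shift x) 0 m) $$ (a, b)) \<in> pull_poly (coords ?I) (affine_pts ?I) (\<lambda>x. x)"
      using Suc by (intro pull_poly_mat_mult) auto
    then show ?case by simp
  qed
  have G_poly: "(\<lambda>x. c (?G x)) \<in> pull_poly (coords ?I) (affine_pts ?I) (\<lambda>x. x)" if "c \<in> entries n" for c
  proof -
    obtain i j where c: "c = (\<lambda>A. A $$ (i, j))" "i < n" "j < n" using \<open>c \<in> entries n\<close> by blast
    have "(\<lambda>x. ?G x $$ (i, j)) \<in> pull_poly (coords ?I) (affine_pts ?I) (\<lambda>x. x)"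
      by (rule pull_poly_mat_mult[of "\<lambda>_. P"]) (use c prd_poly in \<open>auto simp: pull_poly_const\<close>)
    then show ?thesis unfolding c .
  qed
  have "morphism (affine_space ?I) (GL_variety n) ?G"
    unfolding affine_space_def GL_variety_def
  proof (rule morphism_quasi_affine)
    show "?G x \<in> GL n" for x using perm_mat_GL[OF w] prd_GL by (rule GL_mult)
  qed (rule G_poly)
  then have "morphism (affine_space ?I) (flag_variety n) (phi_map n lam w)"
    unfolding phi_map_eq[abs_def] by (rule morphism_comp) (rule morphism_flag_of)
  then have \<phi>: "morphism (affine_space ?I) (subvariety (flag_variety n) ?Y) (phi_map n lam w)"
    unfolding affine_space_def by (rule morphism_into_subvariety) (rule phi_map_mem)
  define c where "c V = (\<lambda>(i, j). cell_coord n w i j V)" for V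
  have "\<forall>kl. \<exists>F. kl \<in> springer_inv lam w \<longrightarrow> F \<in> poly_funs (coords ({..<n} \<times> {..<n})) \<and>
      (\<forall>x. x kl = F (c (flag_of n (?G x))))"
  proof
    fix kl
    show "\<exists>F. kl \<in> springer_inv lam w \<longrightarrow> F \<in> poly_funs (coords ({..<n} \<times> {..<n})) \<and>
      (\<forall>x. x kl = F (c (flag_of n (?G x))))"
    proof (cases "kl \<in> springer_inv lam w")
      case True
      obtain k' l' where "kl = (k', l')" by (cases kl)
      moreover from this obtain k l where "k' = Suc k" "l' = Suc l"
        using hess_inv_pos True unfolding springer_inv_def by blast
      ultimately have kl: "kl = (Suc k, Suc l)" by simp
      then have "inversion k l" using True springer_inv_Suc_iff by simp
      then obtain F where F: "F \<in> poly_funs (coords ({..<n} \<times> {..<n}))"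
        "\<And>x. x (k, l) = F (\<lambda>(i, j). cell_coord n w i j (flag_of n (P * prd x 0 n)))"
        using coordinates_from_cell by blast
      have "x kl = F (c (flag_of n (?G x)))" for x
        using F(2)[of "shift x"] unfolding kl c_def by simp
      then show ?thesis using F(1) by blast
    qed simp
  qed
  then obtain F where "\<forall>kl. kl \<in> springer_inv lam w \<longrightarrow> F kl \<in> poly_funs (coords ({..<n} \<times> {..<n})) \<and>
      (\<forall>x. x kl = F kl (c (flag_of n (?G x))))" by (rule exE[OF choice])
  then have F: "kl \<in> springer_inv lam w \<Longrightarrow> F kl \<in> poly_funs (coords ({..<n} \<times> {..<n}))"
    "kl \<in> springer_inv lam w \<Longrightarrow> x kl = F kl (c (flag_of n (?G x)))" for kl x by blast+
  define \<psi> where "\<psi> V = (\<lambda>kl. if kl \<in> ?I then F kl (c V) else 0)" for V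
  have \<psi>\<phi>: "\<psi> (phi_map n lam w x) = x" if "x \<in> affine_pts ?I" for x
    unfolding phi_map_eq \<psi>_def
    using that F(2) hess_inv_subset by (intro ext) (auto simp: affine_pts_def)
  have "morphism (subvariety (flag_variety n) ?Y) (affine_space ?I) \<psi>"
  proof (rule morphism_subvariety_to_affine[OF openin_big_cell[OF w]])
    show "?Y \<subseteq> big_cell n w" using schubert_subset_big_cell by auto
    show "\<psi> V \<in> affine_pts ?I" for V by (simp add: \<psi>_def affine_pts_def)
    fix kl assume kl: "kl \<in> ?I"
    have "(\<lambda>V. F kl (c V)) \<in> ratfuns n (big_cell n w)"
    proof (rule ratfuns_poly[where p = "F kl" and \<psi> = c])
      show "F kl \<in> poly_funs (coords ({..<n} \<times> {..<n}))" using F(1) kl hess_inv_subset by blast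
      show "(\<lambda>V. d (c V)) \<in> ratfuns n (big_cell n w)" if "d \<in> coords ({..<n} \<times> {..<n})" for d
        using that cell_coord_ratfuns[OF w] by (auto simp: c_def)
    qed
    then show "(\<lambda>V. \<psi> V kl) \<in> ratfuns n (big_cell n w)" using kl by (simp add: \<psi>_def)
  qed
  moreover have "phi_map n lam w (\<psi> V) = V" if "V \<in> ?Y" for V
    using phi_map_surj[OF that] \<psi>\<phi> by metis
  ultimately show ?thesis unfolding variety_iso_def
    using \<phi> \<psi>\<phi> by (intro conjI exI[of _ \<psi>]) auto
qed

end

section \<open>The affine paving\<close>

lemma regular_restrict:
  assumes f: "regular (quasi_affine C X) U f" and W: "openin (zariski C X) W"
  shows "regular (quasi_affine C X) (U \<inter> W) f"
  unfolding regular_quasi_affine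
proof (intro conjI ballI)
  show "openin (zariski C X) (U \<inter> W)" using f W by (auto simp: regular_quasi_affine)
  fix a assume a: "a \<in> U \<inter> W"
  then obtain N p q where N: "openin (zariski C X) N" "a \<in> N" "N \<subseteq> U"
    "p \<in> poly_funs C" "q \<in> poly_funs C" "\<forall>x \<in> N. q x \<noteq> 0 \<and> f x = p x / q x"
    using f unfolding regular_quasi_affine by (meson IntD1)
  show "\<exists>N p q. openin (zariski C X) N \<and> a \<in> N \<and> N \<subseteq> U \<inter> W \<and>
      p \<in> poly_funs C \<and> q \<in> poly_funs C \<and> (\<forall>x \<in> N. q x \<noteq> 0 \<and> f x = p x / q x)"
    by (rule exI[of _ "N \<inter> W"], rule exI[of _ p], rule exI[of _ q])
      (use N a W in \<open>auto intro: openin_Int\<close>)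
qed

lemma regular_flag_restrict:
  assumes f: "regular (flag_variety n) U f" and W: "openin (flag_top n) W"
  shows "regular (flag_variety n) (U \<inter> W) f"
proof -
  have "{g \<in> GL n. flag_of n g \<in> U \<inter> W} = {g \<in> GL n. flag_of n g \<in> U} \<inter> {g \<in> GL n. flag_of n g \<in> W}"
    by auto
  moreover have "regular (GL_variety n) ({g \<in> GL n. flag_of n g \<in> U} \<inter> {g \<in> GL n. flag_of n g \<in> W})
      (f \<circ> flag_of n)"
    unfolding GL_variety_def
    by (rule regular_restrict) (use f W in \<open>auto simp: flag_variety_def GL_variety_def openin_flag_top\<close>)
  ultimately show ?thesis using f W by (simp add: flag_variety_def openin_Int)
qed

text \<open>The strata of a paving are subvarieties of the Hessenberg variety, whereas the
  parametrization refers to the flag variety. Local extensions are composed; the domain of the first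
  is the trace on \<open>A\<close> of an open set \<open>W\<close>, to which the second is
  restricted.\<close>

lemma subvariety_subvariety:
  assumes "B \<subseteq> A"
  shows "subvariety (subvariety (flag_variety n) A) B = subvariety (flag_variety n) B"
proof -
  have top: "subtopology (subtopology (flag_top n) A) B = subtopology (flag_top n) B"
    using assms by (simp add: subtopology_subtopology inf.absorb2)
  have "regular (subvariety (subvariety (flag_variety n) A) B) U f \<longleftrightarrow>
      regular (subvariety (flag_variety n) B) U f" for U f
  proof
    assume f: "regular (subvariety (subvariety (flag_variety n) A) B) U f"
    show "regular (subvariety (flag_variety n) B) U f" unfolding regular_subvariety
    proof (intro conjI ballI)
      show "openin (subtopology (ztop (flag_variety n)) B) U"
        using f top by (simp add: regular_subvariety[of "subvariety (flag_variety n) A"])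
      then have UB: "U \<subseteq> B" using openin_imp_subset by auto
      fix a assume a: "a \<in> U"
      then obtain N g where N: "a \<in> N" "regular (subvariety (flag_variety n) A) N g" "\<forall>x \<in> N \<inter> U. f x = g x"
        using f unfolding regular_subvariety[of "subvariety (flag_variety n) A"] by meson
      obtain N' g' where N': "a \<in> N'" "regular (flag_variety n) N' g'" "\<forall>x \<in> N' \<inter> N. g x = g' x"
        using N(1,2) unfolding regular_subvariety by meson
      have "openin (subtopology (flag_top n) A) N" using N(2) by (simp add: regular_subvariety)
      then obtain W where W: "openin (flag_top n) W" "N = W \<inter> A" by (auto simp: openin_subtopology)
      show "\<exists>N g. a \<in> N \<and> regular (flag_variety n) N g \<and> (\<forall>x \<in> N \<inter> U. f x = g x)"
      proof (intro exI conjI)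
        show "regular (flag_variety n) (N' \<inter> W) g'" using N'(2) W(1) by (rule regular_flag_restrict)
        show "a \<in> N' \<inter> W" using N(1) N'(1) W(2) by auto
        show "\<forall>x \<in> N' \<inter> W \<inter> U. f x = g' x"
        proof
          fix x assume x: "x \<in> N' \<inter> W \<inter> U"
          then have "x \<in> N" using W(2) UB assms by auto
          then show "f x = g' x" using x N(3) N'(3) by simp
        qed
      qed
    qed
  next
    assume f: "regular (subvariety (flag_variety n) B) U f"
    show "regular (subvariety (subvariety (flag_variety n) A) B) U f"
      unfolding regular_subvariety[of "subvariety (flag_variety n) A"]
    proof (intro conjI ballI)
      show "openin (subtopology (ztop (subvariety (flag_variety n) A)) B) U"
        using f top by (simp add: regular_subvariety)
      then have UB: "U \<subseteq> B" using openin_imp_subset by auto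
      fix a assume a: "a \<in> U"
      then obtain N g where N: "a \<in> N" "regular (flag_variety n) N g" "\<forall>x \<in> N \<inter> U. f x = g x"
        using f unfolding regular_subvariety by meson
      have "openin (flag_top n) N" using N(2) by (simp add: flag_variety_def)
      then have "regular (subvariety (flag_variety n) A) (N \<inter> A) g"
        unfolding regular_subvariety using N(2) by (auto simp: openin_subtopology)
      then show "\<exists>N g. a \<in> N \<and> regular (subvariety (flag_variety n) A) N g \<and> (\<forall>x \<in> N \<inter> U. f x = g x)"
        using N a UB assms by (intro exI[of _ "N \<inter> A"] exI[of _ g]) auto
    qed
  qed
  then have "regular (subvariety (subvariety (flag_variety n) A) B) = regular (subvariety (flag_variety n) B)"
    by (intro ext) simp
  then show ?thesis using top by (intro fun_space.equality) simp_all
qed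

section \<open>Isomorphisms with standard affine spaces\<close>

lemma variety_iso_comp:
  assumes "variety_iso X Y \<phi>" "variety_iso Y Z \<psi>"
  shows "variety_iso X Z (\<lambda>x. \<psi> (\<phi> x))"
proof -
  obtain \<phi>' where \<phi>: "morphism X Y \<phi>" "morphism Y X \<phi>'" "\<forall>x \<in> topspace (ztop X). \<phi>' (\<phi> x) = x"
    "\<forall>y \<in> topspace (ztop Y). \<phi> (\<phi>' y) = y" using assms(1) by (auto simp: variety_iso_def)
  obtain \<psi>' where \<psi>: "morphism Y Z \<psi>" "morphism Z Y \<psi>'" "\<forall>x \<in> topspace (ztop Y). \<psi>' (\<psi> x) = x"
    "\<forall>y \<in> topspace (ztop Z). \<psi> (\<psi>' y) = y" using assms(2) by (auto simp: variety_iso_def)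
  have "\<phi> x \<in> topspace (ztop Y)" if "x \<in> topspace (ztop X)" for x
    using \<phi>(1) that by (auto simp: morphism_def continuous_map_def)
  moreover have "\<psi>' z \<in> topspace (ztop Y)" if "z \<in> topspace (ztop Z)" for z
    using \<psi>(2) that by (auto simp: morphism_def continuous_map_def)
  ultimately show ?thesis unfolding variety_iso_def
    using \<phi> \<psi> by (intro conjI exI[of _ "\<lambda>z. \<phi>' (\<psi>' z)"]) (auto intro: morphism_comp)
qed

text \<open>\<open>affine_cells\<close> wants coordinates numbered by an initial segment of the
  naturals, while the parametrization is indexed by inversions.\<close>

lemma affine_space_reindex:
  assumes b: "bij_betw \<beta> J I"
  shows "variety_iso (affine_space J) (affine_space I)
    (\<lambda>y i. if i \<in> I then y (inv_into J \<beta> i) else 0)"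
proof -
  have mor: "morphism (affine_space A) (affine_space B) (\<lambda>y i. if i \<in> B then y (\<gamma> i) else 0)"
    if "\<gamma> ` B \<subseteq> A" for A :: "'x set" and B :: "'y set" and \<gamma>
    unfolding affine_space_def
  proof (rule morphism_quasi_affine)
    show "(\<lambda>x. c (\<lambda>i. if i \<in> B then x (\<gamma> i) else 0)) \<in> pull_poly (coords A) (affine_pts A) (\<lambda>x. x)"
      if c: "c \<in> coords B" for c
    proof -
      obtain i where i: "i \<in> B" "c = (\<lambda>x. x i)" using c by auto
      then have "(\<lambda>x. x (\<gamma> i)) \<in> poly_funs (coords A)" using \<open>\<gamma> ` B \<subseteq> A\<close> by (intro poly_funs.gen) auto
      then show ?thesis by (rule pull_polyI) (use i in simp)
    qed
  qed (simp add: affine_pts_def)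
  have im: "\<beta> ` J = I" "inv_into J \<beta> ` I = J" "inj_on \<beta> J"
    using b bij_betw_inv_into[OF b] by (auto simp: bij_betw_def)
  let ?\<psi> = "\<lambda>x j. if j \<in> J then x (\<beta> j) else 0"
  show ?thesis unfolding variety_iso_def
  proof (intro conjI exI[of _ ?\<psi>] ballI)
    show "morphism (affine_space J) (affine_space I) (\<lambda>y i. if i \<in> I then y (inv_into J \<beta> i) else 0)"
      by (rule mor) (use im in simp)
    show "morphism (affine_space I) (affine_space J) ?\<psi>" by (rule mor) (use im in simp)
  next
    fix y assume "y \<in> topspace (ztop (affine_space J))"
    then have "y j = 0" if "j \<notin> J" for j using that by (simp add: affine_pts_def)
    then show "?\<psi> (\<lambda>i. if i \<in> I then y (inv_into J \<beta> i) else 0) = y"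
      using im by (intro ext) (auto simp: inv_into_f_f)
  next
    fix x assume "x \<in> topspace (ztop (affine_space I))"
    then have x0: "x i = 0" if "i \<notin> I" for i using that by (simp add: affine_pts_def)
    have "inv_into J \<beta> i \<in> J \<and> \<beta> (inv_into J \<beta> i) = i" if "i \<in> I" for i
      using that im(1) f_inv_into_f[of i \<beta> J] inv_into_into[of i \<beta> J] by auto
    then show "(\<lambda>i. if i \<in> I then ?\<psi> x (inv_into J \<beta> i) else 0) = x"
      using x0 by (intro ext) auto
  qed
qed

lemma disjoint_union_single:
  assumes X: "\<And>U f. regular X U f \<Longrightarrow> openin (ztop X) U"
  shows "variety_iso (disjoint_union {..<1 :: nat} (\<lambda>_. X)) X snd"
proof -
  let ?D = "disjoint_union {..<1 :: nat} (\<lambda>_. X)"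
  have op: "openin (ztop ?D) U \<longleftrightarrow> U \<subseteq> {0} \<times> topspace (ztop X) \<and> openin (ztop X) {x. (0, x) \<in> U}" for U
    by (auto simp: disjoint_union_def openin_sum_topology)
  have top: "topspace (ztop ?D) = {0} \<times> topspace (ztop X)"
    by (auto simp: disjoint_union_def)
  have reg: "regular ?D U f \<longleftrightarrow> openin (ztop ?D) U \<and> regular X {x. (0, x) \<in> U} (\<lambda>x. f (0, x))" for U f
    by (simp add: disjoint_union_def lessThan_Suc)
  have preim: "{x. (0, x) \<in> {q \<in> topspace (ztop ?D). snd q \<in> V}} = V" if "openin (ztop X) V" for V
    using openin_subset[OF that] top by auto
  have snd_open: "openin (ztop ?D) {q \<in> topspace (ztop ?D). snd q \<in> V}" if "openin (ztop X) V" for V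
    unfolding op preim[OF that] using that top by auto
  have inj_open: "{x \<in> topspace (ztop X). (0, x) \<in> U} = {x. (0, x) \<in> U}" if "openin (ztop ?D) U" for U
    using that unfolding op by auto
  show ?thesis unfolding variety_iso_def
  proof (intro conjI exI[of _ "\<lambda>x. (0, x)"] ballI)
    show "morphism ?D X snd" unfolding morphism_def
    proof (intro conjI allI impI)
      show "continuous_map (ztop ?D) (ztop X) snd"
        unfolding continuous_map_def using snd_open top by auto
      fix V f assume f: "regular X V f"
      show "regular ?D {q \<in> topspace (ztop ?D). snd q \<in> V} (f \<circ> snd)"
        unfolding reg preim[OF X[OF f]] using snd_open[OF X[OF f]] f by (simp add: o_def)
    qed
    show "morphism X ?D (\<lambda>x. (0, x))" unfolding morphism_def
    proof (intro conjI allI impI)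
      show "continuous_map (ztop X) (ztop ?D) (\<lambda>x. (0, x))"
        unfolding continuous_map_def using inj_open top op by auto
      fix V f assume f: "regular ?D V f"
      then have "openin (ztop ?D) V" unfolding reg by blast
      then show "regular X {x \<in> topspace (ztop X). (0, x) \<in> V} (f \<circ> (\<lambda>x. (0, x)))"
        using f inj_open unfolding reg by (simp add: o_def)
    qed
  next
    fix q assume "q \<in> topspace (ztop ?D)"
    then have "fst q = 0" unfolding top by (simp add: mem_Times_iff)
    then show "(0, snd q) = q" by (simp add: prod_eq_iff)
  qed simp
qed

text \<open>The empty variety is the disjoint union of no affine spaces. It occurs at the bottom of
  the filtration and for Schubert cells that miss the Hessenberg variety.\<close>

lemma affine_cells_empty:
  assumes "topspace (ztop Y) = {}"
    and "\<And>U f. openin (ztop Y) U \<Longrightarrow> U = {} \<Longrightarrow> regular Y U f"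
  shows "affine_cells Y {}"
proof -
  let ?D = "disjoint_union {..<0 :: nat} (\<lambda>j. affine_space {..<(0 :: nat)})"
  have top: "topspace (ztop ?D) = {}" by (simp add: disjoint_union_def)
  have "regular ?D {} f" for f by (simp add: disjoint_union_def)
  then have "variety_iso ?D Y (\<lambda>_. undefined)"
    unfolding variety_iso_def morphism_def continuous_map_def
    using assms top by (auto intro!: exI[of _ "\<lambda>_. undefined"])
  then show ?thesis unfolding affine_cells_def
    by (intro exI[of _ 0] exI[of _ "\<lambda>_. 0"] exI[of _ "\<lambda>_. undefined"]) simp
qed

lemma affine_cells_single:
  assumes iso: "variety_iso (affine_space I) Y \<phi>" and I: "finite I"
  shows "affine_cells Y {topspace (ztop Y)}"
proof -
  obtain \<beta> where \<beta>: "bij_betw \<beta> {..<card I} I"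
    using ex_bij_betw_nat_finite[OF I] by (auto simp: atLeast0LessThan)
  let ?X = "affine_space {..<card I}" and ?\<rho> = "\<lambda>y i. if i \<in> I then y (inv_into {..<card I} \<beta> i) else 0"
  have 1: "variety_iso (disjoint_union {..<1 :: nat} (\<lambda>_. ?X)) ?X snd"
    by (rule disjoint_union_single) (simp add: affine_space_def regular_quasi_affine)
  have 2: "variety_iso ?X Y (\<lambda>y. \<phi> (?\<rho> y))"
    by (rule variety_iso_comp[OF affine_space_reindex[OF \<beta>] iso])
  let ?\<phi> = "\<lambda>q. \<phi> (?\<rho> (snd q))"
  have 3: "variety_iso (disjoint_union {..<1 :: nat} (\<lambda>_. ?X)) Y ?\<phi>"
    by (rule variety_iso_comp[OF 1 2])
  have "(\<lambda>y. \<phi> (?\<rho> y)) ` affine_pts {..<card I} = topspace (ztop Y)"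
  proof -
    obtain \<psi> where \<psi>: "morphism ?X Y (\<lambda>y. \<phi> (?\<rho> y))" "morphism Y ?X \<psi>"
      "\<forall>y \<in> topspace (ztop Y). \<phi> (?\<rho> (\<psi> y)) = y" using 2 by (auto simp: variety_iso_def)
    have "\<phi> (?\<rho> y) \<in> topspace (ztop Y)" if "y \<in> affine_pts {..<card I}" for y
      using \<psi>(1) that by (auto simp: morphism_def continuous_map_def)
    moreover have "\<psi> y \<in> affine_pts {..<card I}" if "y \<in> topspace (ztop Y)" for y
      using \<psi>(2) that by (auto simp: morphism_def continuous_map_def)
    ultimately show ?thesis using \<psi>(3) by (auto intro!: image_eqI[of _ _ "\<psi> _"])
  qed
  moreover have "?\<phi> ` ({j} \<times> affine_pts {..<card I}) = (\<lambda>y. \<phi> (?\<rho> y)) ` affine_pts {..<card I}" for j :: nat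
  proof -
    have "{j} \<times> affine_pts {..<card I} = Pair j ` affine_pts {..<card I}" by auto
    then show ?thesis by (simp only: image_image snd_conv)
  qed
  ultimately have "{topspace (ztop Y)} = (\<lambda>j. ?\<phi> ` ({j} \<times> affine_pts {..<card I})) ` {..<1 :: nat}"
    by (simp add: lessThan_Suc)
  then show ?thesis unfolding affine_cells_def using 3
    by (intro exI[of _ 1] exI[of _ "\<lambda>_. card I"] exI[of _ ?\<phi>]) simp
qed

lemma hessenberg_springer_fun: "hessenberg_fun n springer_fun"
  by (auto simp: hessenberg_fun_def springer_fun_def mono_on_def)

lemma finite_hess_inv:
  assumes "filling n lam w"
  shows "finite (hess_inv lam h w)"
proof (rule finite_subset)
  interpret filling n lam w by fact
  show "hess_inv lam h w \<subseteq> {..n} \<times> {..n}"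
  proof
    fix kl assume kl: "kl \<in> hess_inv lam h w"
    obtain k l where "kl = (Suc k, Suc l)" using hess_inv_pos kl by (metis surj_pair)
    then show "kl \<in> {..n} \<times> {..n}" using kl hess_inv_Suc_iff by auto
  qed
qed simp

text \<open>Closedness comes from open sets. With the permutations sorted by height, a big cell
  meets only cells that do not stand earlier in the list, so the big cells from position
  \<open>i\<close> on cut out exactly the complement of the first \<open>i\<close> cells.\<close>

lemma Hess_paving:
  assumes n: "n > 0" and h: "hessenberg_fun n h" and lam: "sum_list lam = n"
  shows "\<exists>d Z. affine_paving (subvariety (flag_variety n) (Hess n (X_mat n lam) h)) d Z
        {schubert_cell n w \<inter> Hess n (X_mat n lam) h | w.
           w permutes {1..n} \<and> schubert_cell n w \<inter> Hess n (X_mat n lam) h \<noteq> {}}"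
proof -
  let ?H = "Hess n (X_mat n lam) h" and ?S = "{w. w permutes {1..n}}"
  have fill: "filling n lam w" if "w \<in> ?S" for w
    using that n lam by unfold_locales auto
  have big: "schubert_cell n w \<inter> ?H \<subseteq> big_cell n w" if w: "w \<in> ?S" for w
  proof
    fix V assume V: "V \<in> schubert_cell n w \<inter> ?H"
    interpret filling n lam w by (rule fill[OF w])
    interpret hess_filling n lam w h
      by unfold_locales (use h schubert_Hess_strict[OF h] V in auto)
    show "V \<in> big_cell n w" using schubert_subset_big_cell V by blast
  qed
  have "finite ?S" by (rule finite_permutations) simp
  then obtain xs where xs: "set xs = ?S" "distinct xs" using finite_distinct_list by blast
  define ws where "ws = sort_key (cell_height n) xs"
  have ws: "set ws = ?S" "distinct ws" "sorted (map (cell_height n) ws)"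
    using xs by (simp_all add: ws_def)
  let ?d = "length ws"
  define C where "C i = schubert_cell n (ws ! i) \<inter> ?H" for i
  have perm: "ws ! i permutes {1..n}" if "i < ?d" for i using nth_mem[OF that] ws(1) by simp
  \<comment> \<open>Ties in the sorting are harmless: a big cell meets a cell of the same height
    only if the permutations agree.\<close>
  have sep: "j \<le> k" if "j < ?d" "k < ?d" "V \<in> big_cell n (ws ! j)" "V \<in> C k" for j k V
  proof (rule ccontr)
    assume "\<not> j \<le> k"
    then have "cell_height n (ws ! k) \<le> cell_height n (ws ! j)"
      using ws(3) that by (auto simp: sorted_iff_nth_mono)
    moreover have "V \<in> schubert_cell n (ws ! k)" using that(4) by (simp add: C_def)
    ultimately have "ws ! j = ws ! k"
      using big_cell_meets_schubert[OF perm[OF that(1)] perm[OF that(2)] that(3)] by simp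
    then show False using ws(2) that(1,2) \<open>\<not> j \<le> k\<close> nth_eq_iff_index_eq by blast
  qed
  have Cbig: "C i \<subseteq> big_cell n (ws ! i)" if "i < ?d" for i
    using big[of "ws ! i"] perm[OF that] by (simp add: C_def)
  have disj: "j = k" if "j < ?d" "k < ?d" "V \<in> C j" "V \<in> C k" for j k V
    using sep[of j k V] sep[of k j V] Cbig that by force
  have cover: "\<exists>i<?d. V \<in> C i" if "V \<in> ?H" for V
  proof -
    have "V \<in> Flags n" using that by (simp add: Hess_def)
    then obtain w where "w permutes {1..n}" "V \<in> schubert_cell n w" by (rule Flags_schubert_cell)
    moreover from this obtain i where "i < ?d" "ws ! i = w" using ws(1) by (metis in_set_conv_nth mem_Collect_eq)
    ultimately show ?thesis using that by (auto simp: C_def)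
  qed
  \<comment> \<open>\<open>Z 0\<close> is empty, so the indices run from 0 to \<open>?d\<close> and
    the stratum with index \<open>Suc i\<close> is \<open>C i\<close>. An empty \<open>C i\<close>
    gives an empty stratum that contributes no cell.\<close>
  define Z where "Z i = (\<Union>j<i. C j)" for i
  have HF: "?H \<subseteq> Flags n" by (auto simp: Hess_def)
  note top = topspace_flag_top[of n]
  let ?Y = "subvariety (flag_variety n) ?H"
  have closed: "closedin (ztop ?Y) (Z i)" if i: "i \<le> ?d" for i
  proof -
    let ?U = "\<Union>j\<in>{i..<?d}. big_cell n (ws ! j)"
    have "?H - Z i = ?U \<inter> ?H"
    proof (intro equalityI subsetI)
      fix V assume V: "V \<in> ?H - Z i"
      then obtain j where j: "j < ?d" "V \<in> C j" using cover by blast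
      then have "i \<le> j" using V by (force simp: Z_def)
      then show "V \<in> ?U \<inter> ?H" using V j Cbig by fastforce
    next
      fix V assume V: "V \<in> ?U \<inter> ?H"
      then obtain j where j: "i \<le> j" "j < ?d" "V \<in> big_cell n (ws ! j)" by auto
      have "V \<notin> C k" if "k < i" for k
        using sep[OF j(2) _ j(3), of k] that i j(1) by auto
      then show "V \<in> ?H - Z i" using V by (auto simp: Z_def)
    qed
    moreover have "openin (flag_top n) ?U"
      using perm by (intro openin_Union) (auto intro!: openin_big_cell)
    ultimately have "openin (subtopology (flag_top n) ?H) (?H - Z i)"
      by (auto simp: openin_subtopology)
    moreover have "Z i \<subseteq> ?H" by (auto simp: Z_def C_def)
    ultimately show ?thesis using HF top by (simp add: closedin_def inf.absorb2)
  qed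
  have "Z ?d = ?H" using cover unfolding Z_def C_def by blast
  then have Zd: "Z ?d = topspace (ztop ?Y)" using HF top by auto
  have Zmono: "Z i \<subseteq> Z (Suc i)" for i by (auto simp: Z_def lessThan_Suc)
  have diff: "Z (Suc i) - Z i = C i" if i: "i < ?d" for i
  proof -
    have "V \<notin> C j" if "V \<in> C i" "j < i" for V j
      using disj[of j i V] that i by auto
    then show ?thesis by (auto simp: Z_def lessThan_Suc)
  qed
  have empty: "affine_cells (subvariety ?Y {}) {}"
    by (rule affine_cells_empty) (simp_all add: regular_subvariety)
  define cs where "cs i = (if i = 0 \<or> C (i - 1) = {} then {} else {C (i - 1)})" for i
  have cells: "affine_cells (subvariety ?Y (C i)) (cs (Suc i))" if i: "i < ?d" for i
  proof (cases "C i = {}")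
    case True
    then show ?thesis using empty by (simp add: cs_def)
  next
    case False
    then obtain V where V: "V \<in> C i" by blast
    interpret filling n lam "ws ! i" by (rule fill) (use perm[OF i] in simp)
    interpret hess_filling n lam "ws ! i" h
      by unfold_locales (use h schubert_Hess_strict[OF h] V in \<open>auto simp: C_def\<close>)
    have sub: "subvariety ?Y (C i) = subvariety (flag_variety n) (C i)"
      by (rule subvariety_subvariety) (simp add: C_def)
    have "C i \<subseteq> Flags n" using HF by (auto simp: C_def)
    then have "topspace (ztop (subvariety (flag_variety n) (C i))) = C i" using top by auto
    moreover have "filling n lam (ws ! i)" by unfold_locales
    ultimately have "affine_cells (subvariety (flag_variety n) (C i)) {C i}"
      using affine_cells_single[OF phi_map_iso finite_hess_inv] by (simp add: C_def)
    then show ?thesis using False sub by (simp add: cs_def)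
  qed
  have cellset: "{schubert_cell n w \<inter> ?H | w. w permutes {1..n} \<and> schubert_cell n w \<inter> ?H \<noteq> {}} = (\<Union>i\<le>?d. cs i)"
  proof (intro equalityI subsetI)
    fix D assume "D \<in> {schubert_cell n w \<inter> ?H | w. w permutes {1..n} \<and> schubert_cell n w \<inter> ?H \<noteq> {}}"
    then obtain w where w: "w permutes {1..n}" "schubert_cell n w \<inter> ?H \<noteq> {}" "D = schubert_cell n w \<inter> ?H"
      by blast
    then obtain i where "i < ?d" "ws ! i = w" using ws(1) by (metis in_set_conv_nth mem_Collect_eq)
    then have "D \<in> cs (Suc i)" "Suc i \<le> ?d" using w by (auto simp: cs_def C_def)
    then show "D \<in> (\<Union>i\<le>?d. cs i)" by blast
  next
    fix D assume "D \<in> (\<Union>i\<le>?d. cs i)"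
    then obtain i where "i \<le> ?d" "D \<in> cs i" by blast
    then have "i \<noteq> 0" "C (i - 1) \<noteq> {}" "D = C (i - 1)" "i - 1 < ?d" by (auto simp: cs_def split: if_splits)
    then show "D \<in> {schubert_cell n w \<inter> ?H | w. w permutes {1..n} \<and> schubert_cell n w \<inter> ?H \<noteq> {}}"
      using perm[of "i - 1"] unfolding C_def by blast
  qed
  have "affine_paving ?Y ?d Z (\<Union>i\<le>?d. cs i)" unfolding affine_paving_def
  proof (intro conjI allI impI exI[of _ cs] refl)
    fix i assume i: "i \<le> ?d"
    show "affine_cells (subvariety ?Y (Z i - (if i = 0 then {} else Z (i - 1)))) (cs i)"
    proof (cases i)
      case 0
      then show ?thesis using empty by (simp add: Z_def cs_def)
    next
      case (Suc j)
      then show ?thesis using cells[of j] diff[of j] i by simp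
    qed
  qed (use closed Zd Zmono in simp_all)
  then show ?thesis unfolding cellset by blast
qed

theorem theorem5p7:
  fixes n :: nat and h :: "nat \<Rightarrow> nat" and lam :: "nat list"
  assumes "n > 0"
    and "hessenberg_fun n h"
    and "sum_list lam = n"
  shows
    "(\<forall>w. w permutes {1..n} \<and> R_filling lam w \<in> RS h lam \<longrightarrow>
        (\<forall>V \<in> D_set n lam w. \<forall>g x.
           V = flag_of n (gprod n w g) \<and>
           (\<forall>k \<in> {2..n}. g k \<in> B_sub n lam w k \<and> has_coords n lam w k x (g k)) \<longrightarrow>
           (V \<in> Hess n (X_mat n lam) h \<longleftrightarrow>
             (\<forall>(k, l) \<in> springer_inv lam w - hess_inv lam h w. x (k, l) = 0))) \<and>
        variety_iso (affine_space (springer_inv lam w))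
          (subvariety (flag_variety n) (schubert_cell n w \<inter> springer_fiber n (X_mat n lam)))
          (phi_map n lam w) \<and>
        affine_pts (hess_inv lam h w) =
          {x \<in> affine_pts (springer_inv lam w).
             \<forall>p \<in> springer_inv lam w - hess_inv lam h w. x p = 0} \<and>
        variety_iso (affine_space (hess_inv lam h w))
          (subvariety (flag_variety n) (schubert_cell n w \<inter> Hess n (X_mat n lam) h))
          (phi_map n lam w)) \<and>
     (\<exists>d Z. affine_paving (subvariety (flag_variety n) (Hess n (X_mat n lam) h)) d Z
        {schubert_cell n w \<inter> Hess n (X_mat n lam) h | w.
           w permutes {1..n} \<and> schubert_cell n w \<inter> Hess n (X_mat n lam) h \<noteq> {}})"
proof (intro conjI allI impI)
  fix w assume strict_w: "w permutes {1..n} \<and> R_filling lam w \<in> RS h lam"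
  interpret filling n lam w using assms strict_w by unfold_locales auto
  have strict: "l < h (Suc r)" if "nbr n lam w l r" for l r
  proof -
    have "h_strict h lam (R_filling lam w)" using strict_w unfolding RS_def by blast
    then show ?thesis using h_strict_iff that by blast
  qed
  interpret hess_filling n lam w h
    by unfold_locales (use assms strict in auto)
  \<comment> \<open>The Springer fiber is the case \<open>h i = i - 1\<close>, and the rows are
    strictly increasing. The parametrization of its cell is therefore the same result in a second
    interpretation, whose Hessenberg inversions are the Springer inversions.\<close>
  interpret sp: hess_filling n lam w springer_fun
    by unfold_locales (use hessenberg_springer_fun E_strict in \<open>auto simp: springer_fun_def\<close>)
  show "\<forall>V \<in> D_set n lam w. \<forall>g x.
           V = flag_of n (gprod n w g) \<and>
           (\<forall>k \<in> {2..n}. g k \<in> B_sub n lam w k \<and> has_coords n lam w k x (g k)) \<longrightarrow>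
           (V \<in> Hess n (X_mat n lam) h \<longleftrightarrow>
             (\<forall>(k, l) \<in> springer_inv lam w - hess_inv lam h w. x (k, l) = 0))"
  proof (intro ballI allI impI)
    fix V g x assume "V = flag_of n (gprod n w g) \<and>
      (\<forall>k \<in> {2..n}. g k \<in> B_sub n lam w k \<and> has_coords n lam w k x (g k))"
    then show "V \<in> Hess n (X_mat n lam) h \<longleftrightarrow>
        (\<forall>(k, l) \<in> springer_inv lam w - hess_inv lam h w. x (k, l) = 0)"
      using gprod_eq[of x g] Hess_iff[of x] by simp
  qed
  show "variety_iso (affine_space (springer_inv lam w))
          (subvariety (flag_variety n) (schubert_cell n w \<inter> springer_fiber n (X_mat n lam)))
          (phi_map n lam w)"
    unfolding springer_inv_def by (rule sp.phi_map_iso)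
  show "affine_pts (hess_inv lam h w) =
          {x \<in> affine_pts (springer_inv lam w).
             \<forall>p \<in> springer_inv lam w - hess_inv lam h w. x p = 0}"
    using hess_inv_subset by (fastforce simp: affine_pts_def)
  show "variety_iso (affine_space (hess_inv lam h w))
          (subvariety (flag_variety n) (schubert_cell n w \<inter> Hess n (X_mat n lam) h))
          (phi_map n lam w)"
    by (rule phi_map_iso)
qed (rule Hess_paving[OF assms])

end
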